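(* Let $n\ge2$ be an integer and let $Z_{\mathbf{S}^n}(s)$ be the spectral zeta-function defined in the context. Then for any $n/2-1/4<\sigma_1<\sigma_2<n/2$, the function $Z_{\mathbf{S}^n}(s)$ has $\asymp T$ zeros in the rectangle $\sigma_1<\sigma<\sigma_2$, $0<t<T$; that is, there are constants $0<C_1<C_2$ such that for all sufficiently large $T$ the number $N(T)$ of zeros (with multiplicity) in this rectangle satisfies $C_1T\le N(T)\le C_2T$.
   Context: For $k\in\mathbb{N}$ let $m_k=\frac{(2k+n-1)(k+n-2)!}{k!\,(n-1)!}$ (the multiplicity of the eigenvalue $k(k+n-1)$ of the Laplacian on the $n$-sphere $\mathbf{S}^n$) and $\lambda_k=k(k+n-1)+\left(\frac{n-1}{2}\right)^2=\left(k+\frac{n-1}{2}\right)^2$. Define $Z_{\mathbf{S}^n}(s)=\sum_{k=1}^\infty m_k\lambda_k^{-s}$, which converges absolutely for $\Re(s)>n/2$, and is continued meromorphically to $\mathbb{C}$ (it equals a finite combination of Dirichlet polynomials times shifted Riemann zeta-functions plus Dirichlet polynomials; e.g. $Z_{\mathbf{S}^2}(s)=(2^{2s}-2)\zeta(2s-1)-4^s$, $Z_{\mathbf{S}^3}(s)=\zeta(2s-2)-1$). *)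

theory Defs
  imports "HOL-Complex_Analysis.Complex_Analysis"
begin

text \<open>The truncated subtractions below are exact in the intended range \<open>n \<ge> 2\<close>.\<close>

definition sphere_mult :: "nat \<Rightarrow> nat \<Rightarrow> real" where
  "sphere_mult n k =
     real (2 * k + n - 1) * fact (k + n - 2) / (fact k * fact (n - 1))"

definition sphere_eigenvalue :: "nat \<Rightarrow> nat \<Rightarrow> real" where
  "sphere_eigenvalue n k = real k * (real k + real n - 1) + ((real n - 1) / 2)\<^sup>2"

definition sphere_zeta_series :: "nat \<Rightarrow> complex \<Rightarrow> complex" where
  "sphere_zeta_series n s =
     (\<Sum>\<^sub>\<infinity>k\<in>{1..}. of_real (sphere_mult n k) * of_real (sphere_eigenvalue n k) powr (-s))"

text \<open>
  A nicely meromorphic function is analytic off its poles and takes the value 0 at them, so a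
  meromorphic continuation to the whole plane is unique as a function in this class
  (\<open>nicely_meromorphic_continuation_unique\<close>).
\<close>

definition is_sphere_zeta :: "nat \<Rightarrow> (complex \<Rightarrow> complex) \<Rightarrow> bool" where
  "is_sphere_zeta n f \<longleftrightarrow> f nicely_meromorphic_on UNIV \<and>
     (\<forall>s. Re s > real n / 2 \<longrightarrow> f s = sphere_zeta_series n s)"

definition sphere_zeta :: "nat \<Rightarrow> complex \<Rightarrow> complex" where
  "sphere_zeta n = (THE f. is_sphere_zeta n f)"

definition zeros_in_rect ::
    "(complex \<Rightarrow> complex) \<Rightarrow> real \<Rightarrow> real \<Rightarrow> real \<Rightarrow> complex set" where
  "zeros_in_rect f \<sigma>1 \<sigma>2 T =
     {z. \<sigma>1 < Re z \<and> Re z < \<sigma>2 \<and> 0 < Im z \<and> Im z < T \<and> \<not> is_pole f z \<and> f z = 0}"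

text \<open>
  The condition \<open>\<not> is_pole f z\<close> above excludes the conventional value 0 at a pole.
  If there are infinitely many zeros, the sum below is 0 by convention, so a positive lower bound
  on it entails that the set of zeros is finite.
\<close>

definition zero_count :: "(complex \<Rightarrow> complex) \<Rightarrow> real \<Rightarrow> real \<Rightarrow> real \<Rightarrow> int" where
  "zero_count f \<sigma>1 \<sigma>2 T = (\<Sum>z\<in>zeros_in_rect f \<sigma>1 \<sigma>2 T. zorder f z)"

lemma nicely_meromorphic_continuation_unique:
  assumes f: "f nicely_meromorphic_on UNIV" and g: "g nicely_meromorphic_on UNIV"
    and eq: "\<And>s. Re s > c \<Longrightarrow> f s = g s"
  shows "f = g"
proof
  fix z
  define d where "d = (\<lambda>w. f w - g w)"
  define r where "r = remove_sings d"
  have d: "d meromorphic_on UNIV"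
    using f g unfolding d_def nicely_meromorphic_on_def by (intro meromorphic_intros) auto
  have r: "r nicely_meromorphic_on UNIV"
    unfolding r_def by (rule remove_sings_nicely_meromorphic[OF d])
  have r0: "r s = 0" if "Re s > c" for s
  proof -
    have "open {s. Re s > c}" by (rule open_halfspace_Re_gt)
    hence "\<forall>\<^sub>F w in at s. w \<in> {s. Re s > c}"
      using that by (intro eventually_at_in_open') auto
    hence "\<forall>\<^sub>F w in at s. d w = 0"
      by eventually_elim (auto simp: d_def eq)
    hence "d \<midarrow>s\<rightarrow> 0" by (simp add: tendsto_eventually)
    thus ?thesis unfolding r_def by (rule remove_sings_eqI)
  qed
  have ne: "{s. Re s > c} \<noteq> {}"
    by (auto intro!: exI[of _ "of_real (c + 1)"])
  have "r constant_on {s. Re s > c}"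
    using r0 unfolding constant_on_def by blast
  hence "r constant_on UNIV"
    by (rule constant_on_extend_nicely_meromorphic_on[OF r])
       (use ne in \<open>auto simp: open_halfspace_Re_gt\<close>)
  hence "r w = 0" for w
    using r0[of "of_real (c + 1)"] by (auto simp: constant_on_def)
  moreover have "\<forall>\<^sub>F w in at z. r w = d w"
    unfolding r_def using d
    by (intro eventually_remove_sings_eq_at)
       (auto intro: meromorphic_on_isolated_singularity meromorphic_on_subset)
  ultimately have ev: "\<forall>\<^sub>F w in at z. f w = g w"
    by (auto simp: d_def elim: eventually_mono)
  have F: "(is_pole f z \<and> f z = 0) \<or> f \<midarrow>z\<rightarrow> f z" and G: "(is_pole g z \<and> g z = 0) \<or> g \<midarrow>z\<rightarrow> g z"
    using f g by (auto simp: nicely_meromorphic_on_def)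
  have P: "is_pole f z \<longleftrightarrow> is_pole g z"
    using ev by (intro is_pole_cong) auto
  have L: "f \<midarrow>z\<rightarrow> l \<longleftrightarrow> g \<midarrow>z\<rightarrow> l" for l
    using ev by (intro tendsto_cong)
  have N: "\<not> is_pole g z" if "g \<midarrow>z\<rightarrow> l" for l
    using that not_tendsto_and_filterlim_at_infinity[of "at z" g l] by (auto simp: is_pole_def)
  show "f z = g z"
    using F G P L N LIM_unique by metis
qed

lemma sphere_zeta_eqI: "is_sphere_zeta n f \<Longrightarrow> sphere_zeta n = f"
  unfolding sphere_zeta_def is_sphere_zeta_def
  by (intro the_equality nicely_meromorphic_continuation_unique[where c = "real n / 2"]) auto

end

theory Submission imports Defs "HOL-Real_Asymp.Real_Asymp" begin

text \<open>
  Put \<open>w = 2 s - (n - 1)\<close>. In the strip \<open>1/2 < Re w < 1\<close> the zeta function of the sphere is, up to a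
  factor without zeros, \<open>\<zeta>(w) - V(w)\<close>, where \<open>V(w) = \<Sum>m. v m * m powr (-w)\<close> has nonnegative
  coefficients and converges absolutely even for \<open>Re w = 1/2\<close>: the multiplicities are
  \<open>y ^ (n - 1) * (1 + O(y powr (-2)))\<close> in terms of \<open>y = 2 k + n - 1\<close>. With the alternating zeta function
  \<open>\<eta>\<close>, put \<open>\<xi>(w) = \<eta>(w) - (1 - 2 powr (1 - w)) * V(w)\<close>, which has the same zeros.

  Upper bound: Jensen's inequality on discs of fixed radius centred on a line on which \<open>\<xi>\<close> is bounded
  away from 0 bounds the number of zeros near height \<open>\<tau>\<close> by a mean value of \<open>\<bar>\<xi>\<bar>\<^sup>2\<close>, and the mean
  square of \<open>\<xi>\<close> on a vertical line to the right of \<open>1/2\<close> is \<open>O(T)\<close>.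

  Lower bound: choose signs for the primes such that, with the induced completely multiplicative
  function \<open>g\<close> in place of the twist by \<open>m powr (-i \<tau>)\<close>, the function
  \<open>1 - V\<^sub>g(w) * (\<Prod>p. 1 - g p * p powr (-w))\<close> has a real zero between \<open>\<alpha>\<close> and \<open>\<beta>\<close>. If
  \<open>p powr (-i \<tau>)\<close> is close to \<open>g p\<close> for all small primes, and the contribution of the integers without
  small prime factors to \<open>\<eta>(w + i \<tau>)\<close> is small, then \<open>\<xi>\<close> has a zero near \<open>w + i \<tau>\<close>. Both conditions
  hold for a positive proportion of \<open>\<tau>\<close>: use \<open>\<bar>\<Sum>d dvd Q ^ N. g d * d powr (-i \<tau>)\<bar>\<^sup>2\<close> as a weight, where
  \<open>Q\<close> is the product of the small primes. For large \<open>N\<close> it concentrates on the \<open>\<tau>\<close> of the first kind,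
  and it is orthogonal to the integers coprime to \<open>Q\<close>, so the second condition holds on average.
\<close>

section \<open>The alternating zeta function\<close>

text \<open>The bound \<sigma> > n/2 - 1/4 is Re w > 1/2, where mean squares on vertical lines are
  still O(T); the pole of zeta at w = 1 is the reason for \<eta>, which is entire. Two obstacles
  shape the lower bound. The sum of p^(-\<sigma>) over the primes diverges for \<sigma> \<le> 1,
  which gives the freedom to make products over primes large or small, but also prevents convergence
  for general signs. Signs that alternate along the primes from some point on restore convergence to
  the right of 1/2, and the limit is holomorphic with isolated zeros, so an intermediate value
  argument on the real axis yields a circle on which a small perturbation keeps the zero. The second
  obstacle is to meet finitely many conditions on \<tau> together. They are added up into one
  nonnegative function that must fall below 1; its weighted mean is a combination of second moments,
  and these need no more than trivial bounds for off-diagonal terms. The index m = 1 lies outside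
  the spectral sum, so V has the coefficient 1 there; this keeps the twisted series away from 0 on
  the real axis and lets the prime product decide the sign.\<close>

fun fdiff :: "nat \<Rightarrow> complex \<Rightarrow> real \<Rightarrow> complex" where
  "fdiff 0 s x = of_real x powr (-s)"
| "fdiff (Suc k) s x = fdiff k s x - fdiff k s (x + 1)"

lemma has_vector_derivative_fdiff:
  assumes "x > 0"
  shows "(fdiff k s has_vector_derivative (- s * fdiff k (s + 1) x)) (at x)"
  using assms
proof (induction k arbitrary: x)
  case 0
  have "((\<lambda>z. z powr (-s)) has_field_derivative (-s) * of_real x powr (-s - 1)) (at (of_real x))"
    using 0 by (intro has_field_derivative_powr) (auto simp: complex_nonpos_Reals_iff)
  from has_vector_derivative_real_field[OF this]
  have "((\<lambda>y. of_real y powr (-s)) has_vector_derivative (- s * of_real x powr (-s - 1))) (at x)" .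
  moreover have "- (s + 1) = - s - 1" by simp
  ultimately show ?case by (simp only: fdiff.simps(1)[abs_def])
next
  case (Suc k)
  have "((\<lambda>x. x + 1) has_vector_derivative 1) (at x)"
    by (auto intro!: derivative_eq_intros)
  from vector_diff_chain_at[OF this Suc.IH[of "x + 1"]]
  have "((\<lambda>x. fdiff k s (x + 1)) has_vector_derivative (- s * fdiff k (s + 1) (x + 1))) (at x)"
    using Suc.prems by (simp add: o_def)
  from has_vector_derivative_diff[OF Suc.IH[OF Suc.prems] this]
  show ?case by (simp add: algebra_simps)
qed

text \<open>By the mean value theorem on [x, x + 1] each difference costs one derivative, that is, a
  factor |s + i| / x. The condition on Re s + k makes the final exponent nonpositive, so the unknown
  intermediate point may be replaced by x.\<close>

lemma norm_fdiff_le: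
  assumes "x > 0" "Re s + real k \<ge> 0"
  shows "norm (fdiff k s x) \<le> (\<Prod>i<k. norm (s + of_nat i)) * x powr (- Re s - real k)"
  using assms
proof (induction k arbitrary: s x)
  case 0
  thus ?case by (simp add: norm_powr_real_powr)
next
  case (Suc k)
  have cont: "continuous_on {x..x+1} (fdiff k s)"
  proof (rule continuous_on_vector_derivative)
    fix y assume "y \<in> {x..x+1}"
    thus "(fdiff k s has_vector_derivative (- s * fdiff k (s + 1) y)) (at y within {x..x+1})"
      using Suc.prems by (intro has_vector_derivative_at_within[OF has_vector_derivative_fdiff]) auto
  qed
  have "\<exists>y\<in>{x<..<x+1}. norm (fdiff k s (x+1) - fdiff k s x)
          \<le> norm ((\<lambda>h. h *\<^sub>R (- s * fdiff k (s + 1) y)) (x + 1 - x))"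
    using cont Suc.prems
    by (intro mvt_general has_vector_derivative_fdiff[unfolded has_vector_derivative_def]) auto
  then obtain y where y: "x < y" "y < x + 1"
    and le: "norm (fdiff k s (x+1) - fdiff k s x) \<le> norm s * norm (fdiff k (s + 1) y)"
    by (auto simp: norm_mult)
  have "norm (fdiff (Suc k) s x) \<le> norm s * norm (fdiff k (s + 1) y)"
    using le by (simp add: norm_minus_commute)
  also have "\<dots> \<le> norm s * ((\<Prod>i<k. norm (s + 1 + of_nat i)) * y powr (- Re (s + 1) - real k))"
    using Suc.prems y by (intro mult_left_mono Suc.IH) auto
  also have "\<dots> \<le> norm s * ((\<Prod>i<k. norm (s + 1 + of_nat i)) * x powr (- Re (s + 1) - real k))"
    using Suc.prems y by (intro mult_left_mono powr_mono2') (auto intro!: prod_nonneg)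
  also have "\<dots> = (\<Prod>i<Suc k. norm (s + of_nat i)) * x powr (- Re s - real (Suc k))"
  proof -
    have e: "- Re (s + 1) - real k = - Re s - real (Suc k)" by simp
    show ?thesis unfolding e by (subst prod.lessThan_Suc_shift) (simp add: add_ac mult_ac)
  qed
  finally show ?case .
qed

lemma norm_fdiff_le_power:
  assumes "x > 0" "Re s + real k \<ge> 0" "norm s + real k \<le> R" "q \<le> Re s" "x \<ge> 1"
  shows "norm (fdiff k s x) \<le> R ^ k * x powr (- q - real k)"
proof -
  have "norm (s + of_nat i) \<le> R" if "i < k" for i
    using norm_triangle_ineq[of s "of_nat i"] that assms(3) by simp
  hence "(\<Prod>i<k. norm (s + of_nat i)) \<le> (\<Prod>i<k. R)"
    by (intro prod_mono) auto
  hence P: "(\<Prod>i<k. norm (s + of_nat i)) \<le> R ^ k" by simp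
  have R: "R \<ge> 0" using assms(3) norm_ge_zero[of s] by linarith
  have "norm (fdiff k s x) \<le> (\<Prod>i<k. norm (s + of_nat i)) * x powr (- Re s - real k)"
    using assms by (intro norm_fdiff_le)
  also have "\<dots> \<le> R ^ k * x powr (- q - real k)"
    using assms R P by (intro mult_mono powr_mono) auto
  finally show ?thesis .
qed

lemma fdiff_holomorphic [holomorphic_intros]:
  assumes "x > 0"
  shows "(\<lambda>s. fdiff k s x) holomorphic_on A"
  using assms by (induction k arbitrary: x) (auto intro!: holomorphic_intros)

text \<open>The \<open>k\<close>-fold Euler transform of the alternating series \<open>\<Sum>m. (-1)^m (x + m) powr (-s)\<close>.\<close>

definition euler_alt :: "nat \<Rightarrow> real \<Rightarrow> complex \<Rightarrow> complex" where
  "euler_alt k x s =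
     (\<Sum>j<k. fdiff j s x / 2 ^ (j + 1)) + (\<Sum>m. (-1) ^ m * fdiff k s (x + real m)) / 2 ^ k"

lemma summable_shift_powr:
  assumes "x \<ge> 1" "p > 1"
  shows "summable (\<lambda>m. (x + real m) powr (-p))"
proof (rule summable_comparison_test')
  show "summable (\<lambda>m. real m powr (-p))"
    using assms by (simp add: summable_real_powr_iff)
  show "norm ((x + real m) powr (-p)) \<le> real m powr (-p)" if "m \<ge> 1" for m
    using that assms by (auto intro!: powr_mono2')
qed

lemma summable_norm_fdiff:
  assumes "x \<ge> 1" "Re s + real k > 1"
  shows "summable (\<lambda>m. norm (fdiff k s (x + real m)))"
proof (rule summable_comparison_test')
  show "summable (\<lambda>m. (\<Prod>i<k. norm (s + of_nat i)) * (x + real m) powr (- (Re s + real k)))"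
    using assms by (intro summable_mult summable_shift_powr) auto
  show "norm (norm (fdiff k s (x + real m)))
          \<le> (\<Prod>i<k. norm (s + of_nat i)) * (x + real m) powr (- (Re s + real k))" for m
    using norm_fdiff_le[of "x + real m" s k] assms by simp
qed

lemma summable_alt_fdiff:
  assumes "x \<ge> 1" "Re s + real k > 1"
  shows "summable (\<lambda>m. (-1) ^ m * fdiff k s (x + real m))"
  by (rule summable_norm_cancel) (use summable_norm_fdiff[OF assms] in \<open>simp add: norm_mult norm_power\<close>)

lemma alt_fdiff_shift:
  assumes "x \<ge> 1" "Re s + real k > 1"
  shows "(\<Sum>m. (-1) ^ m * fdiff k s (x + real m)) =
           fdiff k s x - (\<Sum>m. (-1) ^ m * fdiff k s (x + 1 + real m))"
proof -
  have "(\<Sum>m. (-1) ^ m * fdiff k s (x + real m)) =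
          (\<Sum>m. (-1) ^ Suc m * fdiff k s (x + real (Suc m))) + (-1) ^ 0 * fdiff k s (x + real 0)"
    using suminf_split_head[OF summable_alt_fdiff[OF assms]] by simp
  also have "(\<lambda>m. (-1) ^ Suc m * fdiff k s (x + real (Suc m))) =
               (\<lambda>m. - ((-1) ^ m * fdiff k s (x + 1 + real m)))"
    by (auto simp: add_ac)
  also have "(\<Sum>m. - ((-1) ^ m * fdiff k s (x + 1 + real m))) =
               - (\<Sum>m. (-1) ^ m * fdiff k s (x + 1 + real m))"
    using assms by (intro suminf_minus summable_alt_fdiff) auto
  finally show ?thesis by simp
qed

text \<open>Subtracting the series shifted by one place gives twice the alternating series minus its
  first term; the powers of 2 in \<open>euler_alt\<close> record this halving.\<close>

lemma euler_alt_Suc: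
  assumes "x \<ge> 1" "Re s + real k > 1"
  shows "euler_alt (Suc k) x s = euler_alt k x s"
proof -
  have "(\<Sum>m. (-1) ^ m * fdiff (Suc k) s (x + real m)) =
          (\<Sum>m. (-1) ^ m * fdiff k s (x + real m)) - (\<Sum>m. (-1) ^ m * fdiff k s (x + 1 + real m))"
    using assms
    using summable_alt_fdiff[of x s k] summable_alt_fdiff[of "x + 1" s k]
    by (subst suminf_diff) (auto simp: algebra_simps)
  also have "\<dots> = 2 * (\<Sum>m. (-1) ^ m * fdiff k s (x + real m)) - fdiff k s x"
    using alt_fdiff_shift[OF assms] by simp
  finally have "(\<Sum>m. (-1) ^ m * fdiff (Suc k) s (x + real m)) / 2 ^ Suc k =
      (\<Sum>m. (-1) ^ m * fdiff k s (x + real m)) / 2 ^ k - fdiff k s x / 2 ^ (k + 1)"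
    by (simp add: field_simps del: fdiff.simps)
  thus ?thesis
    unfolding euler_alt_def by (simp del: fdiff.simps)
qed

lemma euler_alt_shift:
  assumes "x \<ge> 1" "Re s + real k > 1"
  shows "euler_alt k x s = of_real x powr (-s) - euler_alt k (x + 1) s"
proof -
  \<comment> \<open>The finite corrections at x and x + 1 add up to a telescoping sum: the j-th
    differences at x and x + 1 together are twice the one at x minus the next difference.\<close>
  have A: "(\<Sum>j<k. fdiff j s x / 2 ^ (j + 1)) + (\<Sum>j<k. fdiff j s (x + 1) / 2 ^ (j + 1)) =
             fdiff 0 s x - fdiff k s x / 2 ^ k"
  proof (induction k)
    case (Suc k)
    have "fdiff k s x / 2 ^ (k + 1) + fdiff k s (x + 1) / 2 ^ (k + 1) =
            fdiff k s x / 2 ^ k - fdiff (Suc k) s x / 2 ^ Suc k"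
      by (simp add: field_simps)
    moreover have "(\<Sum>j<Suc k. fdiff j s x / 2 ^ (j + 1)) + (\<Sum>j<Suc k. fdiff j s (x + 1) / 2 ^ (j + 1)) =
      ((\<Sum>j<k. fdiff j s x / 2 ^ (j + 1)) + (\<Sum>j<k. fdiff j s (x + 1) / 2 ^ (j + 1))) +
      (fdiff k s x / 2 ^ (k + 1) + fdiff k s (x + 1) / 2 ^ (k + 1))"
      by (simp add: algebra_simps)
    ultimately show ?case unfolding Suc.IH by (simp del: fdiff.simps)
  qed auto
  have B: "(\<Sum>m. (-1) ^ m * fdiff k s (x + 1 + real m)) =
             fdiff k s x - (\<Sum>m. (-1) ^ m * fdiff k s (x + real m))"
    using alt_fdiff_shift[OF assms] by simp
  show ?thesis using A unfolding euler_alt_def B by (simp add: field_simps)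
qed

lemma euler_alt_eq:
  assumes "x \<ge> 1" "Re s + real k > 1" "Re s + real l > 1"
  shows "euler_alt k x s = euler_alt l x s"
proof -
  have *: "euler_alt (k + d) x s = euler_alt k x s" if "Re s + real k > 1" for k d
    using that by (induction d) (auto simp: euler_alt_Suc assms(1))
  show ?thesis
    using *[of k "l - k"] *[of l "k - l"] assms by (cases "k \<le> l") auto
qed

text \<open>k \<ge> 2 - Re s suffices for absolute convergence (for Re s \<ge> 2 the ceiling is cut
  off at 0 and no Euler step is made). All admissible k agree by \<open>euler_alt_eq\<close>, so
  near any point a single k serves, which makes \<open>eta\<close> entire.\<close>

definition eta :: "complex \<Rightarrow> complex" where
  "eta s = euler_alt (nat \<lceil>2 - Re s\<rceil>) 1 s"

lemma eta_eq_euler_alt: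
  assumes "Re s + real k > 1"
  shows "eta s = euler_alt k 1 s"
proof -
  have "Re s + real (nat \<lceil>2 - Re s\<rceil>) > 1" by linarith
  thus ?thesis unfolding eta_def using assms by (intro euler_alt_eq) auto
qed

lemma euler_alt_holomorphic:
  "euler_alt k 1 holomorphic_on {s. Re s + real k > 1}"
proof -
  have op: "open {s::complex. Re s + real k > 1}"
    using open_halfspace_Re_gt[of "1 - real k"] by (simp add: algebra_simps)
  have "(\<lambda>s. \<Sum>m. (-1) ^ m * fdiff k s (1 + real m)) holomorphic_on {s. Re s + real k > 1}"
  proof (rule holomorphic_uniform_sequence[OF op])
    show "(\<lambda>s. \<Sum>m<n. (-1) ^ m * fdiff k s (1 + real m)) holomorphic_on {s. Re s + real k > 1}" for n
      by (intro holomorphic_intros) auto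
  next
    fix s :: complex assume s: "s \<in> {s. Re s + real k > 1}"
    define d where "d = (Re s + real k - 1) / 2"
    have d: "d > 0" using s by (simp add: d_def)
    have near: "Re s - d \<le> Re z" "norm z \<le> norm s + d" if "z \<in> cball s d" for z
    proof -
      have "norm (s - z) \<le> d" using that by (simp add: dist_norm)
      moreover have "\<bar>Re (s - z)\<bar> \<le> norm (s - z)" by (rule abs_Re_le_cmod)
      ultimately show "Re s - d \<le> Re z" by auto
      show "norm z \<le> norm s + d"
        using \<open>norm (s - z) \<le> d\<close> norm_triangle_ineq2[of z s] by (simp add: norm_minus_commute)
    qed
    have 1: "cball s d \<subseteq> {s. Re s + real k > 1}"
      using near(1) s by (force simp: d_def field_simps)
    have 2: "uniform_limit (cball s d) (\<lambda>n z. \<Sum>m<n. (-1) ^ m * fdiff k z (1 + real m))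
               (\<lambda>z. \<Sum>m. (-1) ^ m * fdiff k z (1 + real m)) sequentially"
    proof (rule Weierstrass_m_test)
      show "summable (\<lambda>m. (norm s + d + real k) ^ k * (1 + real m) powr (- (Re s - d + real k)))"
        using s by (intro summable_mult summable_shift_powr) (auto simp: d_def field_simps)
      fix m z assume z: "z \<in> cball s d"
      show "norm ((- 1) ^ m * fdiff k z (1 + real m))
              \<le> (norm s + d + real k) ^ k * (1 + real m) powr (- (Re s - d + real k))"
        using norm_fdiff_le_power[of "1 + real m" z k "norm s + d + real k" "Re s - d"]
              near[OF z] 1 z by (force simp: norm_mult norm_power)
    qed
    show "\<exists>d>0. cball s d \<subseteq> {s. Re s + real k > 1} \<and>
            uniform_limit (cball s d) (\<lambda>n z. \<Sum>m<n. (-1) ^ m * fdiff k z (1 + real m))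
               (\<lambda>z. \<Sum>m. (-1) ^ m * fdiff k z (1 + real m)) sequentially"
      using d 1 2 by blast
  qed
  thus ?thesis
    unfolding euler_alt_def[abs_def] by (intro holomorphic_intros) auto
qed

lemma eta_holomorphic: "eta holomorphic_on A"
proof -
  have "eta field_differentiable (at s)" for s
  proof -
    define k where "k = nat \<lceil>2 - Re s\<rceil>"
    have s: "Re s + real k > 1" unfolding k_def by linarith
    have op: "open {s::complex. Re s + real k > 1}"
      using open_halfspace_Re_gt[of "1 - real k"] by (simp add: algebra_simps)
    have "eta holomorphic_on {s. Re s + real k > 1}"
      using euler_alt_holomorphic[of k]
      by (rule holomorphic_transform) (auto simp: eta_eq_euler_alt)
    thus ?thesis using op s by (auto simp: holomorphic_on_open field_differentiable_def)
  qed
  thus ?thesis by (auto simp: holomorphic_on_def intro: field_differentiable_at_within)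
qed

text \<open>The remainder after N terms is again an Euler transform, started at N + 1; this is the
  reason for the base point x in \<open>euler_alt\<close>.\<close>

lemma eta_partial_sum:
  assumes "Re s + real k > 1"
  shows "eta s = (\<Sum>m=1..N. (-1) ^ (m + 1) * of_nat m powr (-s)) + (-1) ^ N * euler_alt k (real N + 1) s"
proof (induction N)
  case 0
  thus ?case using eta_eq_euler_alt[OF assms] by simp
next
  case (Suc N)
  have "euler_alt k (real N + 1) s = of_real (real N + 1) powr (-s) - euler_alt k (real N + 1 + 1) s"
    by (rule euler_alt_shift) (use assms in auto)
  moreover have "(-1) ^ N * of_real (real N + 1) powr (-s) = (-1) ^ (Suc N + 1) * of_nat (Suc N) powr (-s)"
    by (simp add: add_ac)
  ultimately show ?case using Suc by (simp add: ring_distribs add_ac)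
qed

lemma sums_eta:
  assumes "Re s > 1"
  shows "(\<lambda>m. (-1) ^ m * of_nat (Suc m) powr (-s)) sums eta s"
proof -
  have "eta s = euler_alt 0 1 s" using assms by (intro eta_eq_euler_alt) auto
  also have "\<dots> = (\<Sum>m. (-1) ^ m * fdiff 0 s (1 + real m))" by (simp add: euler_alt_def)
  finally have "(\<lambda>m. (-1) ^ m * fdiff 0 s (1 + real m)) sums eta s"
    using summable_alt_fdiff[of 1 s 0] assms by (simp add: summable_sums del: fdiff.simps)
  thus ?thesis by (simp add: add_ac)
qed

text \<open>For x = N + 1 large one has |s| + k \<le> x^\<theta> with 1/\<kappa> < \<theta> < 1, so
  each difference gains x^(\<theta> - 1) and every term of the finite correction is at most x^(-c).
  In the remaining series (1 + m)^(-2) is split off for summability; the factor x^2 lost in this way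
  is paid for by choosing (1 - \<theta>) k \<ge> 2.\<close>

lemma eta_approx:
  fixes \<kappa> c :: real
  assumes "\<kappa> > 1" "c > 0"
  obtains C N0 where "\<And>N s. N \<ge> N0 \<Longrightarrow> Re s \<ge> c \<Longrightarrow> norm s powr \<kappa> \<le> real N \<Longrightarrow>
    norm (eta s - (\<Sum>m=1..N. (-1) ^ (m + 1) * of_nat m powr (-s))) \<le> C * (real N + 1) powr (-c)"
proof -
  define \<theta> where "\<theta> = (1 / \<kappa> + 1) / 2"
  have "1 / \<kappa> < 1" using assms by simp
  hence \<theta>: "1 / \<kappa> < \<theta>" "\<theta> < 1" unfolding \<theta>_def by simp_all
  define k where "k = nat \<lceil>2 / (1 - \<theta>)\<rceil> + 2"
  have "real k \<ge> 2 / (1 - \<theta>)" unfolding k_def by linarith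
  hence k: "(1 - \<theta>) * real k \<ge> 2" using \<theta>(2) by (simp add: divide_le_eq mult.commute)
  have k2: "k \<ge> 2" by (simp add: k_def)
  define K where "K = (\<Sum>m. (1 + real m) powr (-2))"
  have sK: "summable (\<lambda>m. (1 + real m) powr (-2))"
    by (rule summable_shift_powr) auto
  have "K \<ge> 0" unfolding K_def by (rule suminf_nonneg[OF sK]) simp
  have "((\<lambda>x::real. (x powr (1/\<kappa>) + real k) / x powr \<theta>) \<longlongrightarrow> 0) at_top"
    using \<theta> assms by real_asymp
  hence "eventually (\<lambda>x::real. (x powr (1/\<kappa>) + real k) / x powr \<theta> < 1) at_top"
    by (rule order_tendstoD) auto
  hence "eventually (\<lambda>x::real. (x powr (1/\<kappa>) + real k) / x powr \<theta> < 1 \<and> x > 0) at_top"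
    using eventually_gt_at_top[of 0] by eventually_elim auto
  then obtain x0 where x0: "\<And>x. x \<ge> x0 \<Longrightarrow> (x powr (1/\<kappa>) + real k) / x powr \<theta> < 1 \<and> x > 0"
    unfolding eventually_at_top_linorder by blast
  show ?thesis
  proof (rule that[of "nat \<lceil>x0\<rceil>" "real k + K"])
    fix N :: nat and s :: complex
    assume N: "N \<ge> nat \<lceil>x0\<rceil>" and s: "Re s \<ge> c" "norm s powr \<kappa> \<le> real N"
    define x where "x = real N + 1"
    have x1: "x \<ge> 1" by (simp add: x_def)
    have "x \<ge> x0" using N unfolding x_def by linarith
    from x0[OF this] have xk: "x powr (1/\<kappa>) + real k \<le> x powr \<theta>"
      using x1 by (simp add: divide_less_eq)
    have "norm s = (norm s powr \<kappa>) powr (1 / \<kappa>)"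
      using assms by (simp add: powr_powr)
    also have "\<dots> \<le> x powr (1 / \<kappa>)"
      using s assms by (intro powr_mono2) (auto simp: x_def)
    finally have R: "norm s + real k \<le> x powr \<theta>" using xk by linarith
    have bd: "norm (fdiff j s y) \<le> (x powr \<theta>) ^ j * y powr (- c - real j)" if "j \<le> k" "y \<ge> 1" for j y
      using that s R assms by (intro norm_fdiff_le_power) auto
    have pw: "(x powr \<theta>) ^ j = x powr (\<theta> * real j)" for j
      using x1 powr_realpow[of "x powr \<theta>" j] by (simp add: powr_powr)
    have sums: "norm (\<Sum>j<k. fdiff j s x / 2 ^ (j + 1)) \<le> real k * x powr (-c)"
    proof -
      have "norm (\<Sum>j<k. fdiff j s x / 2 ^ (j + 1)) \<le> (\<Sum>j<k. x powr (-c))"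
      proof (rule order.trans[OF norm_sum], rule sum_mono)
        fix j assume j: "j \<in> {..<k}"
        have "norm (fdiff j s x / 2 ^ (j + 1)) \<le> norm (fdiff j s x)"
          using divide_left_mono[of 1 "2 ^ (j + 1)" "norm (fdiff j s x)"] one_le_power[of "2::real" "j + 1"]
          by (simp add: norm_divide norm_power del: power_Suc)
        also have "\<dots> \<le> (x powr \<theta>) ^ j * x powr (- c - real j)"
          using j x1 by (intro bd) auto
        also have "\<dots> = x powr (\<theta> * real j) * x powr (- c - real j)"
          by (simp only: pw)
        also have "\<dots> = x powr (\<theta> * real j - c - real j)"
          by (subst powr_add [symmetric]) (simp add: algebra_simps)
        also have "\<dots> \<le> x powr (-c)"
          using x1 \<theta> mult_right_mono[of \<theta> 1 "real j"] by (intro powr_mono) simp_all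
        finally show "norm (fdiff j s x / 2 ^ (j + 1)) \<le> x powr (-c)" .
      qed
      thus ?thesis by simp
    qed
    have tail: "norm (\<Sum>m. (-1) ^ m * fdiff k s (x + real m)) \<le> K * x powr (-c)"
    proof -
      have le: "norm ((-1) ^ m * fdiff k s (x + real m)) \<le> x powr (-c) * (1 + real m) powr (-2)" for m
      proof -
        have "norm ((-1) ^ m * fdiff k s (x + real m)) = norm (fdiff k s (x + real m))"
          by (simp add: norm_mult norm_power)
        also have "\<dots> \<le> (x powr \<theta>) ^ k * (x + real m) powr (- c - real k)"
          using x1 by (intro bd) auto
        also have "(x + real m) powr (- c - real k) = (x + real m) powr (- c - real k + 2) * (x + real m) powr (-2)"
          by (subst powr_add [symmetric]) simp
        also have "\<dots> \<le> x powr (- c - real k + 2) * (1 + real m) powr (-2)"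
          using x1 k2 assms by (intro mult_mono powr_mono2') auto
        also have "(x powr \<theta>) ^ k * (x powr (- c - real k + 2) * (1 + real m) powr (-2)) =
                     x powr (\<theta> * real k) * x powr (- c - real k + 2) * (1 + real m) powr (-2)"
          by (simp only: pw)
        also have "\<dots> = x powr (\<theta> * real k - c - real k + 2) * (1 + real m) powr (-2)"
          by (subst powr_add [symmetric]) (simp add: algebra_simps)
        also have "\<dots> \<le> x powr (-c) * (1 + real m) powr (-2)"
          using x1 k by (intro mult_right_mono powr_mono) (simp_all add: left_diff_distrib)
        finally show ?thesis by (simp add: mult_left_mono)
      qed
      have "norm (\<Sum>m. (-1) ^ m * fdiff k s (x + real m)) \<le> (\<Sum>m. x powr (-c) * (1 + real m) powr (-2))"
        by (intro norm_suminf_le le summable_mult sK)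
      also have "\<dots> = K * x powr (-c)" unfolding K_def using suminf_mult[OF sK, of "x powr (-c)"]
        by (simp add: mult_ac)
      finally show ?thesis .
    qed
    have "eta s - (\<Sum>m=1..N. (-1) ^ (m + 1) * of_nat m powr (-s)) = (-1) ^ N * euler_alt k x s"
      using eta_partial_sum[of s k N] s assms k2 by (simp add: x_def)
    hence "norm (eta s - (\<Sum>m=1..N. (-1) ^ (m + 1) * of_nat m powr (-s))) = norm (euler_alt k x s)"
      by (simp add: norm_mult norm_power)
    also have "\<dots> \<le> norm (\<Sum>j<k. fdiff j s x / 2 ^ (j + 1)) + norm ((\<Sum>m. (-1) ^ m * fdiff k s (x + real m)) / 2 ^ k)"
      unfolding euler_alt_def by (rule norm_triangle_ineq)
    also have "norm ((\<Sum>m. (-1) ^ m * fdiff k s (x + real m)) / 2 ^ k) \<le> norm (\<Sum>m. (-1) ^ m * fdiff k s (x + real m)) / 1"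
      using divide_left_mono[of 1 "2 ^ k" "norm (\<Sum>m. (-1) ^ m * fdiff k s (x + real m))"]
      by (simp add: norm_divide norm_power)
    finally show "norm (eta s - (\<Sum>m=1..N. (-1) ^ (m + 1) * of_nat m powr (-s))) \<le> (real k + K) * (real N + 1) powr (-c)"
      using sums tail by (simp add: x_def algebra_simps)
  qed
qed

text \<open>
  Partial sums of length just above the height of \<open>s\<close> suffice. As \<open>\<kappa>\<close> is arbitrarily close to 1, the
  off-diagonal terms \<open>N powr (2 - 2 * c + \<epsilon>)\<close> in their mean square are then \<open>o(T)\<close> for \<open>c > 1/2\<close>.
\<close>

definition dirichlet_approx :: "(nat \<Rightarrow> complex) \<Rightarrow> (complex \<Rightarrow> complex) \<Rightarrow> bool" where
  "dirichlet_approx a f \<longleftrightarrow> (\<forall>\<kappa>>1. \<forall>c>0. \<forall>e>0. \<exists>N0. \<forall>N\<ge>N0. \<forall>s.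
     Re s \<ge> c \<longrightarrow> norm s powr \<kappa> \<le> real N \<longrightarrow>
     norm (f s - (\<Sum>m=1..N. a m * of_nat m powr (-s))) < e)"

lemma dirichlet_approxE:
  assumes "dirichlet_approx a f" "\<kappa> > 1" "c > 0" "e > 0"
  obtains N0 where "\<And>N s. N \<ge> N0 \<Longrightarrow> Re s \<ge> c \<Longrightarrow> norm s powr \<kappa> \<le> real N \<Longrightarrow>
    norm (f s - (\<Sum>m=1..N. a m * of_nat m powr (-s))) < e"
  using assms(1)[unfolded dirichlet_approx_def, rule_format, OF assms(2-4)] by (auto intro: that)

section \<open>Dilated coefficients and sieving by finitely many primes\<close>

definition coeff_shift :: "nat \<Rightarrow> (nat \<Rightarrow> complex) \<Rightarrow> nat \<Rightarrow> complex" where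
  "coeff_shift d a m = (if d dvd m then a (m div d) else 0)"

lemma of_nat_mult_powr:
  "(of_nat (d * m) :: complex) powr s = of_nat d powr s * of_nat m powr s"
  unfolding of_nat_mult by (rule powr_times_real) auto

lemma sum_coeff_shift:
  assumes "d \<ge> 1"
  shows "(\<Sum>m=1..N. coeff_shift d a m * of_nat m powr (-s)) =
           of_nat d powr (-s) * (\<Sum>m=1..N div d. a m * of_nat m powr (-s))"
proof -
  have "(\<Sum>m=1..N. coeff_shift d a m * of_nat m powr (-s)) =
          (\<Sum>m\<in>{m\<in>{1..N}. d dvd m}. a (m div d) * of_nat m powr (-s))"
    by (rule sum.mono_neutral_cong_right) (auto simp: coeff_shift_def)
  also have "\<dots> = (\<Sum>m=1..N div d. of_nat d powr (-s) * (a m * of_nat m powr (-s)))"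
  proof (rule sum.reindex_bij_witness[of _ "\<lambda>m. d * m" "\<lambda>m. m div d"])
    fix m assume "m \<in> {m\<in>{1..N}. d dvd m}"
    then obtain k where k: "m = d * k" "1 \<le> m" "m \<le> N" by auto
    show "d * (m div d) = m" using k by simp
    show "m div d \<in> {1..N div d}"
      using k assms by (auto simp: Suc_le_eq less_eq_div_iff_mult_less_eq mult.commute)
    show "of_nat d powr (-s) * (a (m div d) * of_nat (m div d) powr (-s)) = a (m div d) * of_nat m powr (-s)"
      using k assms by (simp add: of_nat_mult_powr[unfolded of_nat_mult] mult_ac)
  next
    fix m assume m: "m \<in> {1..N div d}"
    show "d * m div d = m" using assms by simp
    have "d * m \<le> d * (N div d)" using m by simp
    also have "\<dots> \<le> N" by simp
    finally show "d * m \<in> {m\<in>{1..N}. d dvd m}" using m assms by auto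
  qed
  finally show ?thesis by (simp add: sum_distrib_left)
qed

lemma dirichlet_approx_eta: "dirichlet_approx (\<lambda>m. (-1) ^ (m + 1)) eta"
  unfolding dirichlet_approx_def
proof (intro allI impI)
  fix \<kappa> c e :: real assume kce: "\<kappa> > 1" "c > 0" "e > 0"
  show "\<exists>N0. \<forall>N\<ge>N0. \<forall>s. Re s \<ge> c \<longrightarrow> norm s powr \<kappa> \<le> real N \<longrightarrow>
     norm (eta s - (\<Sum>m=1..N. (-1) ^ (m + 1) * of_nat m powr (-s))) < e"
  proof (rule eta_approx[OF kce(1,2)])
  fix C N0
  assume N0: "\<And>N s. N \<ge> N0 \<Longrightarrow> Re s \<ge> c \<Longrightarrow> norm s powr \<kappa> \<le> real N \<Longrightarrow>
    norm (eta s - (\<Sum>m=1..N. (-1) ^ (m + 1) * of_nat m powr (-s))) \<le> C * (real N + 1) powr (-c)"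
  have "((\<lambda>N. C * (real N + 1) powr (-c)) \<longlongrightarrow> 0) sequentially"
    using kce by real_asymp
  hence "\<forall>\<^sub>F N in sequentially. C * (real N + 1) powr (-c) < e"
    using kce by (intro order_tendstoD) auto
  then obtain N1 where N1: "\<And>N. N \<ge> N1 \<Longrightarrow> C * (real N + 1) powr (-c) < e"
    unfolding eventually_sequentially by blast
  have "norm (eta s - (\<Sum>m=1..N. (-1) ^ (m + 1) * of_nat m powr (-s))) < e"
    if "N \<ge> max N0 N1" "Re s \<ge> c" "norm s powr \<kappa> \<le> real N" for N s
    using order.strict_trans1[OF N0 N1] that by simp
  thus "\<exists>N0. \<forall>N\<ge>N0. \<forall>s. Re s \<ge> c \<longrightarrow> norm s powr \<kappa> \<le> real N \<longrightarrow>
     norm (eta s - (\<Sum>m=1..N. (-1) ^ (m + 1) * of_nat m powr (-s))) < e" by blast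
  qed
qed

lemma dirichlet_approx_cong:
  assumes "dirichlet_approx a f" "\<And>m. m \<ge> 1 \<Longrightarrow> a m = b m" "\<And>s. f s = g s"
  shows "dirichlet_approx b g"
proof -
  have "(\<Sum>m=1..N. a m * of_nat m powr (-s)) = (\<Sum>m=1..N. b m * of_nat m powr (-s))" for N s
    using assms(2) by (intro sum.cong) auto
  moreover have "f = g" using assms(3) by auto
  ultimately show ?thesis using assms(1) by (simp add: dirichlet_approx_def)
qed

lemma dirichlet_approx_diff:
  assumes "dirichlet_approx a f" "dirichlet_approx b g"
  shows "dirichlet_approx (\<lambda>m. a m - b m) (\<lambda>s. f s - g s)"
  unfolding dirichlet_approx_def
proof (intro allI impI)
  fix \<kappa> c e :: real assume kce: "\<kappa> > 1" "c > 0" "e > 0"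
  hence e2: "e / 2 > 0" by simp
  obtain N0 where N0: "\<And>N s. N \<ge> N0 \<Longrightarrow> Re s \<ge> c \<Longrightarrow> norm s powr \<kappa> \<le> real N \<Longrightarrow>
    norm (f s - (\<Sum>m=1..N. a m * of_nat m powr (-s))) < e / 2"
    by (rule dirichlet_approxE[OF assms(1) kce(1,2) e2]) blast
  obtain N1 where N1: "\<And>N s. N \<ge> N1 \<Longrightarrow> Re s \<ge> c \<Longrightarrow> norm s powr \<kappa> \<le> real N \<Longrightarrow>
    norm (g s - (\<Sum>m=1..N. b m * of_nat m powr (-s))) < e / 2"
    by (rule dirichlet_approxE[OF assms(2) kce(1,2) e2]) blast
  have "norm (f s - g s - (\<Sum>m=1..N. (a m - b m) * of_nat m powr (-s))) < e"
    if "N \<ge> max N0 N1" "Re s \<ge> c" "norm s powr \<kappa> \<le> real N" for N s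
  proof -
    have "f s - g s - (\<Sum>m=1..N. (a m - b m) * of_nat m powr (-s)) =
      (f s - (\<Sum>m=1..N. a m * of_nat m powr (-s))) - (g s - (\<Sum>m=1..N. b m * of_nat m powr (-s)))"
      by (simp add: left_diff_distrib sum_subtractf)
    also have "norm \<dots> \<le> norm (f s - (\<Sum>m=1..N. a m * of_nat m powr (-s))) + norm (g s - (\<Sum>m=1..N. b m * of_nat m powr (-s)))"
      by (rule norm_triangle_ineq4)
    also have "\<dots> < e" using N0[of N s] N1[of N s] that by simp
    finally show ?thesis .
  qed
  thus "\<exists>N0. \<forall>N\<ge>N0. \<forall>s. Re s \<ge> c \<longrightarrow> norm s powr \<kappa> \<le> real N \<longrightarrow>
     norm (f s - g s - (\<Sum>m=1..N. (a m - b m) * of_nat m powr (-s))) < e" by blast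
qed

text \<open>Dilation by d turns the cutoff N into \<open>N div d\<close>. An exponent \<kappa>'
  strictly between 1 and \<kappa> absorbs the loss, as N^(\<kappa>'/\<kappa>) is eventually below
  N/d - 1; the factor d^(-s) has modulus at most 1.\<close>

lemma dirichlet_approx_shift:
  assumes "dirichlet_approx a f" "d \<ge> 1"
  shows "dirichlet_approx (coeff_shift d a) (\<lambda>s. of_nat d powr (-s) * f s)"
  unfolding dirichlet_approx_def
proof (intro allI impI)
  fix \<kappa> c e :: real assume kce: "\<kappa> > 1" "c > 0" "e > 0"
  define \<kappa>' where "\<kappa>' = (\<kappa> + 1) / 2"
  have \<kappa>': "\<kappa>' > 1" "\<kappa>' < \<kappa>" using kce by (auto simp: \<kappa>'_def)
  obtain N0 where N0: "\<And>N s. N \<ge> N0 \<Longrightarrow> Re s \<ge> c \<Longrightarrow> norm s powr \<kappa>' \<le> real N \<Longrightarrow>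
    norm (f s - (\<Sum>m=1..N. a m * of_nat m powr (-s))) < e"
    by (rule dirichlet_approxE[OF assms(1) \<kappa>'(1) kce(2,3)]) blast
  have "\<forall>\<^sub>F x::real in at_top. x powr (\<kappa>' / \<kappa>) \<le> x / real d - 1"
  proof -
    have "((\<lambda>x::real. x powr (\<kappa>' / \<kappa>) / (x / real d - 1)) \<longlongrightarrow> 0) at_top"
    proof -
      have "\<kappa>' / \<kappa> < 1" "real d > 0" using kce \<kappa>' assms by auto
      thus ?thesis by real_asymp
    qed
    hence "\<forall>\<^sub>F x::real in at_top. x powr (\<kappa>' / \<kappa>) / (x / real d - 1) < 1"
      by (rule order_tendstoD) auto
    thus ?thesis using eventually_gt_at_top[of "real d"]
    proof eventually_elim
      case (elim x)
      hence "x / real d - 1 > 0" using assms by (simp add: field_simps)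
      thus ?case using elim by (simp add: divide_less_eq)
    qed
  qed
  then obtain x0 where x0: "\<And>x. x \<ge> x0 \<Longrightarrow> x powr (\<kappa>' / \<kappa>) \<le> x / real d - 1"
    unfolding eventually_at_top_linorder by blast
  have "norm (of_nat d powr (-s) * f s - (\<Sum>m=1..N. coeff_shift d a m * of_nat m powr (-s))) < e"
    if "N \<ge> max (d * N0) (nat \<lceil>x0\<rceil>)" and s: "Re s \<ge> c" "norm s powr \<kappa> \<le> real N" for N s
  proof -
    have N: "N \<ge> d * N0" "real N \<ge> x0" using that by linarith+
    have "N div d \<ge> N0" using N(1) assms by (simp add: less_eq_div_iff_mult_less_eq mult.commute)
    moreover have "norm s powr \<kappa>' \<le> real (N div d)"
    proof -
      have "norm s powr \<kappa>' = (norm s powr \<kappa>) powr (\<kappa>' / \<kappa>)"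
        using kce by (simp add: powr_powr)
      also have "\<dots> \<le> real N powr (\<kappa>' / \<kappa>)"
        using s kce \<kappa>' by (intro powr_mono2) auto
      also have "\<dots> \<le> real N / real d - 1" by (rule x0) fact
      also have "\<dots> \<le> real (N div d)"
      proof -
        have "N < d + d * (N div d)" using assms by (intro dividend_less_times_div) auto
        hence "real N < real (d + d * (N div d))" by (simp only: of_nat_less_iff)
        thus ?thesis using assms by (simp add: field_simps)
      qed
      finally show ?thesis .
    qed
    ultimately have *: "norm (f s - (\<Sum>m=1..N div d. a m * of_nat m powr (-s))) < e"
      using s by (intro N0)
    have "norm ((of_nat d :: complex) powr (-s)) \<le> 1"
      using s kce assms powr_mono[of "- Re s" 0 "real d"] by (simp add: norm_powr_real_powr)
    hence "norm ((of_nat d :: complex) powr (-s) * (f s - (\<Sum>m=1..N div d. a m * of_nat m powr (-s)))) \<le>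
        norm (f s - (\<Sum>m=1..N div d. a m * of_nat m powr (-s)))"
      by (simp add: norm_mult mult_left_le_one_le)
    also note *
    finally show ?thesis unfolding sum_coeff_shift[OF assms(2)] right_diff_distrib .
  qed
  thus "\<exists>N0. \<forall>N\<ge>N0. \<forall>s. Re s \<ge> c \<longrightarrow> norm s powr \<kappa> \<le> real N \<longrightarrow>
     norm (of_nat d powr (-s) * f s - (\<Sum>m=1..N. coeff_shift d a m * of_nat m powr (-s))) < e" by blast
qed

lemma dirichlet_approx_one: "dirichlet_approx (\<lambda>m. if m = 1 then 1 else 0) (\<lambda>_. 1)"
  unfolding dirichlet_approx_def
proof (intro allI impI)
  fix \<kappa> c e :: real assume kce: "\<kappa> > 1" "c > 0" "e > 0"
  have "norm (1 - (\<Sum>m=1..N. (if m = 1 then 1 else 0) * of_nat m powr (-s))) < e"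
    if "N \<ge> 1" for N and s :: complex
  proof -
    have "(\<Sum>m=1..N. (if m = 1 then 1 else 0) * of_nat m powr (-s)) = (\<Sum>m\<in>{1::nat}. (1::complex))"
      using that by (intro sum.mono_neutral_cong_right) auto
    thus ?thesis using kce by simp
  qed
  thus "\<exists>N0. \<forall>N\<ge>N0. \<forall>s. Re s \<ge> c \<longrightarrow> norm s powr \<kappa> \<le> real N \<longrightarrow>
     norm (1 - (\<Sum>m=1..N. (if m = 1 then 1 else 0) * of_nat m powr (-s))) < e" by blast
qed

definition rough :: "nat set \<Rightarrow> nat \<Rightarrow> complex" where
  "rough P m = (if \<forall>p\<in>P. \<not> p dvd m then 1 else 0)"

text \<open>Each factor 1 - p^(-s) removes the multiples of p. The coefficients of \<eta> are 1
  minus twice the indicator of even m, and this dilation by 2 commutes with the sieve, so 2 may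
  belong to P as well.\<close>

lemma dirichlet_approx_eta_sieved:
  assumes "finite P" "\<And>p. p \<in> P \<Longrightarrow> prime p"
  shows "dirichlet_approx (\<lambda>m. rough P m - 2 * coeff_shift 2 (rough P) m)
           (\<lambda>s. eta s * (\<Prod>p\<in>P. 1 - of_nat p powr (-s)))"
  using assms
proof (induction P rule: finite_induct)
  case empty
  show ?case
    by (rule dirichlet_approx_cong[OF dirichlet_approx_eta]) (auto simp: rough_def coeff_shift_def)
next
  case (insert p P)
  have p: "prime p" using insert.prems by auto
  hence p: "prime p" "p \<ge> 1" using prime_ge_1_nat by auto
  have ndvd: "\<not> p dvd q" "\<not> q dvd p" if "q \<in> P" for q
    using insert that primes_dvd_imp_eq[of p q] primes_dvd_imp_eq[of q p] by auto
  have rec: "rough (insert p P) m = rough P m - coeff_shift p (rough P) m" for m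
  proof (cases "p dvd m")
    case True
    then obtain k where k: "m = p * k" by auto
    have "q dvd m \<longleftrightarrow> q dvd k" if "q \<in> P" for q
      using that ndvd(2)[OF that] insert.prems k by (auto simp: prime_dvd_mult_iff)
    thus ?thesis using k p True by (auto simp: rough_def coeff_shift_def)
  qed (auto simp: rough_def coeff_shift_def)
  have comm: "coeff_shift 2 (coeff_shift p a) m = coeff_shift p (coeff_shift 2 a) m" for a m
  proof -
    have "2 dvd m \<and> p dvd (m div 2) \<longleftrightarrow> p dvd m \<and> 2 dvd (m div p)"
      using p by (metis dvd_div_iff_mult dvd_mult_left dvd_mult_right mult.commute
          not_prime_0 zero_neq_numeral)
    moreover have "m div 2 div p = m div p div 2" by (simp add: div_mult2_eq [symmetric] mult.commute)
    ultimately show ?thesis by (auto simp: coeff_shift_def)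
  qed
  have lin: "coeff_shift d (\<lambda>m. a m - b m) m = coeff_shift d a m - coeff_shift d b m" 
      "coeff_shift d (\<lambda>m. 2 * a m) m = 2 * coeff_shift d a m" for d a b m
    by (auto simp: coeff_shift_def)
  have "dirichlet_approx
      (\<lambda>m. (rough P m - 2 * coeff_shift 2 (rough P) m) - coeff_shift p (\<lambda>m. rough P m - 2 * coeff_shift 2 (rough P) m) m)
      (\<lambda>s. eta s * (\<Prod>p\<in>P. 1 - of_nat p powr (-s)) - of_nat p powr (-s) * (eta s * (\<Prod>p\<in>P. 1 - of_nat p powr (-s))))"
    using insert.IH insert.prems p by (intro dirichlet_approx_diff dirichlet_approx_shift) auto
  thus ?case
  proof (rule dirichlet_approx_cong)
    fix m
    have "coeff_shift 2 (rough (insert p P)) m = coeff_shift 2 (rough P) m - coeff_shift 2 (coeff_shift p (rough P)) m"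
      unfolding lin(1) [symmetric] rec ..
    thus "rough P m - 2 * coeff_shift 2 (rough P) m - coeff_shift p (\<lambda>m. rough P m - 2 * coeff_shift 2 (rough P) m) m
        = rough (insert p P) m - 2 * coeff_shift 2 (rough (insert p P)) m"
      unfolding lin rec by (simp add: comm)
  next
    fix s
    show "eta s * (\<Prod>p\<in>P. 1 - of_nat p powr (-s)) - of_nat p powr (-s) * (eta s * (\<Prod>p\<in>P. 1 - of_nat p powr (-s))) =
      eta s * (\<Prod>p\<in>insert p P. 1 - of_nat p powr (-s))"
      using insert by (simp add: algebra_simps)
  qed
qed

text \<open>Without m = 1 the support starts beyond the primes of P once P is an initial segment of
  the primes, so the mean square is controlled by the tail of a convergent series.\<close>

definition rough_gt_1 :: "nat set \<Rightarrow> nat \<Rightarrow> complex" where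
  "rough_gt_1 P m = (if m = 1 then 0 else rough P m)"

lemma dirichlet_approx_rough_eta:
  assumes "finite P" "\<And>p. p \<in> P \<Longrightarrow> prime p"
  shows "dirichlet_approx (\<lambda>m. rough_gt_1 P m - 2 * coeff_shift 2 (rough_gt_1 P) m)
           (\<lambda>s. eta s * (\<Prod>p\<in>P. 1 - of_nat p powr (-s)) - (1 - 2 * 2 powr (-s)))"
proof -
  let ?o = "\<lambda>m::nat. if m = 1 then 1 else 0 :: complex"
  have "dirichlet_approx (\<lambda>m. (rough P m - 2 * coeff_shift 2 (rough P) m) - ((?o m - coeff_shift 2 ?o m) - coeff_shift 2 ?o m))
           (\<lambda>s. eta s * (\<Prod>p\<in>P. 1 - of_nat p powr (-s)) - ((1 - of_nat 2 powr (-s) * 1) - of_nat 2 powr (-s) * 1))"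
    by (intro dirichlet_approx_diff dirichlet_approx_shift dirichlet_approx_eta_sieved assms dirichlet_approx_one) auto
  moreover have "\<not> p dvd Suc 0" if "p \<in> P" for p using assms(2)[OF that] by auto
  ultimately show ?thesis
    by (elim dirichlet_approx_cong) (auto simp: rough_gt_1_def coeff_shift_def rough_def)
qed

section \<open>Mean squares of Dirichlet polynomials\<close>

lemma has_integral_cis_linear:
  fixes l T :: real
  assumes "T \<ge> 0"
  obtains J where "((\<lambda>t. exp (\<i> * of_real (t * l))) has_integral J) {0..T}"
    "l = 0 \<Longrightarrow> J = of_real T" "l \<noteq> 0 \<Longrightarrow> norm J \<le> 2 / \<bar>l\<bar>"
proof (cases "l = 0")
  case True
  have "((\<lambda>t. 1 :: complex) has_integral of_real T) {0..T}"
    using has_integral_const_real[of "1::complex" 0 T] assms by (simp add: scaleR_conv_of_real)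
  thus ?thesis using that[of "of_real T"] True by simp
next
  case False
  define F where "F = (\<lambda>t. exp (\<i> * of_real (t * l)) / (\<i> * of_real l))"
  have "((\<lambda>t. exp (\<i> * of_real (t * l))) has_integral (F T - F 0)) {0..T}"
  proof (rule fundamental_theorem_of_calculus)
    fix t assume "t \<in> {0..T}"
    have "((\<lambda>z. exp (\<i> * (z * of_real l)) / (\<i> * of_real l)) has_field_derivative
             exp (\<i> * (of_real t * of_real l))) (at (of_real t))"
      using False by (auto intro!: derivative_eq_intros simp: field_simps)
    from has_vector_derivative_real_field[OF this]
    show "(F has_vector_derivative exp (\<i> * of_real (t * l))) (at t within {0..T})"
      by (simp add: F_def)
  qed (use assms in auto)
  moreover have "norm (F T - F 0) \<le> 2 / \<bar>l\<bar>"
  proof -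
    have "F T - F 0 = (exp (\<i> * of_real (T * l)) - 1) / (\<i> * of_real l)"
      by (simp add: F_def diff_divide_distrib)
    also have "norm \<dots> = norm (exp (\<i> * of_real (T * l)) - 1) / \<bar>l\<bar>"
      by (simp add: norm_divide norm_mult)
    also have "norm (exp (\<i> * of_real (T * l)) - 1) \<le> 2"
      using norm_triangle_ineq4[of "exp (\<i> * of_real (T * l))" 1] by (simp only: norm_exp_i_times norm_one)
    finally show ?thesis by (simp add: divide_right_mono)
  qed
  ultimately show ?thesis using that[of "F T - F 0"] False by blast
qed

lemma powr_ii_nat:
  assumes "n \<ge> 1"
  shows "of_nat n powr (-(\<i> * of_real t)) = exp (\<i> * of_real (t * - ln (real n)))"
  using assms by (simp add: powr_def Ln_of_nat algebra_simps)

text \<open>The frequencies are given by an injection from an arbitrary index set so that a product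
  of two Dirichlet polynomials can be treated with pairs as indices. Off the diagonal the
  oscillating integral is at most 2 over the difference of the logarithms, for every T.\<close>

lemma mean_square_dirichlet_poly:
  fixes c :: "'i \<Rightarrow> complex" and \<nu> :: "'i \<Rightarrow> nat"
  assumes I: "finite I" "inj_on \<nu> I" "\<And>i. i \<in> I \<Longrightarrow> \<nu> i \<ge> 1" and T: "T \<ge> 0"
  shows "\<bar>integral {0..T} (\<lambda>t. (norm (\<Sum>i\<in>I. c i * of_nat (\<nu> i) powr (-(\<i> * of_real t))))\<^sup>2)
            - T * (\<Sum>i\<in>I. (norm (c i))\<^sup>2)\<bar>
         \<le> (\<Sum>i\<in>I. \<Sum>j\<in>I-{i}. 2 * (norm (c i) * norm (c j)) / \<bar>ln (real (\<nu> i)) - ln (real (\<nu> j))\<bar>)"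
proof -
  define l where "l = (\<lambda>i j. ln (real (\<nu> j)) - ln (real (\<nu> i)))"
  have "\<forall>i j. \<exists>J. ((\<lambda>t. exp (\<i> * of_real (t * l i j))) has_integral J) {0..T} \<and>
    (l i j = 0 \<longrightarrow> J = of_real T) \<and> (l i j \<noteq> 0 \<longrightarrow> norm J \<le> 2 / \<bar>l i j\<bar>)"
    using has_integral_cis_linear[OF T] by metis
  then obtain J where J: "\<And>i j. ((\<lambda>t. exp (\<i> * of_real (t * l i j))) has_integral J i j) {0..T}"
    "\<And>i j. l i j = 0 \<Longrightarrow> J i j = of_real T" "\<And>i j. l i j \<noteq> 0 \<Longrightarrow> norm (J i j) \<le> 2 / \<bar>l i j\<bar>"
    by metis
  define D where "D = (\<lambda>t. \<Sum>i\<in>I. c i * of_nat (\<nu> i) powr (-(\<i> * of_real t)))"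
  have expand: "of_real ((norm (D t))\<^sup>2) =
      (\<Sum>i\<in>I. \<Sum>j\<in>I. c i * cnj (c j) * exp (\<i> * of_real (t * l i j)))" for t
  proof -
    have D: "D t = (\<Sum>i\<in>I. c i * exp (\<i> * of_real (t * - ln (real (\<nu> i)))))"
      unfolding D_def by (intro sum.cong refl arg_cong2[where f = "(*)"] powr_ii_nat I)
    have "of_real ((norm (D t))\<^sup>2) = D t * cnj (D t)"
      by (rule complex_norm_square)
    also have "\<dots> = (\<Sum>i\<in>I. \<Sum>j\<in>I. (c i * exp (\<i> * of_real (t * - ln (real (\<nu> i))))) *
        cnj (c j * exp (\<i> * of_real (t * - ln (real (\<nu> j))))))"
      unfolding D by (simp add: sum_product)
    also have "\<dots> = (\<Sum>i\<in>I. \<Sum>j\<in>I. c i * cnj (c j) * exp (\<i> * of_real (t * l i j)))"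
      by (intro sum.cong refl) (simp add: exp_cnj l_def algebra_simps flip: exp_add)
    finally show ?thesis .
  qed
  have "((\<lambda>t. \<Sum>i\<in>I. \<Sum>j\<in>I. c i * cnj (c j) * exp (\<i> * of_real (t * l i j)))
          has_integral (\<Sum>i\<in>I. \<Sum>j\<in>I. c i * cnj (c j) * J i j)) {0..T}"
    by (intro has_integral_sum has_integral_mult_right J I)
  hence "((\<lambda>t. of_real ((norm (D t))\<^sup>2)) has_integral (\<Sum>i\<in>I. \<Sum>j\<in>I. c i * cnj (c j) * J i j)) {0..T}"
    by (simp only: expand)
  from has_integral_linear[OF this bounded_linear_Re]
  have "((\<lambda>t. (norm (D t))\<^sup>2) has_integral Re (\<Sum>i\<in>I. \<Sum>j\<in>I. c i * cnj (c j) * J i j)) {0..T}"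
    by (simp only: o_def Re_complex_of_real)
  hence int: "integral {0..T} (\<lambda>t. (norm (D t))\<^sup>2) = Re (\<Sum>i\<in>I. \<Sum>j\<in>I. c i * cnj (c j) * J i j)"
    by (rule integral_unique)
  have split: "(\<Sum>i\<in>I. \<Sum>j\<in>I. c i * cnj (c j) * J i j) =
     of_real (T * (\<Sum>i\<in>I. (norm (c i))\<^sup>2)) + (\<Sum>i\<in>I. \<Sum>j\<in>I-{i}. c i * cnj (c j) * J i j)"
  proof -
    have "(\<Sum>j\<in>I. c i * cnj (c j) * J i j) = of_real (T * (norm (c i))\<^sup>2) + (\<Sum>j\<in>I-{i}. c i * cnj (c j) * J i j)"
      if "i \<in> I" for i
    proof -
      have "c i * cnj (c i) = (of_real (norm (c i)))\<^sup>2"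
        using complex_norm_square[of "c i"] by simp
      moreover have "J i i = of_real T" by (rule J(2)) (simp add: l_def)
      ultimately show ?thesis using that I(1)
        by (subst sum.remove[of I i]) simp_all
    qed
    thus ?thesis by (simp add: sum.distrib sum_distrib_left)
  qed
  have "\<bar>integral {0..T} (\<lambda>t. (norm (D t))\<^sup>2) - T * (\<Sum>i\<in>I. (norm (c i))\<^sup>2)\<bar> =
          \<bar>Re (\<Sum>i\<in>I. \<Sum>j\<in>I-{i}. c i * cnj (c j) * J i j)\<bar>"
    unfolding int split by simp
  also have "\<dots> \<le> norm (\<Sum>i\<in>I. \<Sum>j\<in>I-{i}. c i * cnj (c j) * J i j)"
    by (rule abs_Re_le_cmod)
  also have "\<dots> \<le> (\<Sum>i\<in>I. \<Sum>j\<in>I-{i}. norm (c i * cnj (c j) * J i j))"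
    by (intro order.trans[OF norm_sum] sum_mono) auto
  also have "\<dots> \<le> (\<Sum>i\<in>I. \<Sum>j\<in>I-{i}. 2 * (norm (c i) * norm (c j)) / \<bar>ln (real (\<nu> i)) - ln (real (\<nu> j))\<bar>)"
  proof (intro sum_mono)
    fix i j assume ij: "i \<in> I" "j \<in> I - {i}"
    hence "\<nu> i \<noteq> \<nu> j" "\<nu> i \<ge> 1" "\<nu> j \<ge> 1" using I by (auto simp: inj_on_def)
    hence "l i j \<noteq> 0" by (simp add: l_def)
    from J(3)[OF this]
    have "norm (J i j) \<le> 2 / \<bar>ln (real (\<nu> i)) - ln (real (\<nu> j))\<bar>"
      by (simp add: l_def abs_minus_commute)
    hence "norm (c i) * norm (c j) * norm (J i j) \<le> norm (c i) * norm (c j) * (2 / \<bar>ln (real (\<nu> i)) - ln (real (\<nu> j))\<bar>)"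
      by (intro mult_left_mono) auto
    thus "norm (c i * cnj (c j) * J i j) \<le> 2 * (norm (c i) * norm (c j)) / \<bar>ln (real (\<nu> i)) - ln (real (\<nu> j))\<bar>"
      by (simp add: norm_mult mult_ac)
  qed
  finally show ?thesis unfolding D_def .
qed

lemma sum_powr_le:
  fixes b :: real
  assumes "0 \<le> b" "b < 1" "X \<ge> 1"
  shows "(\<Sum>k=1..X. real k powr (-b)) \<le> real X powr (1 - b) / (1 - b)"
  using assms(3)
proof (induction X rule: dec_induct)
  case base
  thus ?case using assms by (simp add: field_simps)
next
  case (step n)
  have "\<exists>z. real n < z \<and> z < real (Suc n) \<and>
     real (Suc n) powr (1 - b) / (1 - b) - real n powr (1 - b) / (1 - b) = (real (Suc n) - real n) * z powr (-b)"
  proof (rule MVT2)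
    fix x assume "real n \<le> x"
    hence "x > 0" using step by linarith
    hence "((\<lambda>x. x powr (1 - b) / (1 - b)) has_real_derivative ((1 - b) * x powr (1 - b - 1)) / (1 - b)) (at x)"
      by (intro DERIV_cdivide has_real_derivative_powr)
    thus "((\<lambda>x. x powr (1 - b) / (1 - b)) has_real_derivative x powr (-b)) (at x)"
      using assms by simp
  qed auto
  then obtain z where z: "real n < z" "z < real (Suc n)"
    and eq: "real (Suc n) powr (1 - b) / (1 - b) - real n powr (1 - b) / (1 - b) = z powr (-b)"
    by (metis add_diff_cancel_left' mult_1 of_nat_1 of_nat_Suc add.commute)
  have "real (Suc n) powr (-b) \<le> z powr (-b)"
    using z assms step by (intro powr_mono2') auto
  thus ?case using step eq by simp
qed

lemma inverse_abs_ln_diff_le: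
  assumes "1 \<le> k" "k < l"
  shows "1 / \<bar>ln (real k) - ln (real l)\<bar> \<le> 1 + real k / real (l - k)"
proof -
  have "ln (real k / real l) \<le> real k / real l - 1"
    using assms by (intro ln_le_minus_one) auto
  hence "ln (real l) - ln (real k) \<ge> real (l - k) / real l"
    using assms by (simp add: ln_div field_simps)
  moreover have "real (l - k) / real l > 0" using assms by simp
  ultimately have "1 / \<bar>ln (real k) - ln (real l)\<bar> \<le> 1 / (real (l - k) / real l)"
    by (intro divide_left_mono mult_pos_pos) (use assms in auto)
  also have "\<dots> = 1 + real k / real (l - k)"
    using assms by (simp add: field_simps)
  finally show ?thesis .
qed

definition offdiag :: "real \<Rightarrow> nat \<Rightarrow> real" where
  "offdiag a X = (\<Sum>k\<in>{1..X}. \<Sum>l\<in>{1..X}-{k}.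
      2 * (real k powr (-a) * real l powr (-a)) / \<bar>ln (real k) - ln (real l)\<bar>)"

text \<open>The bound 1 + k/(l - k) for the inverse logarithm splits the sum in two. The constant
  part is controlled by the square of the sum of k^(-a); in the other, 1/(l - k) is weakened to (l -
  k)^(\<eta> - 1), which avoids a logarithm at the price of X^\<eta>.\<close>

lemma offdiag_le:
  fixes a \<eta> :: real
  assumes a: "1/2 < a" "a < 1" and \<eta>: "0 < \<eta>" "\<eta> \<le> 1"
  obtains C where "C \<ge> 0" "\<And>X. X \<ge> 1 \<Longrightarrow> offdiag a X \<le> C * real X powr (2 - 2 * a + \<eta>)"
proof -
  define C where "C = 4 * (1 / (1 - a)^2 + 1 / (\<eta> * (2 - 2 * a)))"
  show ?thesis
  proof (rule that[of C])
    show "C \<ge> 0" using a \<eta> by (auto simp: C_def)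
    fix X :: nat assume X: "X \<ge> 1"
    define h where "h = (\<lambda>k l. 2 * (real k powr (-a) * real l powr (-a)) / \<bar>ln (real k) - ln (real l)\<bar>)"
    have sym: "h k l = h l k" for k l
      unfolding h_def by (subst abs_minus_commute) (simp only: mult.commute)
    define L where "L = (\<Sum>l\<in>{1..X}. \<Sum>k\<in>{1..<l}. h k l)"
    have "offdiag a X = (\<Sum>k\<in>{1..X}. \<Sum>l\<in>{1..X}-{k}. h k l)"
      by (simp add: offdiag_def h_def)
    also have "\<dots> = (\<Sum>k\<in>{1..X}. (\<Sum>l\<in>{1..<k}. h k l) + (\<Sum>l\<in>{k<..X}. h k l))"
    proof (rule sum.cong)
      fix k assume k: "k \<in> {1..X}"
      have eq: "{1..X} - {k} = {1..<k} \<union> {k<..X}" using k by auto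
      show "(\<Sum>l\<in>{1..X}-{k}. h k l) = (\<Sum>l\<in>{1..<k}. h k l) + (\<Sum>l\<in>{k<..X}. h k l)"
        unfolding eq by (rule sum.union_disjoint) auto
    qed auto
    also have "\<dots> = (\<Sum>k\<in>{1..X}. \<Sum>l\<in>{1..<k}. h k l) + (\<Sum>k\<in>{1..X}. \<Sum>l\<in>{k<..X}. h k l)"
      by (rule sum.distrib)
    also have "(\<Sum>k\<in>{1..X}. \<Sum>l\<in>{k<..X}. h k l) = L"
    proof -
      have "(\<Sum>k\<in>{1..X}. \<Sum>l\<in>{k<..X}. h k l) = (\<Sum>k\<in>{1..X}. \<Sum>l\<in>{1..X}. if k < l then h k l else 0)"
        by (rule sum.cong[OF refl], rule sum.mono_neutral_cong_left) auto
      also have "\<dots> = (\<Sum>l\<in>{1..X}. \<Sum>k\<in>{1..X}. if k < l then h k l else 0)"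
        by (rule sum.swap)
      also have "\<dots> = L" unfolding L_def
        by (rule sum.cong[OF refl], rule sum.mono_neutral_cong_right) auto
      finally show ?thesis .
    qed
    also have "(\<Sum>k\<in>{1..X}. \<Sum>l\<in>{1..<k}. h k l) = L"
      unfolding L_def by (intro sum.cong refl sym)
    finally have D: "offdiag a X = 2 * L" by simp
    have hle: "h k l \<le> 2 * (real k powr (-a) * real l powr (-a)) + 2 * (real l powr (1 - 2 * a) * real (l - k) powr (-(1 - \<eta>)))"
      if "1 \<le> k" "k < l" for k l
    proof -
      have "h k l = 2 * (real k powr (-a) * real l powr (-a)) * (1 / \<bar>ln (real k) - ln (real l)\<bar>)"
        by (simp add: h_def)
      also have "\<dots> \<le> 2 * (real k powr (-a) * real l powr (-a)) * (1 + real k / real (l - k))"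
        using that by (intro mult_left_mono inverse_abs_ln_diff_le) auto
      also have "\<dots> = 2 * (real k powr (-a) * real l powr (-a)) + 2 * (real k * real k powr (-a)) * real l powr (-a) * (1 / real (l - k))"
        by (simp add: algebra_simps)
      also have "real k * real k powr (-a) = real k powr (1 - a)"
        using that powr_add[of "real k" 1 "-a"] by simp
      also have "2 * real k powr (1 - a) * real l powr (-a) * (1 / real (l - k))
         \<le> 2 * real l powr (1 - a) * real l powr (-a) * real (l - k) powr (-(1 - \<eta>))"
      proof (intro mult_mono)
        have "real (l - k) powr (-1) \<le> real (l - k) powr (-(1 - \<eta>))"
          using that \<eta> by (intro powr_mono) auto
        thus "1 / real (l - k) \<le> real (l - k) powr (-(1 - \<eta>))"
          using that by (simp add: powr_minus_divide)
        show "real k powr (1 - a) \<le> real l powr (1 - a)"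
          using that a by (intro powr_mono2) auto
      qed auto
      also have "2 * real l powr (1 - a) * real l powr (-a) = 2 * real l powr (1 - 2 * a)"
      proof -
        have "real l powr (1 - a) * real l powr (-a) = real l powr (1 - 2 * a)"
          by (subst powr_add [symmetric]) simp
        thus ?thesis by simp
      qed
      finally show ?thesis by (simp add: mult_ac)
    qed
    have "L \<le> (\<Sum>l\<in>{1..X}. \<Sum>k\<in>{1..<l}. 2 * (real k powr (-a) * real l powr (-a)) + 2 * (real l powr (1 - 2 * a) * real (l - k) powr (-(1 - \<eta>))))"
      unfolding L_def by (intro sum_mono hle) auto
    also have "\<dots> = (\<Sum>l\<in>{1..X}. 2 * real l powr (-a) * (\<Sum>k\<in>{1..<l}. real k powr (-a))) +
         (\<Sum>l\<in>{1..X}. 2 * real l powr (1 - 2 * a) * (\<Sum>k\<in>{1..<l}. real (l - k) powr (-(1 - \<eta>))))"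
      by (simp add: sum.distrib sum_distrib_left mult_ac)
    also have "\<dots> \<le> (\<Sum>l\<in>{1..X}. 2 * real l powr (-a) * (real X powr (1 - a) / (1 - a))) +
         (\<Sum>l\<in>{1..X}. 2 * real l powr (1 - 2 * a) * (real X powr \<eta> / \<eta>))"
    proof (intro add_mono sum_mono mult_left_mono)
      fix l assume l: "l \<in> {1..X}"
      have "(\<Sum>k\<in>{1..<l}. real k powr (-a)) \<le> (\<Sum>k\<in>{1..X}. real k powr (-a))"
        using l by (intro sum_mono2) auto
      also have "\<dots> \<le> real X powr (1 - a) / (1 - a)"
        using a X by (intro sum_powr_le) auto
      finally show "(\<Sum>k\<in>{1..<l}. real k powr (-a)) \<le> real X powr (1 - a) / (1 - a)" .
      have "(\<Sum>k\<in>{1..<l}. real (l - k) powr (-(1 - \<eta>))) = (\<Sum>k\<in>{1..<l}. real k powr (-(1 - \<eta>)))"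
        by (rule sum.reindex_bij_witness[of _ "\<lambda>k. l - k" "\<lambda>k. l - k"]) auto
      also have "\<dots> \<le> (\<Sum>k\<in>{1..X}. real k powr (-(1 - \<eta>)))"
        using l by (intro sum_mono2) auto
      also have "\<dots> \<le> real X powr (1 - (1 - \<eta>)) / (1 - (1 - \<eta>))"
        using \<eta> X by (intro sum_powr_le) auto
      finally show "(\<Sum>k\<in>{1..<l}. real (l - k) powr (-(1 - \<eta>))) \<le> real X powr \<eta> / \<eta>" by simp
    qed auto
    also have "\<dots> = 2 * (\<Sum>l\<in>{1..X}. real l powr (-a)) * (real X powr (1 - a) / (1 - a)) +
         2 * (\<Sum>l\<in>{1..X}. real l powr (-(2 * a - 1))) * (real X powr \<eta> / \<eta>)"
      by (simp add: sum_distrib_left sum_distrib_right mult_ac)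
    also have "\<dots> \<le> 2 * (real X powr (1 - a) / (1 - a)) * (real X powr (1 - a) / (1 - a)) +
         2 * (real X powr (1 - (2 * a - 1)) / (1 - (2 * a - 1))) * (real X powr \<eta> / \<eta>)"
      using a \<eta> X by (intro add_mono mult_right_mono mult_left_mono sum_powr_le) auto
    also have "2 * (real X powr (1 - a) / (1 - a)) * (real X powr (1 - a) / (1 - a)) =
       2 * real X powr (2 - 2 * a) / (1 - a)^2"
    proof -
      have "real X powr (1 - a) * real X powr (1 - a) = real X powr (2 - 2 * a)"
        by (subst powr_add [symmetric]) simp
      thus ?thesis by (simp add: power2_eq_square mult.assoc)
    qed
    also have "2 * (real X powr (1 - (2 * a - 1)) / (1 - (2 * a - 1))) * (real X powr \<eta> / \<eta>) =
       2 * real X powr (2 - 2 * a + \<eta>) / (\<eta> * (2 - 2 * a))"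
    proof -
      have "real X powr (1 - (2 * a - 1)) * real X powr \<eta> = real X powr (2 - 2 * a + \<eta>)"
        by (subst powr_add [symmetric]) simp
      thus ?thesis by (simp add: mult.assoc mult.commute)
    qed
    also have "2 * real X powr (2 - 2 * a) / (1 - a)^2 \<le> 2 * real X powr (2 - 2 * a + \<eta>) / (1 - a)^2"
      using X \<eta> by (intro divide_right_mono mult_left_mono powr_mono) auto
    finally have "L \<le> 2 * real X powr (2 - 2 * a + \<eta>) / (1 - a)^2 + 2 * real X powr (2 - 2 * a + \<eta>) / (\<eta> * (2 - 2 * a))"
      by simp
    also have "\<dots> = C / 2 * real X powr (2 - 2 * a + \<eta>)"
      by (simp add: C_def distrib_left distrib_right)
    finally show "offdiag a X \<le> C * real X powr (2 - 2 * a + \<eta>)" using D by simp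
  qed
qed

text \<open>As the products d m are distinct, the diagonal is at most card S times the diagonal of
  the second factor alone: the weight does not correlate with it. K depends on S, but not on N, T or
  w.\<close>

lemma mean_square_product_le:
  fixes S :: "nat set" and x a :: "nat \<Rightarrow> complex"
  assumes S: "finite S" "\<And>d. d \<in> S \<Longrightarrow> d \<ge> 1"
    and x: "\<And>d. d \<in> S \<Longrightarrow> norm (x d) \<le> 1" and a: "\<And>m. norm (a m) \<le> 1"
    and inj: "inj_on (\<lambda>(d, m). d * m) (S \<times> {m. m \<ge> 1 \<and> a m \<noteq> 0})"
    and c: "1/2 < c" "c < 1"
  obtains K where "K \<ge> 0" "\<And>N T w. T \<ge> 0 \<Longrightarrow> Re w \<ge> c \<Longrightarrow>
     integral {0..T} (\<lambda>t. (norm ((\<Sum>d\<in>S. x d * of_nat d powr (-(\<i> * of_real t))) *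
        (\<Sum>m=1..N. a m * of_nat m powr (-(w + \<i> * of_real t)))))\<^sup>2)
     \<le> T * (real (card S) * (\<Sum>m=1..N. (norm (a m))\<^sup>2 * real m powr (-2 * c))) + K * real N powr (3/2 - c)"
proof -
  \<comment> \<open>The choice c - 1/2 for the small loss makes the exponent 2 - 2c + (c - 1/2) =
    3/2 - c, which is below 1.\<close>
  obtain C where C: "C \<ge> 0" "\<And>X. X \<ge> 1 \<Longrightarrow> offdiag c X \<le> C * real X powr (2 - 2 * c + (c - 1/2))"
    using offdiag_le[OF c, of "c - 1/2"] c by auto
  define D where "D = 1 + \<Sum>S"
  have D1: "D \<ge> 1" by (simp add: D_def)
  have D: "d \<le> D" if "d \<in> S" for d
    using member_le_sum[OF that, of "\<lambda>x. x"] S unfolding D_def by simp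
  define K where "K = (real D powr c)\<^sup>2 * C * real D powr (3/2 - c)"
  show ?thesis
  proof (rule that[of K])
    show "K \<ge> 0" using C by (simp add: K_def)
    fix N :: nat and T :: real and w :: complex
    assume T: "T \<ge> 0" and w: "Re w \<ge> c"
    let ?M = "{m\<in>{1..N}. a m \<noteq> 0}"
    define I where "I = S \<times> ?M"
    define \<nu> where "\<nu> = (\<lambda>(d::nat, m::nat). d * m)"
    define cf where "cf = (\<lambda>(d, m). x d * (a m * of_nat m powr (-w)))"
    have fin: "finite I" unfolding I_def using S by auto
    have injI: "inj_on \<nu> I" unfolding \<nu>_def I_def by (rule inj_on_subset[OF inj]) auto
    have \<nu>1: "\<nu> i \<ge> 1" if "i \<in> I" for i using that S by (auto simp: \<nu>_def I_def Suc_le_eq)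
    have \<nu>2: "\<nu> i \<le> D * N" if "i \<in> I" for i using that D by (auto simp: \<nu>_def I_def intro!: mult_mono)
    have prod: "(\<Sum>d\<in>S. x d * of_nat d powr (-(\<i> * of_real t))) * (\<Sum>m=1..N. a m * of_nat m powr (-(w + \<i> * of_real t)))
        = (\<Sum>i\<in>I. cf i * of_nat (\<nu> i) powr (-(\<i> * of_real t)))" for t
    proof -
      have "(\<Sum>m=1..N. a m * of_nat m powr (-(w + \<i> * of_real t))) = (\<Sum>m\<in>?M. a m * of_nat m powr (-(w + \<i> * of_real t)))"
        by (rule sum.mono_neutral_right) auto
      hence "(\<Sum>d\<in>S. x d * of_nat d powr (-(\<i> * of_real t))) * (\<Sum>m=1..N. a m * of_nat m powr (-(w + \<i> * of_real t))) =
         (\<Sum>(d, m)\<in>I. (x d * of_nat d powr (-(\<i> * of_real t))) * (a m * of_nat m powr (-(w + \<i> * of_real t))))"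
        unfolding I_def by (simp add: sum_product sum.cartesian_product)
      also have "\<dots> = (\<Sum>i\<in>I. cf i * of_nat (\<nu> i) powr (-(\<i> * of_real t)))"
      proof (rule sum.cong)
        fix i assume i: "i \<in> I"
        obtain d m where [simp]: "i = (d, m)" by (cases i)
        have dm: "d \<ge> 1" "m \<ge> 1" using i S by (auto simp: I_def)
        have "of_nat (d * m) powr (-(\<i> * of_real t)) = of_nat d powr (-(\<i> * of_real t)) * of_nat m powr (-(\<i> * of_real t))"
          using dm by (subst (1 2 3) powr_ii_nat) (simp_all add: ln_mult algebra_simps flip: exp_add)
        moreover have "of_nat m powr (-(w + \<i> * of_real t)) = of_nat m powr (-w) * of_nat m powr (-(\<i> * of_real t))"
          by (simp flip: powr_add)
        ultimately show "(case i of (d, m) \<Rightarrow> (x d * of_nat d powr (-(\<i> * of_real t))) * (a m * of_nat m powr (-(w + \<i> * of_real t)))) =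
            cf i * of_nat (\<nu> i) powr (-(\<i> * of_real t))"
          by (simp only: \<open>i = (d, m)\<close> prod.case cf_def \<nu>_def mult_ac)
      qed auto
      finally show ?thesis .
    qed
    let ?L = "\<lambda>i j. \<bar>ln (real (\<nu> i)) - ln (real (\<nu> j))\<bar>"
    have "integral {0..T} (\<lambda>t. (norm (\<Sum>i\<in>I. cf i * of_nat (\<nu> i) powr (-(\<i> * of_real t))))\<^sup>2)
        \<le> T * (\<Sum>i\<in>I. (norm (cf i))\<^sup>2) + (\<Sum>i\<in>I. \<Sum>j\<in>I-{i}. 2 * (norm (cf i) * norm (cf j)) / ?L i j)"
      using mean_square_dirichlet_poly[OF fin injI \<nu>1 T, of cf] by linarith
    moreover have "(\<Sum>i\<in>I. (norm (cf i))\<^sup>2) \<le> real (card S) * (\<Sum>m=1..N. (norm (a m))\<^sup>2 * real m powr (-2 * c))"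
    proof -
      have "(\<Sum>i\<in>I. (norm (cf i))\<^sup>2) \<le> (\<Sum>(d, m)\<in>I. (norm (a m))\<^sup>2 * real m powr (-2 * c))"
      proof (rule sum_mono)
        fix i assume i: "i \<in> I"
        obtain d m where [simp]: "i = (d, m)" by (cases i)
        have dm: "d \<in> S" "m \<ge> 1" using i S by (auto simp: I_def)
        have "norm (cf i) = norm (x d) * (norm (a m) * real m powr (- Re w))"
          by (simp add: cf_def norm_mult norm_powr_real_powr)
        also have "\<dots> \<le> 1 * (norm (a m) * real m powr (-c))"
          by (intro mult_mono powr_mono x) (use dm w in auto)
        finally have "norm (cf i) \<le> 1 * (norm (a m) * real m powr (-c))" .
        hence "(norm (cf i))\<^sup>2 \<le> (norm (a m) * real m powr (-c))\<^sup>2"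
          by (intro power_mono) auto
        also have "\<dots> = (norm (a m))\<^sup>2 * (real m powr (-c) * real m powr (-c))"
          by (simp add: power_mult_distrib power2_eq_square)
        also have "real m powr (-c) * real m powr (-c) = real m powr (-2 * c)"
          by (subst powr_add [symmetric]) simp
        finally show "(norm (cf i))\<^sup>2 \<le> (case i of (d, m) \<Rightarrow> (norm (a m))\<^sup>2 * real m powr (-2 * c))"
          by simp
      qed
      also have "\<dots> = (\<Sum>d\<in>S. \<Sum>m\<in>?M. (norm (a m))\<^sup>2 * real m powr (-2 * c))"
        unfolding I_def by (rule sum.cartesian_product [symmetric])
      also have "\<dots> = real (card S) * (\<Sum>m\<in>?M. (norm (a m))\<^sup>2 * real m powr (-2 * c))"
        by simp
      also have "(\<Sum>m\<in>?M. (norm (a m))\<^sup>2 * real m powr (-2 * c)) = (\<Sum>m=1..N. (norm (a m))\<^sup>2 * real m powr (-2 * c))"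
        by (rule sum.mono_neutral_left) auto
      finally show ?thesis .
    qed
    moreover have "(\<Sum>i\<in>I. \<Sum>j\<in>I-{i}. 2 * (norm (cf i) * norm (cf j)) / ?L i j) \<le> K * real N powr (3/2 - c)"
    proof (cases "N = 0")
      case True
      hence "I = {}" by (auto simp: I_def)
      thus ?thesis using True by simp
    next
      case False
      \<comment> \<open>Measured against (d m)^(-c) the coefficient loses at most d^c, hence D^c;
        this brings the off-diagonal sum to the standard form \<open>offdiag\<close>.\<close>
      have cf_le: "norm (cf i) \<le> real D powr c * real (\<nu> i) powr (-c)" if i: "i \<in> I" for i
      proof -
        obtain d m where [simp]: "i = (d, m)" by (cases i)
        have dm: "d \<in> S" "m \<ge> 1" "d \<ge> 1" using i S by (auto simp: I_def)
        have "norm (cf i) = norm (x d) * (norm (a m) * real m powr (- Re w))"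
          by (simp add: cf_def norm_mult norm_powr_real_powr)
        also have "\<dots> \<le> 1 * (1 * real m powr (-c))"
          by (intro mult_mono powr_mono x a) (use dm w in auto)
        also have "\<dots> = real d powr c * real (\<nu> i) powr (-c)"
          using dm by (simp add: \<nu>_def powr_mult powr_minus field_simps)
        also have "\<dots> \<le> real D powr c * real (\<nu> i) powr (-c)"
          using D[OF dm(1)] c by (intro mult_right_mono powr_mono2) auto
        finally show ?thesis .
      qed
      let ?h = "\<lambda>k l. 2 * (real k powr (-c) * real l powr (-c)) / \<bar>ln (real k) - ln (real l)\<bar>"
      have "(\<Sum>i\<in>I. \<Sum>j\<in>I-{i}. 2 * (norm (cf i) * norm (cf j)) / ?L i j) \<le>
         (\<Sum>i\<in>I. \<Sum>j\<in>I-{i}. (real D powr c)\<^sup>2 * ?h (\<nu> i) (\<nu> j))"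
      proof (intro sum_mono)
        fix i j assume ij: "i \<in> I" "j \<in> I - {i}"
        have "norm (cf i) * norm (cf j) \<le> (real D powr c * real (\<nu> i) powr (-c)) * (real D powr c * real (\<nu> j) powr (-c))"
          using ij by (intro mult_mono cf_le) auto
        hence "2 * (norm (cf i) * norm (cf j)) / ?L i j \<le> 2 * ((real D powr c * real (\<nu> i) powr (-c)) * (real D powr c * real (\<nu> j) powr (-c))) / ?L i j"
          by (intro divide_right_mono mult_left_mono) auto
        thus "2 * (norm (cf i) * norm (cf j)) / ?L i j \<le> (real D powr c)\<^sup>2 * ?h (\<nu> i) (\<nu> j)"
          by (simp add: power2_eq_square mult_ac)
      qed
      also have "\<dots> = (real D powr c)\<^sup>2 * (\<Sum>i\<in>I. \<Sum>j\<in>I-{i}. ?h (\<nu> i) (\<nu> j))"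
        by (simp only: sum_distrib_left)
      also have "(\<Sum>i\<in>I. \<Sum>j\<in>I-{i}. ?h (\<nu> i) (\<nu> j)) = (\<Sum>k\<in>\<nu> ` I. \<Sum>l\<in>\<nu> ` I - {k}. ?h k l)"
      proof (subst sum.reindex[OF injI], rule sum.cong)
        fix i assume i: "i \<in> I"
        have "\<nu> ` I - {\<nu> i} = \<nu> ` (I - {i})" using injI i by (auto simp: inj_on_def)
        moreover have "inj_on \<nu> (I - {i})" using injI by (rule inj_on_subset) auto
        ultimately show "(\<Sum>j\<in>I-{i}. ?h (\<nu> i) (\<nu> j)) = ((\<lambda>k. \<Sum>l\<in>\<nu> ` I - {k}. ?h k l) \<circ> \<nu>) i"
          by (simp add: sum.reindex)
      qed auto
      also have "(\<Sum>k\<in>\<nu> ` I. \<Sum>l\<in>\<nu> ` I - {k}. ?h k l) \<le> offdiag c (D * N)"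
      proof -
        have sub: "\<nu> ` I \<subseteq> {1..D*N}" using \<nu>1 \<nu>2 by auto
        have "(\<Sum>k\<in>\<nu> ` I. \<Sum>l\<in>\<nu> ` I - {k}. ?h k l) \<le> (\<Sum>k\<in>\<nu> ` I. \<Sum>l\<in>{1..D*N}-{k}. ?h k l)"
          using sub by (intro sum_mono sum_mono2) auto
        also have "\<dots> \<le> offdiag c (D * N)"
          unfolding offdiag_def using sub by (intro sum_mono2) (auto intro!: sum_nonneg)
        finally show ?thesis .
      qed
      also have "offdiag c (D * N) \<le> C * real (D * N) powr (2 - 2 * c + (c - 1/2))"
        using False D1 by (intro C(2)) (simp add: Suc_le_eq)
      also have "(real D powr c)\<^sup>2 * (C * real (D * N) powr (2 - 2 * c + (c - 1/2))) = K * real N powr (3/2 - c)"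
      proof -
        have "2 - 2 * c + (c - 1/2) = 3/2 - c" by simp
        thus ?thesis by (simp add: K_def powr_mult)
      qed
      finally show ?thesis by (simp add: mult_left_mono)
    qed
    ultimately show "integral {0..T} (\<lambda>t. (norm ((\<Sum>d\<in>S. x d * of_nat d powr (-(\<i> * of_real t))) *
        (\<Sum>m=1..N. a m * of_nat m powr (-(w + \<i> * of_real t)))))\<^sup>2)
     \<le> T * (real (card S) * (\<Sum>m=1..N. (norm (a m))\<^sup>2 * real m powr (-2 * c))) + K * real N powr (3/2 - c)"
      unfolding prod using mult_left_mono[OF _ T] by (smt (verit, best))
  qed
qed

section \<open>Jensen's inequality\<close>

lemma holomorphic_factor_zorder:
  assumes f: "f holomorphic_on S" "open S" "connected S" "a \<in> S" "\<exists>w\<in>S. f w \<noteq> 0"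
  obtains g where "g holomorphic_on S" "\<And>z. z \<in> S \<Longrightarrow> f z = (z - a) ^ nat (zorder f a) * g z"
proof -
  define n where "n = nat (zorder f a)"
  obtain r where r: "r > 0" "cball a r \<subseteq> S" "zor_poly f a holomorphic_on cball a r"
     "\<And>w. w \<in> cball a r \<Longrightarrow> f w = zor_poly f a w * (w - a) ^ n \<and> zor_poly f a w \<noteq> 0"
    unfolding n_def using zorder_exist_zero[OF f] by blast
  define g where "g = (\<lambda>z. if z = a then zor_poly f a a else f z / (z - a) ^ n)"
  have 1: "g holomorphic_on ball a r"
  proof (rule holomorphic_transform)
    show "zor_poly f a holomorphic_on ball a r"
      using r(3) by (rule holomorphic_on_subset) auto
    show "zor_poly f a z = g z" if "z \<in> ball a r" for z
      using r(4)[of z] that by (auto simp: g_def)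
  qed
  have 2: "g holomorphic_on (S - {a})"
  proof (rule holomorphic_transform)
    show "(\<lambda>z. f z / (z - a) ^ n) holomorphic_on S - {a}"
      using f by (intro holomorphic_intros) (auto intro: holomorphic_on_subset)
  qed (auto simp: g_def)
  have "g holomorphic_on (ball a r \<union> (S - {a}))"
    by (rule holomorphic_on_Un[OF 1 2]) (use f in auto)
  moreover have "ball a r \<union> (S - {a}) = S" using r f(4) by auto
  ultimately have "g holomorphic_on S" by simp
  moreover have "f z = (z - a) ^ n * g z" if "z \<in> S" for z
    using r(4)[of a] r(1) that by (auto simp: g_def)
  ultimately show ?thesis using that unfolding n_def by blast
qed

lemma holomorphic_factor_zorders:
  assumes f: "f holomorphic_on S" "open S" "connected S" "\<exists>w\<in>S. f w \<noteq> 0" and "finite Z" "Z \<subseteq> S"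
  shows "\<exists>g. g holomorphic_on S \<and> (\<forall>z\<in>S. f z = (\<Prod>a\<in>Z. (z - a) ^ nat (zorder f a)) * g z)"
  using assms(5,6)
proof (induction Z rule: finite_induct)
  case empty
  thus ?case using f by auto
next
  case (insert a Z)
  then obtain g where g: "g holomorphic_on S"
    "\<And>z. z \<in> S \<Longrightarrow> f z = (\<Prod>a\<in>Z. (z - a) ^ nat (zorder f a)) * g z" by auto
  have nz: "\<exists>w\<in>S. g w \<noteq> 0" using f g by force
  have aS: "a \<in> S" using insert by simp
  let ?P = "\<lambda>z. \<Prod>b\<in>Z. (z - b) ^ nat (zorder f b)"
  have "zorder f a = zorder (\<lambda>z. ?P z * g z) a"
  proof (rule zorder_cong)
    have "eventually (\<lambda>z. z \<in> S) (at a)"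
      using f aS by (intro eventually_at_in_open') auto
    thus "\<forall>\<^sub>F z in at a. f z = ?P z * g z"
      by eventually_elim (use g in auto)
  qed auto
  also have "\<dots> = zorder ?P a + zorder g a"
  proof (rule zorder_times_analytic)
    show "?P analytic_on {a}" by (intro analytic_intros)
    show "g analytic_on {a}" using g aS f analytic_at by blast
    obtain w where w: "w \<in> S" "f w \<noteq> 0" using f by auto
    have "eventually (\<lambda>z. f z \<noteq> 0 \<and> z \<in> S) (at a)"
      using non_zero_neighbour_alt[OF f(1-3) aS w] by simp
    thus "\<forall>\<^sub>F z in at a. ?P z * g z \<noteq> 0"
      by eventually_elim (use g in auto)
  qed
  also have "zorder ?P a = 0"
  proof (rule zorder_eq_0I)
    show "?P analytic_on {a}" by (intro analytic_intros)
    show "?P a \<noteq> 0" using insert by (auto simp: prod_zero_iff)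
  qed
  finally have eq: "zorder g a = zorder f a" by simp
  obtain h where h: "h holomorphic_on S" "\<And>z. z \<in> S \<Longrightarrow> g z = (z - a) ^ nat (zorder g a) * h z"
    using holomorphic_factor_zorder[OF g(1) f(2,3) aS nz] by blast
  have "f z = (\<Prod>b\<in>insert a Z. (z - b) ^ nat (zorder f b)) * h z" if "z \<in> S" for z
    using g(2)[OF that] h(2)[OF that] insert.hyps eq by simp
  thus ?case using h by blast
qed

text \<open>Replacing each factor \<open>z - a\<close> by a Blaschke factor of the disc keeps the modulus on the boundary.\<close>

lemma jensen_zero_count:
  assumes f: "f holomorphic_on S" "open S" "connected S" and S: "cball z0 R \<subseteq> S"
    and rR: "0 < r" "r < R" and nz: "f z0 \<noteq> 0" and Z: "finite Z" "Z \<subseteq> cball z0 r"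
    and M: "\<And>z. z \<in> sphere z0 R \<Longrightarrow> norm (f z) \<le> M"
  shows "(R / r) ^ (\<Sum>a\<in>Z. nat (zorder f a)) * norm (f z0) \<le> M"
proof -
  have z0: "z0 \<in> S" using S rR by auto
  have ZS: "Z \<subseteq> S" using Z S rR by (meson cball_subset_cball_iff less_imp_le order_trans subset_cball)
  obtain g where g: "g holomorphic_on S"
    "\<And>z. z \<in> S \<Longrightarrow> f z = (\<Prod>a\<in>Z. (z - a) ^ nat (zorder f a)) * g z"
    using holomorphic_factor_zorders[OF f _ Z(1) ZS] z0 nz by blast
  define k where "k = (\<lambda>a. nat (zorder f a))"
  define b where "b = (\<lambda>a z. (of_real (R\<^sup>2) - cnj (a - z0) * (z - z0)) / of_real R)"
  define h where "h = (\<lambda>z. (\<Prod>a\<in>Z. b a z ^ k a) * g z)"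
  have hol: "h holomorphic_on S"
    unfolding h_def b_def using rR by (intro holomorphic_intros g) auto
  have sph: "norm (h z) \<le> M" if z: "z \<in> sphere z0 R" for z
  proof -
    have "norm (b a z) = norm (z - a)" for a
    proof -
      define u where "u = z - z0"
      define v where "v = a - z0"
      have nu: "norm u = R" using z by (simp add: u_def dist_norm norm_minus_commute)
      have "of_real (R\<^sup>2) = u * cnj u"
        using complex_norm_square[of u] by (simp add: nu)
      hence "of_real (R\<^sup>2) - cnj v * u = u * cnj (u - v)"
        by (simp add: algebra_simps)
      hence "norm (of_real (R\<^sup>2) - cnj v * u) = R * norm (u - v)"
        by (simp only: norm_mult complex_mod_cnj nu)
      moreover have "u - v = z - a" by (simp add: u_def v_def)
      ultimately show ?thesis unfolding b_def u_def[symmetric] v_def[symmetric]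
        using rR by (simp add: norm_divide)
    qed
    hence "norm (h z) = norm ((\<Prod>a\<in>Z. (z - a) ^ k a) * g z)"
      by (simp add: h_def norm_mult prod_norm[symmetric] norm_power)
    also have "\<dots> = norm (f z)" using g(2)[of z] z S by (auto simp: k_def)
    also have "\<dots> \<le> M" by (rule M) fact
    finally show ?thesis .
  qed
  have hz0: "norm (h z0) \<le> M"
  proof (rule maximum_modulus_frontier[of h "cball z0 R"])
    show "h holomorphic_on interior (cball z0 R)"
      using hol by (rule holomorphic_on_subset) (use S in auto)
    show "continuous_on (closure (cball z0 R)) h"
      using hol S by (auto intro: holomorphic_on_imp_continuous_on holomorphic_on_subset)
    show "norm (h z) \<le> M" if "z \<in> frontier (cball z0 R)" for z
      using sph[of z] that rR by (simp add: frontier_cball)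
  qed (use rR in auto)
  \<comment> \<open>At the centre every \<open>b a\<close> equals R whereas |z0 - a| \<le> r, so
    replacing the factors gains at least R/r for each zero, counted with multiplicity.\<close>
  have "(R / r) ^ (\<Sum>a\<in>Z. k a) * norm (f z0) = (\<Prod>a\<in>Z. (R / r) ^ k a * norm (z0 - a) ^ k a) * norm (g z0)"
    using g(2)[OF z0] by (simp add: k_def power_sum prod.distrib norm_mult prod_norm[symmetric] norm_power)
  also have "\<dots> \<le> (\<Prod>a\<in>Z. R ^ k a) * norm (g z0)"
  proof (intro mult_right_mono prod_mono conjI)
    fix a assume a: "a \<in> Z"
    hence "norm (z0 - a) \<le> r" using Z by (auto simp: dist_norm)
    hence "R / r * norm (z0 - a) \<le> R / r * r" using rR by (intro mult_left_mono) auto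
    hence "(R / r * norm (z0 - a)) ^ k a \<le> R ^ k a" using rR by (intro power_mono) auto
    thus "(R / r) ^ k a * norm (z0 - a) ^ k a \<le> R ^ k a" by (simp only: power_mult_distrib)
  qed (use rR in auto)
  also have "\<dots> = norm (h z0)"
    using rR by (simp add: h_def b_def norm_mult prod_norm[symmetric] norm_power power2_eq_square norm_divide)
  finally show ?thesis using hz0 by (simp add: k_def)
qed

text \<open>Cauchy's formula with |u - w| \<ge> R' - R on the outer circle. It is meant for squares:
  the resulting mean of |f|^2 over a circle, unlike a supremum, can be integrated over vertical
  shifts.\<close>

lemma norm_le_circle_mean:
  assumes f: "f holomorphic_on S" and S: "cball z R' \<subseteq> S" and R: "0 \<le> R" "R < R'" and w: "w \<in> cball z R"
  shows "norm (f w) \<le> R' / (R' - R) * integral {0..1} (\<lambda>x. norm (f (circlepath z R' x)))"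
proof -
  have cf: "continuous_on (cball z R') f"
    using f S by (auto intro: holomorphic_on_imp_continuous_on holomorphic_on_subset)
  have hf: "f holomorphic_on ball z R'"
    using f by (rule holomorphic_on_subset) (use S in auto)
  have w': "norm (w - z) \<le> R" using w by (simp add: dist_norm norm_minus_commute)
  have R': "R' > 0" using R by simp
  have cp: "continuous_on {0..1} (circlepath z R')"
    unfolding circlepath by (intro continuous_intros)
  have on: "norm (circlepath z R' x - z) = R'" for x
    using R' by (simp add: circlepath norm_mult norm_exp_eq_Re)
  have far: "norm (circlepath z R' x - w) \<ge> R' - R" for x
  proof -
    have "norm (circlepath z R' x - z) \<le> norm (circlepath z R' x - w) + norm (w - z)"
      using norm_triangle_ineq[of "circlepath z R' x - w" "w - z"] by simp
    thus ?thesis using w' on[of x] by linarith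
  qed
  have in_cb: "circlepath z R' x \<in> cball z R'" for x
    using on[of x] by (simp add: dist_norm norm_minus_commute)
  have cfc: "continuous_on {0..1} (\<lambda>x. norm (f (circlepath z R' x)))"
    by (intro continuous_on_norm continuous_on_compose2[OF cf cp]) (use in_cb in auto)
  have "((\<lambda>u. f u / (u - w)) has_contour_integral (2 * of_real pi * \<i> * f w)) (circlepath z R')"
    using Cauchy_integral_circlepath[OF cf hf, of w] w' R by simp
  hence "((\<lambda>x. f (circlepath z R' x) / (circlepath z R' x - w) * vector_derivative (circlepath z R') (at x within {0..1}))
     has_integral (2 * of_real pi * \<i> * f w)) {0..1}"
    by (simp add: has_contour_integral_def)
  hence int: "((\<lambda>x. f (circlepath z R' x) / (circlepath z R' x - w) * (2 * pi * \<i> * R' * exp (2 * of_real pi * \<i> * x)))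
     has_integral (2 * of_real pi * \<i> * f w)) {0..1}"
    by (rule has_integral_eq[rotated]) (simp add: vector_derivative_circlepath01)
  have "norm (2 * of_real pi * \<i> * f w) \<le> integral {0..1} (\<lambda>x. 2 * pi * (R' / (R' - R)) * norm (f (circlepath z R' x)))"
    unfolding integral_unique[OF int, symmetric]
  proof (rule integral_norm_bound_integral)
    show "(\<lambda>x. f (circlepath z R' x) / (circlepath z R' x - w) * (2 * pi * \<i> * R' * exp (2 * of_real pi * \<i> * x))) integrable_on {0..1}"
      using int by blast
    show "(\<lambda>x. 2 * pi * (R' / (R' - R)) * norm (f (circlepath z R' x))) integrable_on {0..1}"
      by (intro integrable_continuous_interval continuous_intros cfc)
    fix x :: real assume "x \<in> {0..1}"
    have "norm (f (circlepath z R' x) / (circlepath z R' x - w) * (2 * pi * \<i> * R' * exp (2 * of_real pi * \<i> * x))) =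
       norm (f (circlepath z R' x)) * (2 * pi * R') / norm (circlepath z R' x - w)"
      using R' by (simp add: norm_mult norm_divide norm_exp_eq_Re)
    also have "\<dots> \<le> norm (f (circlepath z R' x)) * (2 * pi * R') / (R' - R)"
      using far[of x] R R' by (intro divide_left_mono) (auto intro!: mult_pos_pos)
    finally show "norm (f (circlepath z R' x) / (circlepath z R' x - w) * (2 * pi * \<i> * R' * exp (2 * of_real pi * \<i> * x)))
       \<le> 2 * pi * (R' / (R' - R)) * norm (f (circlepath z R' x))"
      by (simp add: mult_ac)
  qed
  also have "\<dots> = 2 * pi * (R' / (R' - R)) * integral {0..1} (\<lambda>x. norm (f (circlepath z R' x)))"
    by (rule integral_mult_right)
  finally have "2 * pi * norm (f w) \<le> 2 * pi * (R' / (R' - R) * integral {0..1} (\<lambda>x. norm (f (circlepath z R' x))))"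
    by (simp add: norm_mult mult.assoc)
  thus ?thesis by (rule mult_left_le_imp_le) simp
qed

section \<open>Mean squares on vertical lines\<close>

text \<open>Serves as the resonator: S will be the set of divisors of a power of Q, and x the
  induced signs.\<close>

definition imag_poly :: "nat set \<Rightarrow> (nat \<Rightarrow> complex) \<Rightarrow> real \<Rightarrow> complex" where
  "imag_poly S x t = (\<Sum>d\<in>S. x d * of_nat d powr (-(\<i> * of_real t)))"

lemma continuous_on_of_nat_powr [continuous_intros]:
  assumes "continuous_on A f"
  shows "continuous_on A (\<lambda>t. (of_nat n :: complex) powr f t)"
proof (cases "n = 0")
  case True
  thus ?thesis by simp
next
  case False
  thus ?thesis unfolding powr_def using assms by (auto intro!: continuous_intros)
qed

lemma continuous_on_imag_poly [continuous_intros]: "continuous_on A (imag_poly S x)"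
  unfolding imag_poly_def[abs_def] by (intro continuous_intros)

lemma norm_of_nat_powr_imag: "norm ((of_nat d :: complex) powr (-(\<i> * of_real t))) \<le> 1"
  by (simp add: norm_powr_real_powr)

lemma norm_imag_poly_le:
  assumes "\<And>d. d \<in> S \<Longrightarrow> norm (x d) \<le> 1"
  shows "norm (imag_poly S x t) \<le> real (card S)"
proof -
  have "norm (imag_poly S x t) \<le> (\<Sum>d\<in>S. norm (x d * of_nat d powr (-(\<i> * of_real t))))"
    unfolding imag_poly_def by (rule norm_sum)
  also have "\<dots> \<le> (\<Sum>d\<in>S. 1)"
    using assms norm_of_nat_powr_imag by (intro sum_mono) (auto simp: norm_mult intro!: mult_le_one)
  finally show ?thesis by simp
qed

lemma norm_add_power2_le: "(norm (a + b :: complex))\<^sup>2 \<le> 2 * (norm a)\<^sup>2 + 2 * (norm b)\<^sup>2"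
proof -
  have "(norm (a + b))\<^sup>2 \<le> (norm a + norm b)\<^sup>2"
    by (intro power_mono norm_triangle_ineq) auto
  also have "\<dots> \<le> 2 * (norm a)\<^sup>2 + 2 * (norm b)\<^sup>2"
    using sum_squares_bound[of "norm a" "norm b"] by (simp add: power2_sum)
  finally show ?thesis .
qed

text \<open>The exponent \<kappa> is chosen with \<kappa> \<theta> < 1 for \<theta> = 3/2 - c, so
  that N of size (R + T)^\<kappa> gives N^\<theta> = o(T). The pointwise error e' is scaled by the
  trivial bound card S for the weight (plus 1, in case S is empty), and the factor 2 before Bd comes
  from |a + b|^2 \<le> 2 |a|^2 + 2 |b|^2.\<close>

lemma approx_mean_square:
  fixes c K Bd R e :: real
  assumes approx: "dirichlet_approx a f" and cont: "continuous_on UNIV f"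
    and x: "\<And>d. d \<in> S \<Longrightarrow> norm (x d) \<le> 1"
    and c: "1/2 < c" "c < 1" and K: "K \<ge> 0"
    and poly: "\<And>N T w. T \<ge> 0 \<Longrightarrow> Re w \<ge> c \<Longrightarrow>
       integral {0..T} (\<lambda>t. (norm (imag_poly S x t * (\<Sum>m=1..N. a m * of_nat m powr (-(w + \<i> * of_real t)))))\<^sup>2)
         \<le> T * Bd + K * real N powr (3/2 - c)"
    and R: "R \<ge> 0" and e: "e > 0"
  shows "\<forall>\<^sub>F T in at_top. \<forall>w. Re w \<ge> c \<longrightarrow> norm w \<le> R \<longrightarrow>
       integral {0..T} (\<lambda>t. (norm (imag_poly S x t * f (w + \<i> * of_real t)))\<^sup>2) \<le> T * (2 * Bd + e)"
proof -
  define \<theta> where "\<theta> = 3/2 - c"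
  have \<theta>: "1/2 < \<theta>" "\<theta> < 1" using c by (auto simp: \<theta>_def)
  define \<kappa> where "\<kappa> = (1 + 1 / \<theta>) / 2"
  have "1 / \<theta> > 1" using \<theta> by simp
  hence \<kappa>: "\<kappa> > 1" by (simp add: \<kappa>_def)
  have "\<kappa> * \<theta> = (\<theta> + 1) / 2" using \<theta> by (simp add: \<kappa>_def field_simps)
  hence \<kappa>\<theta>: "\<kappa> * \<theta> < 1" using \<theta> by simp
  define e' where "e' = sqrt (e / 4) / (real (card S) + 1)"
  have e': "e' > 0" using e by (simp add: e'_def)
  have e'2: "(real (card S) * e')\<^sup>2 \<le> e / 4"
  proof -
    have "real (card S) * e' = sqrt (e / 4) * (real (card S) / (real (card S) + 1))" by (simp add: e'_def)
    also have "\<dots> \<le> sqrt (e / 4) * 1" using e by (intro mult_left_mono) auto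
    finally have "(real (card S) * e')\<^sup>2 \<le> (sqrt (e / 4))\<^sup>2" using e' by (intro power_mono) auto
    thus ?thesis using e by simp
  qed
  obtain N0 where N0: "\<And>N s. N \<ge> N0 \<Longrightarrow> Re s \<ge> c \<Longrightarrow> norm s powr \<kappa> \<le> real N \<Longrightarrow>
    norm (f s - (\<Sum>m=1..N. a m * of_nat m powr (-s))) < e'"
    by (rule dirichlet_approxE[OF approx \<kappa> _ e', of c]) (use c in auto)
  have "((\<lambda>T. 2 * K * (((R + T) powr \<kappa> + 1) powr \<theta>) / T) \<longlongrightarrow> 0) at_top"
    using \<kappa>\<theta> \<theta> \<kappa> R K by real_asymp
  hence "\<forall>\<^sub>F T in at_top. 2 * K * (((R + T) powr \<kappa> + 1) powr \<theta>) / T < e / 2"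
    using e by (intro order_tendstoD) auto
  moreover have "\<forall>\<^sub>F T in at_top. (R + T) powr \<kappa> \<ge> real N0"
  proof -
    have "filterlim (\<lambda>T. (R + T) powr \<kappa>) at_top at_top" using \<kappa> by real_asymp
    thus ?thesis by (simp add: filterlim_at_top)
  qed
  ultimately show ?thesis using eventually_gt_at_top[of 0]
  proof eventually_elim
    case (elim T)
    hence T: "T > 0" by simp
    show ?case
    proof (intro allI impI)
      fix w :: complex assume w: "Re w \<ge> c" "norm w \<le> R"
      define N where "N = nat \<lceil>(R + T) powr \<kappa>\<rceil>"
      have N: "(R + T) powr \<kappa> \<le> real N" "real N \<le> (R + T) powr \<kappa> + 1"
      proof -
        have "(R + T) powr \<kappa> \<ge> 0" by simp
        thus "(R + T) powr \<kappa> \<le> real N" "real N \<le> (R + T) powr \<kappa> + 1" unfolding N_def by linarith+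
      qed
      have NN: "N \<ge> N0" using N(1) elim(2) by linarith
      define p where "p = (\<lambda>t. \<Sum>m=1..N. a m * of_nat m powr (-(w + \<i> * of_real t)))"
      have contp: "continuous_on {0..T} p" unfolding p_def by (intro continuous_intros)
      have contf: "continuous_on {0..T} (\<lambda>t. f (w + \<i> * of_real t))"
        by (rule continuous_on_compose2[OF cont]) (auto intro!: continuous_intros)
      have err: "norm (f (w + \<i> * of_real t) - p t) \<le> e'" if t: "t \<in> {0..T}" for t
      proof -
        have "norm (w + \<i> * of_real t) \<le> norm w + norm (\<i> * of_real t)" by (rule norm_triangle_ineq)
        also have "\<dots> \<le> R + T" using w t by (simp add: norm_mult)
        finally have "norm (w + \<i> * of_real t) powr \<kappa> \<le> (R + T) powr \<kappa>"
          using \<kappa> by (intro powr_mono2) auto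
        also have "\<dots> \<le> real N" by (rule N)
        finally show ?thesis unfolding p_def using N0[OF NN, of "w + \<i> * of_real t"] w by simp
      qed
      have "integral {0..T} (\<lambda>t. (norm (imag_poly S x t * f (w + \<i> * of_real t)))\<^sup>2) \<le>
            integral {0..T} (\<lambda>t. 2 * (norm (imag_poly S x t * p t))\<^sup>2 + 2 * (e / 4))"
      proof (rule integral_le)
        show "(\<lambda>t. (norm (imag_poly S x t * f (w + \<i> * of_real t)))\<^sup>2) integrable_on {0..T}"
          by (intro integrable_continuous_interval continuous_intros contf)
        show "(\<lambda>t. 2 * (norm (imag_poly S x t * p t))\<^sup>2 + 2 * (e / 4)) integrable_on {0..T}"
          by (intro integrable_continuous_interval continuous_intros contp)
        fix t assume t: "t \<in> {0..T}"
        let ?d = "f (w + \<i> * of_real t) - p t"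
        have "norm (imag_poly S x t * ?d) \<le> real (card S) * e'"
          using norm_imag_poly_le[where S = S and x = x and t = t, OF x] err[OF t] by (auto simp: norm_mult intro!: mult_mono)
        hence "(norm (imag_poly S x t * ?d))\<^sup>2 \<le> (real (card S) * e')\<^sup>2" by (intro power_mono) auto
        hence "(norm (imag_poly S x t * ?d))\<^sup>2 \<le> e / 4" using e'2 by linarith
        moreover have "(norm (imag_poly S x t * f (w + \<i> * of_real t)))\<^sup>2 \<le> 2 * (norm (imag_poly S x t * p t))\<^sup>2 + 2 * (norm (imag_poly S x t * ?d))\<^sup>2"
          using norm_add_power2_le[of "imag_poly S x t * p t" "imag_poly S x t * ?d"] by (simp add: algebra_simps)
        ultimately show "(norm (imag_poly S x t * f (w + \<i> * of_real t)))\<^sup>2 \<le> 2 * (norm (imag_poly S x t * p t))\<^sup>2 + 2 * (e / 4)"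
          by linarith
      qed
      also have "\<dots> = 2 * integral {0..T} (\<lambda>t. (norm (imag_poly S x t * p t))\<^sup>2) + T * (e / 2)"
      proof -
        have "(\<lambda>t. (norm (imag_poly S x t * p t))\<^sup>2) integrable_on {0..T}"
          by (intro integrable_continuous_interval continuous_intros contp)
        thus ?thesis using T by (subst integral_add) (auto intro: integrable_on_mult_right)
      qed
      also have "integral {0..T} (\<lambda>t. (norm (imag_poly S x t * p t))\<^sup>2) \<le> T * Bd + K * real N powr \<theta>"
        using poly[of T w N] T w by (simp add: p_def \<theta>_def)
      also have "K * real N powr \<theta> \<le> K * ((R + T) powr \<kappa> + 1) powr \<theta>"
        using K N \<theta> by (intro mult_left_mono powr_mono2) auto
      finally have "integral {0..T} (\<lambda>t. (norm (imag_poly S x t * f (w + \<i> * of_real t)))\<^sup>2) \<le>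
         2 * T * Bd + 2 * K * ((R + T) powr \<kappa> + 1) powr \<theta> + T * (e / 2)" by simp
      moreover have "2 * K * ((R + T) powr \<kappa> + 1) powr \<theta> \<le> T * (e / 2)"
        using elim(1) T by (simp add: divide_less_eq mult.commute)
      ultimately show "integral {0..T} (\<lambda>t. (norm (imag_poly S x t * f (w + \<i> * of_real t)))\<^sup>2) \<le> T * (2 * Bd + e)"
        by (simp add: algebra_simps)
    qed
  qed
qed

lemma summable_powr_neg:
  assumes "c > 1/2"
  shows "summable (\<lambda>m. real m powr (-2 * c))"
  using assms by (simp add: summable_real_powr_iff)

text \<open>The unweighted case of \<open>approx_mean_square\<close>, with S = {1} as
  resonator.\<close>

lemma eta_mean_square:
  assumes c: "1/2 < c" "c < 1" and R: "R \<ge> 0"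
  obtains K where "K > 0" "\<forall>\<^sub>F T in at_top. \<forall>w. Re w \<ge> c \<longrightarrow> norm w \<le> R \<longrightarrow>
       integral {0..T} (\<lambda>t. (norm (eta (w + \<i> * of_real t)))\<^sup>2) \<le> K * T"
proof -
  define a :: "nat \<Rightarrow> complex" where "a = (\<lambda>m. (-1) ^ (m + 1))"
  have na: "norm (a m) = 1" for m by (simp add: a_def norm_power)
  define Bd where "Bd = (\<Sum>m. real m powr (-2 * c))"
  have Bd: "Bd \<ge> 0" unfolding Bd_def by (intro suminf_nonneg summable_powr_neg c) auto
  obtain K where K: "K \<ge> 0" "\<And>N T w. T \<ge> 0 \<Longrightarrow> Re w \<ge> c \<Longrightarrow>
     integral {0..T} (\<lambda>t. (norm ((\<Sum>d\<in>{1::nat}. 1 * of_nat d powr (-(\<i> * of_real t))) *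
        (\<Sum>m=1..N. a m * of_nat m powr (-(w + \<i> * of_real t)))))\<^sup>2)
     \<le> T * (real (card {1::nat}) * (\<Sum>m=1..N. (norm (a m))\<^sup>2 * real m powr (-2 * c))) + K * real N powr (3/2 - c)"
    by (rule mean_square_product_le[of "{1}" "\<lambda>_. 1" a c]) (use c na in \<open>auto simp: inj_on_def\<close>)
  have "\<forall>\<^sub>F T in at_top. \<forall>w. Re w \<ge> c \<longrightarrow> norm w \<le> R \<longrightarrow>
       integral {0..T} (\<lambda>t. (norm (imag_poly {1} (\<lambda>_. 1) t * eta (w + \<i> * of_real t)))\<^sup>2) \<le> T * (2 * Bd + 1)"
  proof (rule approx_mean_square)
    show "dirichlet_approx a eta" unfolding a_def by (rule dirichlet_approx_eta)
    show "continuous_on UNIV eta" by (intro holomorphic_on_imp_continuous_on eta_holomorphic)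
    fix N :: nat and T :: real and w :: complex assume T: "T \<ge> 0" "Re w \<ge> c"
    have "(\<Sum>m=1..N. (norm (a m))\<^sup>2 * real m powr (-2 * c)) \<le> Bd"
      unfolding Bd_def na using sum_le_suminf[OF summable_powr_neg[OF c(1)], of "{1..N}"] by simp
    hence "T * (real (card {1::nat}) * (\<Sum>m=1..N. (norm (a m))\<^sup>2 * real m powr (-2 * c))) \<le> T * Bd"
      using T by (simp add: mult_left_mono)
    thus "integral {0..T} (\<lambda>t. (norm (imag_poly {1} (\<lambda>_. 1) t * (\<Sum>m=1..N. a m * of_nat m powr (-(w + \<i> * of_real t)))))\<^sup>2)
         \<le> T * Bd + K * real N powr (3/2 - c)"
      using K(2)[OF T, of N] unfolding imag_poly_def by linarith
  qed (use c K R in auto)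
  moreover have "imag_poly {1} (\<lambda>_. 1) t = 1" for t by (simp add: imag_poly_def)
  ultimately show ?thesis using that[of "2 * Bd + 1"] Bd by (simp add: mult.commute)
qed

text \<open>Formally 1 - 2^(1 - s) times the sum of m^(-s) over all m > 1 free of primes of P; in
  this closed form it is entire, so it makes sense inside the strip.\<close>

definition rough_eta :: "nat set \<Rightarrow> complex \<Rightarrow> complex" where
  "rough_eta P s = eta s * (\<Prod>p\<in>P. 1 - of_nat p powr (-s)) - (1 - 2 * 2 powr (-s))"

lemma rough_eta_holomorphic:
  assumes "\<And>p. p \<in> P \<Longrightarrow> prime p"
  shows "rough_eta P holomorphic_on A"
  unfolding rough_eta_def using assms
  by (intro holomorphic_intros eta_holomorphic) (auto dest: prime_gt_0_nat)

text \<open>Elements of S have all their primes in P and m has none there, so d and m are coprime,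
  and d m = d' m' forces d and d' to divide each other.\<close>

lemma inj_on_smooth_times_rough:
  assumes S: "\<And>d q. d \<in> S \<Longrightarrow> prime q \<Longrightarrow> q dvd d \<Longrightarrow> q \<in> P" and S1: "\<And>d. d \<in> S \<Longrightarrow> d \<ge> 1"
  shows "inj_on (\<lambda>(d, m). d * m) (S \<times> {m. m \<ge> 1 \<and> rough_gt_1 P m \<noteq> 0})"
proof (rule inj_onI, clarify)
  fix d m d' m' :: nat
  assume d: "d \<in> S" "d' \<in> S" and m: "rough_gt_1 P m \<noteq> 0" "rough_gt_1 P m' \<noteq> 0" "m \<ge> 1" "m' \<ge> 1" and eq: "d * m = d' * m'"
  have cop: "coprime d m" if d: "d \<in> S" and m: "rough_gt_1 P m \<noteq> 0" for d m
  proof (rule ccontr)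
    assume "\<not> coprime d m"
    hence "gcd d m \<noteq> 1" by (simp add: coprime_iff_gcd_eq_1)
    then obtain q where q: "prime q" "q dvd gcd d m" using prime_factor_nat by blast
    hence "q \<in> P" using S[OF d, of q] by auto
    thus False using m q by (auto simp: rough_gt_1_def rough_def split: if_splits)
  qed
  have "d dvd d' * m'" using eq by (metis dvd_triv_left)
  hence "d dvd d'" using cop[OF d(1) m(2)] by (simp add: coprime_dvd_mult_left_iff)
  moreover have "d' dvd d * m" using eq by (metis dvd_triv_left)
  hence "d' dvd d" using cop[OF d(2) m(1)] by (simp add: coprime_dvd_mult_left_iff)
  ultimately have "d = d'" by (rule dvd_antisym)
  thus "d = d' \<and> m = m'" using eq S1[OF d(1)] by simp
qed

lemma rough_mean_square:
  assumes P: "finite P" "\<And>p. p \<in> P \<Longrightarrow> prime p"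
    and S: "finite S" "\<And>d. d \<in> S \<Longrightarrow> d \<ge> 1" "\<And>d q. d \<in> S \<Longrightarrow> prime q \<Longrightarrow> q dvd d \<Longrightarrow> q \<in> P"
    and x: "\<And>d. d \<in> S \<Longrightarrow> norm (x d) \<le> 1"
    and c: "1/2 < c" "c < 1" and R: "R \<ge> 0" and e: "e > 0"
  shows "\<forall>\<^sub>F T in at_top. \<forall>w. Re w \<ge> c \<longrightarrow> norm w \<le> R \<longrightarrow>
       integral {0..T} (\<lambda>t. (norm (imag_poly S x t * rough_eta P (w + \<i> * of_real t)))\<^sup>2)
         \<le> T * (20 * real (card S) * (\<Sum>m. (norm (rough_gt_1 P m))\<^sup>2 * real m powr (-2 * c)) + e)"
proof -
  define a :: "nat \<Rightarrow> complex" where "a = (\<lambda>m. rough_gt_1 P m - 2 * coeff_shift 2 (rough_gt_1 P) m)"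
  have nr: "norm (rough_gt_1 P m) \<le> 1" for m by (simp add: rough_gt_1_def rough_def)
  have summ: "summable (\<lambda>m. (norm (rough_gt_1 P m))\<^sup>2 * real m powr (-2 * c))"
  proof (rule summable_comparison_test'[OF summable_powr_neg[OF c(1)]])
    fix m show "norm ((norm (rough_gt_1 P m))\<^sup>2 * real m powr (-2 * c)) \<le> real m powr (-2 * c)"
      using nr[of m] by (simp add: mult_left_le_one_le power_le_one)
  qed
  define Q where "Q = (\<Sum>m. (norm (rough_gt_1 P m))\<^sup>2 * real m powr (-2 * c))"
  have Q0: "Q \<ge> 0" unfolding Q_def by (intro suminf_nonneg summ) auto
  obtain K where K: "K \<ge> 0" "\<And>N T w. T \<ge> 0 \<Longrightarrow> Re w \<ge> c \<Longrightarrow>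
     integral {0..T} (\<lambda>t. (norm ((\<Sum>d\<in>S. x d * of_nat d powr (-(\<i> * of_real t))) *
        (\<Sum>m=1..N. rough_gt_1 P m * of_nat m powr (-(w + \<i> * of_real t)))))\<^sup>2)
     \<le> T * (real (card S) * (\<Sum>m=1..N. (norm (rough_gt_1 P m))\<^sup>2 * real m powr (-2 * c))) + K * real N powr (3/2 - c)"
    by (rule mean_square_product_le[OF S(1,2) x nr inj_on_smooth_times_rough[OF S(3,2)] c]) auto
  have "\<forall>\<^sub>F T in at_top. \<forall>w. Re w \<ge> c \<longrightarrow> norm w \<le> R \<longrightarrow>
       integral {0..T} (\<lambda>t. (norm (imag_poly S x t * rough_eta P (w + \<i> * of_real t)))\<^sup>2) \<le> T * (2 * (10 * (real (card S) * Q)) + e)"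
  proof (rule approx_mean_square)
    show "dirichlet_approx a (rough_eta P)"
      unfolding a_def rough_eta_def using P by (rule dirichlet_approx_rough_eta)
    show "continuous_on UNIV (rough_eta P)"
      using P by (intro holomorphic_on_imp_continuous_on rough_eta_holomorphic)
    show "10 * K \<ge> 0" using K by simp
    fix N :: nat and T :: real and w :: complex assume T: "T \<ge> 0" "Re w \<ge> c"
    define U where "U = (\<lambda>N t. \<Sum>m=1..N. rough_gt_1 P m * of_nat m powr (-(w + \<i> * of_real t)))"
    have contU: "continuous_on A (U N)" for A N unfolding U_def by (intro continuous_intros)
    have UI: "(\<lambda>t. (norm (imag_poly S x t * U N t))\<^sup>2) integrable_on {0..T}" for N
      by (intro integrable_continuous_interval continuous_intros contU)
    have U: "integral {0..T} (\<lambda>t. (norm (imag_poly S x t * U M t))\<^sup>2) \<le> T * (real (card S) * Q) + K * real N powr (3/2 - c)"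
      if "M \<le> N" for M
    proof -
      have "(\<Sum>m=1..M. (norm (rough_gt_1 P m))\<^sup>2 * real m powr (-2 * c)) \<le> Q"
        unfolding Q_def by (intro sum_le_suminf summ) auto
      hence "T * (real (card S) * (\<Sum>m=1..M. (norm (rough_gt_1 P m))\<^sup>2 * real m powr (-2 * c))) \<le> T * (real (card S) * Q)"
        using T by (intro mult_left_mono) auto
      moreover have "K * real M powr (3/2 - c) \<le> K * real N powr (3/2 - c)"
        using K that c by (intro mult_left_mono powr_mono2) auto
      ultimately show ?thesis using K(2)[OF T, of M] unfolding imag_poly_def U_def by linarith
    qed
    have split: "(\<Sum>m=1..N. a m * of_nat m powr (-(w + \<i> * of_real t))) = U N t - 2 * 2 powr (-(w + \<i> * of_real t)) * U (N div 2) t" for t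
    proof -
      have "(\<Sum>m=1..N. a m * of_nat m powr (-(w + \<i> * of_real t))) =
        U N t - 2 * (\<Sum>m=1..N. coeff_shift 2 (rough_gt_1 P) m * of_nat m powr (-(w + \<i> * of_real t)))"
        unfolding a_def U_def left_diff_distrib sum_subtractf mult.assoc sum_distrib_left ..
      also have "(\<Sum>m=1..N. coeff_shift 2 (rough_gt_1 P) m * of_nat m powr (-(w + \<i> * of_real t))) =
        of_nat 2 powr (-(w + \<i> * of_real t)) * U (N div 2) t"
        unfolding U_def by (rule sum_coeff_shift) simp
      finally show ?thesis by (simp only: of_nat_numeral mult.assoc)
    qed
    \<comment> \<open>Since |2 * 2^(-s)| \<le> 2, squaring the splitting gives the weights 2 and 8.
      Their sum is the 10 below, doubled to 20 by \<open>approx_mean_square\<close>.\<close>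
    have le: "(norm (imag_poly S x t * (\<Sum>m=1..N. a m * of_nat m powr (-(w + \<i> * of_real t)))))\<^sup>2 \<le>
        2 * (norm (imag_poly S x t * U N t))\<^sup>2 + 8 * (norm (imag_poly S x t * U (N div 2) t))\<^sup>2" for t
    proof -
      let ?v = "imag_poly S x t * (- (2 * 2 powr (-(w + \<i> * of_real t)) * U (N div 2) t))"
      have "norm ((2::complex) powr (-(w + \<i> * of_real t))) = 2 powr (- Re w)"
        using norm_powr_real_powr[of 2 "-(w + \<i> * of_real t)"] by simp
      also have "\<dots> \<le> 2 powr 0" using T c by (intro powr_mono) auto
      finally have "norm ((2::complex) powr (-(w + \<i> * of_real t))) \<le> 1" by simp
      hence "norm ((2::complex) powr (-(w + \<i> * of_real t))) * norm (imag_poly S x t * U (N div 2) t) \<le> 1 * norm (imag_poly S x t * U (N div 2) t)"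
        by (intro mult_right_mono) auto
      hence "norm ?v \<le> 2 * norm (imag_poly S x t * U (N div 2) t)"
        by (simp add: norm_mult mult_ac)
      hence "(norm ?v)\<^sup>2 \<le> (2 * norm (imag_poly S x t * U (N div 2) t))\<^sup>2"
        by (intro power_mono) auto
      hence "(norm ?v)\<^sup>2 \<le> 4 * (norm (imag_poly S x t * U (N div 2) t))\<^sup>2" by (simp only: power_mult_distrib) simp
      moreover have "imag_poly S x t * (\<Sum>m=1..N. a m * of_nat m powr (-(w + \<i> * of_real t))) = imag_poly S x t * U N t + ?v"
        unfolding split by (simp add: algebra_simps)
      ultimately show ?thesis using norm_add_power2_le[of "imag_poly S x t * U N t" ?v] by simp
    qed
    have "integral {0..T} (\<lambda>t. (norm (imag_poly S x t * (\<Sum>m=1..N. a m * of_nat m powr (-(w + \<i> * of_real t)))))\<^sup>2) \<le>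
          integral {0..T} (\<lambda>t. 2 * (norm (imag_poly S x t * U N t))\<^sup>2 + 8 * (norm (imag_poly S x t * U (N div 2) t))\<^sup>2)"
      by (rule integral_le)
         (use le in \<open>auto intro!: integrable_continuous_interval continuous_intros contU\<close>)
    also have "\<dots> = 2 * integral {0..T} (\<lambda>t. (norm (imag_poly S x t * U N t))\<^sup>2) + 8 * integral {0..T} (\<lambda>t. (norm (imag_poly S x t * U (N div 2) t))\<^sup>2)"
      using UI by (subst integral_add) (auto intro: integrable_on_mult_right)
    also have "\<dots> \<le> 2 * (T * (real (card S) * Q) + K * real N powr (3/2 - c)) + 8 * (T * (real (card S) * Q) + K * real N powr (3/2 - c))"
      by (intro add_mono mult_left_mono U) auto
    finally show "integral {0..T} (\<lambda>t. (norm (imag_poly S x t * (\<Sum>m=1..N. a m * of_nat m powr (-(w + \<i> * of_real t)))))\<^sup>2)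
         \<le> T * (10 * (real (card S) * Q)) + 10 * K * real N powr (3/2 - c)"
      by (simp add: algebra_simps)
  qed (use x c R e in auto)
  thus ?thesis by (simp add: Q_def mult.assoc)
qed

section \<open>The upper bound\<close>

text \<open>Indexed from 0 for use with \<open>suminf\<close>; the term m = 0 vanishes because
  \<open>0 powr z = 0\<close>, so the series effectively starts at m = 1.\<close>

definition dirichlet_sum :: "(nat \<Rightarrow> complex) \<Rightarrow> complex \<Rightarrow> complex" where
  "dirichlet_sum b s = (\<Sum>m. b m * of_nat m powr (-s))"

lemma norm_dirichlet_term_le:
  assumes "norm (b m) \<le> v m" "Re s \<ge> c"
  shows "norm (b m * of_nat m powr (-s)) \<le> v m * real m powr (-c)"
proof (cases "m = 0")
  case False
  thus ?thesis unfolding norm_mult using assms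
    by (intro mult_mono) (auto simp: norm_powr_real_powr intro!: powr_mono order.trans[OF norm_ge_zero assms(1)])
qed auto

lemma
  assumes sv: "summable (\<lambda>m. v m * real m powr (-c))" and b: "\<And>m. norm (b m) \<le> v m" and s: "Re s \<ge> c"
  shows summable_norm_dirichlet: "summable (\<lambda>m. norm (b m * of_nat m powr (-s)))"
    and summable_dirichlet: "summable (\<lambda>m. b m * of_nat m powr (-s))"
    and norm_dirichlet_sum_le: "norm (dirichlet_sum b s) \<le> (\<Sum>m. v m * real m powr (-c))"
proof -
  have le: "norm (b m * of_nat m powr (-s)) \<le> v m * real m powr (-c)" for m
    by (rule norm_dirichlet_term_le) (use b s in auto)
  show "summable (\<lambda>m. norm (b m * of_nat m powr (-s)))"
    by (rule summable_comparison_test'[OF sv]) (use le in auto)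
  thus "summable (\<lambda>m. b m * of_nat m powr (-s))" by (rule summable_norm_cancel)
  show "norm (dirichlet_sum b s) \<le> (\<Sum>m. v m * real m powr (-c))"
    unfolding dirichlet_sum_def by (intro norm_suminf_le le sv)
qed

lemma uniform_limit_dirichlet_sum:
  assumes sv: "summable (\<lambda>m. v m * real m powr (-c))" and b: "\<And>m. norm (b m) \<le> v m" and A: "\<And>s. s \<in> A \<Longrightarrow> Re s \<ge> c"
  shows "uniform_limit A (\<lambda>N s. \<Sum>m<N. b m * of_nat m powr (-s)) (dirichlet_sum b) sequentially"
  unfolding dirichlet_sum_def[abs_def]
proof (rule Weierstrass_m_test[OF _ sv])
  show "norm (b m * of_nat m powr (-s)) \<le> v m * real m powr (-c)" if "s \<in> A" for m s
    by (rule norm_dirichlet_term_le) (use b A that in auto)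
qed

lemma dirichlet_sum_holomorphic:
  assumes sv: "summable (\<lambda>m. v m * real m powr (-c))" and b: "\<And>m. norm (b m) \<le> v m"
  shows "dirichlet_sum b holomorphic_on {s. Re s > c}"
proof (rule holomorphic_uniform_sequence)
  show op: "open {s. Re s > c}" by (rule open_halfspace_Re_gt)
  have hol: "(\<lambda>s. of_nat m powr (-s)) holomorphic_on {s. Re s > c}" for m
    by (cases "m = 0") (auto intro!: holomorphic_intros)
  show "(\<lambda>s. \<Sum>m<n. b m * of_nat m powr (-s)) holomorphic_on {s. Re s > c}" for n
    by (intro holomorphic_intros hol)
  fix s :: complex assume "s \<in> {s. Re s > c}"
  then obtain d where d: "d > 0" "cball s d \<subseteq> {s. Re s > c}"
    using op open_contains_cball by blast
  have "uniform_limit (cball s d) (\<lambda>N s. \<Sum>m<N. b m * of_nat m powr (-s)) (dirichlet_sum b) sequentially"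
    by (rule uniform_limit_dirichlet_sum[OF sv b]) (use d in force)
  thus "\<exists>d>0. cball s d \<subseteq> {s. Re s > c} \<and>
     uniform_limit (cball s d) (\<lambda>N s. \<Sum>m<N. b m * of_nat m powr (-s)) (dirichlet_sum b) sequentially"
    using d by blast
qed

abbreviation zeta_series :: "complex \<Rightarrow> complex" where "zeta_series \<equiv> dirichlet_sum (\<lambda>_. 1)"

lemma summable_zeta_series: "Re s > 1 \<Longrightarrow> summable (\<lambda>m. (1::complex) * of_nat m powr (-s))"
  by (rule summable_dirichlet[where v = "\<lambda>_. 1" and c = "Re s"]) (auto simp: summable_real_powr_iff)

lemma sum_atLeast1_tendsto:
  fixes f :: "nat \<Rightarrow> complex"
  assumes "f sums l" "f 0 = 0"
  shows "(\<lambda>N. \<Sum>m=1..N. f m) \<longlonglongrightarrow> l"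
proof -
  have "(\<lambda>N. \<Sum>m<Suc N. f m) \<longlonglongrightarrow> l"
    using assms(1) unfolding sums_def by (rule LIMSEQ_Suc)
  moreover have "(\<Sum>m<Suc N. f m) = (\<Sum>m=1..N. f m)" for N
    by (rule sum.mono_neutral_right) (use assms(2) in \<open>auto simp: Suc_le_eq intro: gr0I\<close>)
  ultimately show ?thesis by simp
qed

text \<open>Behind it is a finite identity: the alternating sum up to N is the plain sum up to N
  minus 2^(1 - s) times the plain sum up to \<open>N div 2\<close>.\<close>

lemma eta_eq_zeta_series:
  assumes "Re s > 1"
  shows "eta s = (1 - 2 * 2 powr (-s)) * zeta_series s"
proof -
  define Z where "Z = (\<lambda>N. \<Sum>m=1..N. (1::complex) * of_nat m powr (-s))"
  have Z: "Z \<longlonglongrightarrow> zeta_series s"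
    unfolding Z_def dirichlet_sum_def
    by (rule sum_atLeast1_tendsto) (use summable_zeta_series[OF assms] in \<open>auto simp: summable_sums\<close>)
  have "filterlim (\<lambda>N::nat. N div 2) at_top sequentially"
    by (rule filterlim_at_top_mono[of "\<lambda>N. N div 2"])
       (auto simp: filterlim_at_top eventually_sequentially less_eq_div_iff_mult_less_eq
          intro!: exI[of _ "_ * 2"])
  from filterlim_compose[OF Z this] have Z2: "(\<lambda>N. Z (N div 2)) \<longlonglongrightarrow> zeta_series s" .
  have "(\<Sum>m=1..N. (-1) ^ (m + 1) * of_nat m powr (-s)) = Z N - 2 * 2 powr (-s) * Z (N div 2)" for N
  proof -
    have "(\<Sum>m=1..N. (-1) ^ (m + 1) * of_nat m powr (-s)) =
       (\<Sum>m=1..N. (1 - 2 * coeff_shift 2 (\<lambda>_. 1) m) * of_nat m powr (-s))"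
      by (intro sum.cong refl) (auto simp: coeff_shift_def)
    also have "\<dots> = Z N - 2 * (\<Sum>m=1..N. coeff_shift 2 (\<lambda>_. 1) m * of_nat m powr (-s))"
      unfolding Z_def left_diff_distrib sum_subtractf mult.assoc sum_distrib_left ..
    also have "(\<Sum>m=1..N. coeff_shift 2 (\<lambda>_. 1) m * of_nat m powr (-s)) = of_nat 2 powr (-s) * Z (N div 2)"
      unfolding Z_def by (rule sum_coeff_shift) simp
    finally show ?thesis by (simp only: of_nat_numeral mult.assoc)
  qed
  moreover have "(\<lambda>N. Z N - 2 * 2 powr (-s) * Z (N div 2)) \<longlonglongrightarrow> zeta_series s - 2 * 2 powr (-s) * zeta_series s"
    by (intro tendsto_intros Z Z2)
  ultimately have lim: "(\<lambda>N. \<Sum>m=1..N. (-1) ^ (m + 1) * of_nat m powr (-s)) \<longlonglongrightarrow> zeta_series s - 2 * 2 powr (-s) * zeta_series s"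
    by simp
  have "(\<lambda>N. \<Sum>m<N. (-1) ^ m * of_nat (Suc m) powr (-s)) \<longlonglongrightarrow> eta s"
    using sums_eta[OF assms] by (simp only: sums_def)
  moreover have "(\<Sum>m<N. (-1) ^ m * of_nat (Suc m) powr (-s)) = (\<Sum>m=1..N. (-1) ^ (m + 1) * of_nat m powr (-s))" for N
    by (rule sum.reindex_bij_witness[of _ "\<lambda>m. m - 1" Suc]) auto
  ultimately have "(\<lambda>N. \<Sum>m=1..N. (-1) ^ (m + 1) * of_nat m powr (-s)) \<longlonglongrightarrow> eta s" by simp
  from LIMSEQ_unique[OF this lim] show ?thesis by (simp add: algebra_simps)
qed

text \<open>The model is zeta minus V. Summability at 1/2 bounds V and all its twists by signs
  uniformly on the closed half-plane Re s \<ge> 1/2, and \<open>v 1 \<ge> 1\<close> makes the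
  leading term of V on the real axis at least 1.\<close>

locale zeta_minus_series =
  fixes v :: "nat \<Rightarrow> real"
  assumes v_nonneg: "v m \<ge> 0" and v1: "v 1 \<ge> 1" and summ_v: "summable (\<lambda>m. v m * real m powr (-(1/2)))"
begin

definition V :: "complex \<Rightarrow> complex" where "V = dirichlet_sum (\<lambda>m. of_real (v m))"
definition Vmax :: real where "Vmax = (\<Sum>m. v m * real m powr (-(1/2)))"
definition xi :: "complex \<Rightarrow> complex" where "xi s = eta s - (1 - 2 * 2 powr (-s)) * V s"

lemma norm_v: "norm (of_real (v m) :: complex) \<le> v m" using v_nonneg[of m] by simp

lemma V_holomorphic: "V holomorphic_on {s. Re s > 1/2}"
  unfolding V_def using dirichlet_sum_holomorphic[OF summ_v norm_v] .

lemma norm_V_le: "Re s \<ge> 1/2 \<Longrightarrow> norm (V s) \<le> Vmax"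
  unfolding V_def Vmax_def by (rule norm_dirichlet_sum_le[OF summ_v norm_v])

lemma Vmax_nonneg: "Vmax \<ge> 0"
  unfolding Vmax_def using v_nonneg by (intro suminf_nonneg summ_v) auto

lemma xi_holomorphic: "xi holomorphic_on {s. Re s > 1/2}"
  unfolding xi_def by (intro holomorphic_intros eta_holomorphic V_holomorphic) auto

lemma xi_eq_dirichlet:
  assumes "Re s > 1"
  shows "xi s = (1 - 2 * 2 powr (-s)) * dirichlet_sum (\<lambda>m. of_real (1 - v m)) s"
proof -
  have "zeta_series s - V s = (\<Sum>m. 1 * of_nat m powr (-s) - of_real (v m) * of_nat m powr (-s))"
    unfolding dirichlet_sum_def V_def
    by (rule suminf_diff) (use assms in \<open>auto intro!: summable_zeta_series[simplified] summable_dirichlet[OF summ_v norm_v]\<close>)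
  also have "\<dots> = dirichlet_sum (\<lambda>m. of_real (1 - v m)) s"
    unfolding dirichlet_sum_def by (simp add: algebra_simps)
  finally show ?thesis using eta_eq_zeta_series[OF assms] by (simp add: xi_def algebra_simps)
qed

text \<open>Some v M with M \<ge> 1 differs from 1, since otherwise the sum of m^(-1/2) would
  converge. For the least such M, the term of index M dominates the Dirichlet series with
  coefficients 1 - v m far to the right.\<close>

lemma xi_bounded_below:
  obtains \<sigma> c0 where "\<sigma> > B" "\<sigma> > 2" "c0 > 0" "\<And>s. Re s = \<sigma> \<Longrightarrow> norm (xi s) \<ge> c0"
proof -
  have "\<exists>m\<ge>1. v m \<noteq> 1"
  proof (rule ccontr)
    assume "\<not> ?thesis"
    hence "v m * real m powr (-(1/2)) = real m powr (-(1/2))" for m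
      by (cases "m = 0") auto
    hence "summable (\<lambda>m. real m powr (-(1/2)))" using summ_v by presburger
    thus False by (simp add: summable_real_powr_iff)
  qed
  then obtain m0 where m0: "m0 \<ge> 1 \<and> v m0 \<noteq> 1" by blast
  define M where "M = (LEAST m. m \<ge> 1 \<and> v m \<noteq> 1)"
  have M: "M \<ge> 1" "v M \<noteq> 1" using LeastI[of "\<lambda>m. m \<ge> 1 \<and> v m \<noteq> 1", OF m0] by (auto simp: M_def)
  have below: "v m = 1" if "1 \<le> m" "m < M" for m
    using not_less_Least[of m "\<lambda>m. m \<ge> 1 \<and> v m \<noteq> 1"] that by (auto simp: M_def)
  define u where "u = (\<lambda>m. 1 + v m)"
  have u0: "u m \<ge> 0" for m using v_nonneg[of m] by (simp add: u_def)
  have sum_u: "summable (\<lambda>m. u m * real m powr (-2))"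
  proof -
    have "summable (\<lambda>m. v m * real m powr (-2))"
    proof (rule summable_comparison_test'[OF summ_v])
      fix m show "norm (v m * real m powr (-2)) \<le> v m * real m powr (-(1/2))"
        using v_nonneg[of m] by (cases "m = 0") (auto intro!: mult_left_mono powr_mono)
    qed
    moreover have "summable (\<lambda>m. real m powr (-2))" by (simp add: summable_real_powr_iff)
    ultimately show ?thesis unfolding u_def by (simp add: distrib_right summable_add)
  qed
  define H where "H = (\<Sum>m. u m * real m powr (-2))"
  have H0: "H \<ge> 0" unfolding H_def using u0 by (intro suminf_nonneg sum_u) auto
  have "((\<lambda>\<sigma>. (real M + 1) powr (2 - \<sigma>) * H / (real M powr (-\<sigma>))) \<longlongrightarrow> 0) at_top"
  proof -
    have "real M > 0" using M by simp
    thus ?thesis by real_asymp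
  qed
  hence "\<forall>\<^sub>F \<sigma> in at_top. (real M + 1) powr (2 - \<sigma>) * H / (real M powr (-\<sigma>)) < \<bar>1 - v M\<bar> / 2"
    using M by (intro order_tendstoD) auto
  hence "\<forall>\<^sub>F \<sigma> in at_top. (real M + 1) powr (2 - \<sigma>) * H / (real M powr (-\<sigma>)) < \<bar>1 - v M\<bar> / 2 \<and> \<sigma> > B \<and> \<sigma> > 2"
    using eventually_gt_at_top[of B] eventually_gt_at_top[of 2] by eventually_elim auto
  then obtain \<sigma> where \<sigma>: "(real M + 1) powr (2 - \<sigma>) * H / (real M powr (-\<sigma>)) < \<bar>1 - v M\<bar> / 2" "\<sigma> > B" "\<sigma> > 2"
    using eventually_happens by force
  have Mpos: "real M powr (-\<sigma>) > 0" using M by simp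
  have tail: "(real M + 1) powr (2 - \<sigma>) * H < \<bar>1 - v M\<bar> / 2 * real M powr (-\<sigma>)"
    using \<sigma>(1) Mpos by (simp add: divide_less_eq)
  define c0 where "c0 = \<bar>1 - v M\<bar> / 4 * real M powr (-\<sigma>)"
  show ?thesis
  proof (rule that[of \<sigma> c0])
    show "c0 > 0" using M Mpos by (simp add: c0_def)
    fix s assume s: "Re s = \<sigma>"
    define f where "f = (\<lambda>m. of_real (1 - v m) * of_nat m powr (-s) :: complex)"
    have bu: "norm (of_real (1 - v m) :: complex) \<le> u m" for m
      using v_nonneg[of m] unfolding u_def norm_of_real by linarith
    have sf: "summable f" unfolding f_def by (rule summable_dirichlet[OF sum_u bu]) (use s \<sigma> in auto)
    have "(\<Sum>m. f m) = (\<Sum>m. f (m + Suc M)) + (\<Sum>m<Suc M. f m)"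
      using suminf_split_initial_segment[OF sf, of "Suc M"] by simp
    also have "(\<Sum>m<Suc M. f m) = f M"
    proof -
      have "f m = 0" if "m < M" for m using below[of m] that by (cases "m = 0") (auto simp: f_def)
      thus ?thesis by simp
    qed
    finally have split: "(\<Sum>m. f m) = (\<Sum>m. f (m + Suc M)) + f M" .
    have "norm (\<Sum>m. f (m + Suc M)) \<le> (\<Sum>m. (real M + 1) powr (2 - \<sigma>) * (u (m + Suc M) * real (m + Suc M) powr (-2)))"
    proof (rule norm_suminf_le)
      fix m
      have "norm (f (m + Suc M)) \<le> u (m + Suc M) * real (m + Suc M) powr (-\<sigma>)"
        unfolding f_def by (rule norm_dirichlet_term_le[OF bu]) (use s in auto)
      also have "real (m + Suc M) powr (-\<sigma>) = real (m + Suc M) powr (2 - \<sigma>) * real (m + Suc M) powr (-2)"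
        by (subst powr_add [symmetric]) simp
      also have "real (m + Suc M) powr (2 - \<sigma>) \<le> (real M + 1) powr (2 - \<sigma>)"
        using \<sigma> by (intro powr_mono2') auto
      finally show "norm (f (m + Suc M)) \<le> (real M + 1) powr (2 - \<sigma>) * (u (m + Suc M) * real (m + Suc M) powr (-2))"
        using u0[of "m + Suc M"] by (simp add: mult_left_mono mult_right_mono mult_ac)
    qed (use sum_u in \<open>auto intro!: summable_mult simp only: summable_iff_shift[of "\<lambda>m. u m * real m powr (-2)"]\<close>)
    also have "\<dots> = (real M + 1) powr (2 - \<sigma>) * (\<Sum>m. u (m + Suc M) * real (m + Suc M) powr (-2))"
      by (rule suminf_mult) (use sum_u in \<open>simp only: summable_iff_shift[of "\<lambda>m. u m * real m powr (-2)"]\<close>)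
    also have "(\<Sum>m. u (m + Suc M) * real (m + Suc M) powr (-2)) \<le> H"
      using suminf_split_initial_segment[OF sum_u, of "Suc M"] sum_nonneg[of "{..<Suc M}" "\<lambda>m. u m * real m powr (-2)"] u0
      unfolding H_def by simp
    finally have t: "norm (\<Sum>m. f (m + Suc M)) < \<bar>1 - v M\<bar> / 2 * real M powr (-\<sigma>)"
      using tail by (smt (verit) mult_left_mono powr_ge_zero)
    have "norm (f M) = \<bar>1 - v M\<bar> * real M powr (-\<sigma>)"
      using s M unfolding f_def norm_mult by (simp add: norm_powr_real_powr del: of_real_diff)
    hence "norm (\<Sum>m. f m) \<ge> \<bar>1 - v M\<bar> / 2 * real M powr (-\<sigma>)"
      using t norm_diff_ineq[of "f M" "\<Sum>m. f (m + Suc M)"] unfolding split by (simp add: add.commute)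
    hence 1: "norm (dirichlet_sum (\<lambda>m. of_real (1 - v m)) s) \<ge> \<bar>1 - v M\<bar> / 2 * real M powr (-\<sigma>)"
      by (simp add: dirichlet_sum_def f_def)
    have "norm ((2::complex) powr (-s)) = 2 powr (-\<sigma>)"
      using norm_powr_real_powr[of 2 "-s"] s by simp
    also have "\<dots> \<le> 2 powr (-2)" using \<sigma> by (intro powr_mono) auto
    also have "\<dots> = 1/4" by (simp add: powr_minus)
    finally have 2: "norm (1 - 2 * (2::complex) powr (-s)) \<ge> 1/2"
      using norm_triangle_ineq2[of 1 "2 * (2::complex) powr (-s)"] by (simp add: norm_mult)
    have "norm (xi s) = norm (1 - 2 * (2::complex) powr (-s)) * norm (dirichlet_sum (\<lambda>m. of_real (1 - v m)) s)"
      using xi_eq_dirichlet[of s] s \<sigma> by (simp add: norm_mult)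
    also have "\<dots> \<ge> 1/2 * (\<bar>1 - v M\<bar> / 2 * real M powr (-\<sigma>))"
      using 1 2 by (intro mult_mono) auto
    finally show "norm (xi s) \<ge> c0" by (simp add: c0_def)
  qed (use \<sigma> in auto)
qed

end

lemma sum_integrals_consecutive:
  fixes F :: "real \<Rightarrow> real"
  assumes h: "h \<ge> 0" and F: "F integrable_on {0..real J * h}"
  shows "(\<Sum>j<J. integral {real j * h..real (Suc j) * h} F) = integral {0..real J * h} F"
  using F
proof (induction J)
  case (Suc J)
  have le: "real J * h \<le> real (Suc J) * h" using h by (simp add: distrib_right)
  have "F integrable_on {0..real J * h}"
    by (rule integrable_subinterval_real[OF Suc.prems]) (use le in auto)
  hence "(\<Sum>j<Suc J. integral {real j * h..real (Suc j) * h} F) =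
     integral {0..real J * h} F + integral {real J * h..real (Suc J) * h} F"
    using Suc.IH by simp
  also have "\<dots> = integral {0..real (Suc J) * h} F"
    using h le by (intro Henstock_Kurzweil_Integration.integral_combine Suc.prems) auto
  finally show ?case .
qed auto

context zeta_minus_series
begin

lemma continuous_on_xi:
  assumes "continuous_on A f" "\<And>x. x \<in> A \<Longrightarrow> Re (f x) > 1/2"
  shows "continuous_on A (\<lambda>x. xi (f x))"
  by (rule continuous_on_compose2[OF holomorphic_on_imp_continuous_on[OF xi_holomorphic] assms(1)])
     (use assms in auto)

lemma xi_mean_square:
  assumes c: "1/2 < c" "c < 1" and R: "R \<ge> 0"
  obtains K where "K > 0" "\<forall>\<^sub>F T in at_top. \<forall>w. Re w \<ge> c \<longrightarrow> norm w \<le> R \<longrightarrow>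
       integral {0..T} (\<lambda>t. (norm (xi (w + \<i> * of_real t)))\<^sup>2) \<le> K * T"
proof -
  obtain K where K: "K > 0" "\<forall>\<^sub>F T in at_top. \<forall>w. Re w \<ge> c \<longrightarrow> norm w \<le> R \<longrightarrow>
       integral {0..T} (\<lambda>t. (norm (eta (w + \<i> * of_real t)))\<^sup>2) \<le> K * T"
    using eta_mean_square[OF c R] by blast
  have "\<forall>\<^sub>F T in at_top. \<forall>w. Re w \<ge> c \<longrightarrow> norm w \<le> R \<longrightarrow>
       integral {0..T} (\<lambda>t. (norm (xi (w + \<i> * of_real t)))\<^sup>2) \<le> (2 * K + 18 * Vmax\<^sup>2) * T"
    using K(2) eventually_ge_at_top[of 0]
  proof eventually_elim
    case (elim T)
    show ?case
    proof (intro allI impI)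
      fix w :: complex assume w: "Re w \<ge> c" "norm w \<le> R"
      have ce: "continuous_on {0..T} (\<lambda>t. eta (w + \<i> * of_real t))"
        by (rule continuous_on_compose2[OF holomorphic_on_imp_continuous_on[OF eta_holomorphic[of UNIV]]])
           (auto intro!: continuous_intros)
      have cx: "continuous_on {0..T} (\<lambda>t. xi (w + \<i> * of_real t))"
        by (rule continuous_on_xi) (use w c in \<open>auto intro!: continuous_intros\<close>)
      have "integral {0..T} (\<lambda>t. (norm (xi (w + \<i> * of_real t)))\<^sup>2) \<le>
            integral {0..T} (\<lambda>t. 2 * (norm (eta (w + \<i> * of_real t)))\<^sup>2 + 18 * Vmax\<^sup>2)"
      proof (rule integral_le)
        show "(\<lambda>t. (norm (xi (w + \<i> * of_real t)))\<^sup>2) integrable_on {0..T}"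
          by (intro integrable_continuous_interval continuous_intros cx)
        show "(\<lambda>t. 2 * (norm (eta (w + \<i> * of_real t)))\<^sup>2 + 18 * Vmax\<^sup>2) integrable_on {0..T}"
          by (intro integrable_continuous_interval continuous_intros ce)
        fix t :: real
        define s where "s = w + \<i> * of_real t"
        have s: "Re s \<ge> 1/2" using w c by (simp add: s_def)
        have "norm ((2::complex) powr (-s)) = 2 powr (- Re s)" using norm_powr_real_powr[of 2 "-s"] by simp
        also have "\<dots> \<le> 2 powr 0" using s by (intro powr_mono) auto
        finally have "norm (1 - 2 * (2::complex) powr (-s)) \<le> 3"
          using norm_triangle_ineq4[of 1 "2 * (2::complex) powr (-s)"] by (simp add: norm_mult)
        hence "norm ((1 - 2 * (2::complex) powr (-s)) * V s) \<le> 3 * Vmax"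
          using norm_V_le[OF s] unfolding norm_mult by (intro mult_mono) auto
        hence "(norm (- ((1 - 2 * (2::complex) powr (-s)) * V s)))\<^sup>2 \<le> (3 * Vmax)\<^sup>2"
          unfolding norm_minus_cancel by (intro power_mono) auto
        hence "(norm (xi s))\<^sup>2 \<le> 2 * (norm (eta s))\<^sup>2 + 18 * Vmax\<^sup>2"
          using norm_add_power2_le[of "eta s" "- ((1 - 2 * (2::complex) powr (-s)) * V s)"]
          by (simp add: xi_def power_mult_distrib)
        thus "(norm (xi (w + \<i> * of_real t)))\<^sup>2 \<le> 2 * (norm (eta (w + \<i> * of_real t)))\<^sup>2 + 18 * Vmax\<^sup>2"
          by (simp add: s_def)
      qed
      also have "\<dots> = 2 * integral {0..T} (\<lambda>t. (norm (eta (w + \<i> * of_real t)))\<^sup>2) + 18 * Vmax\<^sup>2 * T"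
      proof -
        have "(\<lambda>t. (norm (eta (w + \<i> * of_real t)))\<^sup>2) integrable_on {0..T}"
          by (intro integrable_continuous_interval continuous_intros ce)
        thus ?thesis using elim(2) by (subst integral_add) (auto intro: integrable_on_mult_right)
      qed
      also have "integral {0..T} (\<lambda>t. (norm (eta (w + \<i> * of_real t)))\<^sup>2) \<le> K * T" using elim w by simp
      finally show "integral {0..T} (\<lambda>t. (norm (xi (w + \<i> * of_real t)))\<^sup>2) \<le> (2 * K + 18 * Vmax\<^sup>2) * T"
        by (simp add: algebra_simps)
    qed
  qed
  thus ?thesis using that[of "2 * K + 18 * Vmax\<^sup>2"] K(1) by (simp add: add_pos_nonneg)
qed

definition zeros :: "real \<Rightarrow> real \<Rightarrow> real \<Rightarrow> complex set" where
  "zeros \<alpha> \<beta> T = {z. \<alpha> < Re z \<and> Re z < \<beta> \<and> 0 < Im z \<and> Im z < T \<and> xi z = 0}"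

lemma xi_halfplane: "open {s::complex. Re s > 1/2}" "connected {s::complex. Re s > 1/2}"
  by (rule open_halfspace_Re_gt) (rule convex_connected[OF convex_halfspace_Re_gt])

lemma xi_nonzero: "\<exists>w\<in>{s. Re s > 1/2}. xi w \<noteq> 0"
proof -
  obtain \<sigma> c0 where "\<sigma> > (2::real)" "c0 > 0" "\<And>s. Re s = \<sigma> \<Longrightarrow> norm (xi s) \<ge> c0"
    using xi_bounded_below[of 0] by metis
  from this(1,2) this(3)[of "of_real \<sigma>"] show ?thesis by (intro bexI[of _ "of_real \<sigma>"]) auto
qed

lemma finite_zeros:
  assumes "1/2 < \<alpha>"
  shows "finite (zeros \<alpha> \<beta> T)"
proof (cases "xi constant_on {s. Re s > 1/2}")
  case True
  then obtain k where k: "\<And>s. Re s > 1/2 \<Longrightarrow> xi s = k" by (auto simp: constant_on_def)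
  hence "k \<noteq> 0" using xi_nonzero by auto
  hence "zeros \<alpha> \<beta> T = {}" using k assms by (auto simp: zeros_def)
  thus ?thesis by simp
next
  case False
  have "finite {z\<in>cbox (Complex \<alpha> 0) (Complex \<beta> T). xi z = 0}"
    by (rule holomorphic_compact_finite_zeros[OF xi_holomorphic xi_halfplane _ _ False])
       (use assms in \<open>auto simp: in_cbox_complex_iff\<close>)
  thus ?thesis by (rule rev_finite_subset) (auto simp: zeros_def in_cbox_complex_iff)
qed

lemma zorder_xi_nonneg:
  assumes "Re z > 1/2"
  shows "zorder xi z \<ge> 0" "xi z = 0 \<Longrightarrow> zorder xi z \<ge> 1"
proof -
  have an: "xi analytic_on {z}"
    using xi_holomorphic xi_halfplane assms analytic_at by blast
  obtain w where w: "w \<in> {s. Re s > 1/2}" "xi w \<noteq> 0" using xi_nonzero by blast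
  have "eventually (\<lambda>z. xi z \<noteq> 0) (at z)"
    using non_zero_neighbour_alt[OF xi_holomorphic xi_halfplane _ w, of z] assms by (auto elim: eventually_mono)
  hence "frequently (\<lambda>z. xi z \<noteq> 0) (at z)" by (rule eventually_frequently[rotated]) simp
  from zorder_ge_0[OF an this] zorder_pos_iff'[OF an this]
  show "zorder xi z \<ge> 0" "xi z = 0 \<Longrightarrow> zorder xi z \<ge> 1" by auto
qed

lemma zero_count_upper:
  assumes \<alpha>: "1/2 < \<alpha>" "\<alpha> < 1" "\<alpha> < \<beta>"
  obtains C where "C > 0" "\<forall>\<^sub>F T in at_top. real_of_int (\<Sum>z\<in>zeros \<alpha> \<beta> T. zorder xi z) \<le> C * T"
proof -
  obtain \<sigma> c0 where \<sigma>: "\<sigma> > max \<beta> 2" "c0 > 0" and low: "\<And>s. Re s = \<sigma> \<Longrightarrow> norm (xi s) \<ge> c0"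
    using xi_bounded_below[of "max \<beta> 2"] by metis
  \<comment> \<open>The line \<alpha> lies 4h to the right of 1/2. The discs of radius r, R, R'
    about \<sigma> reach to 1/2 + 3h, 1/2 + 2h and 1/2 + h. As r = (\<sigma> - \<alpha>) + h, the
    smallest disc contains the part of the strip in a window of height h whenever the height of its
    centre lies in that window.\<close>
  define h where "h = (\<alpha> - 1/2) / 4"
  define R' where "R' = \<sigma> - 1/2 - h"
  define R where "R = \<sigma> - 1/2 - 2 * h"
  define r where "r = \<sigma> - 1/2 - 3 * h"
  define c where "c = 1/2 + h"
  have h: "h > 0" "h < 1/8" using \<alpha> by (auto simp: h_def)
  have rR: "0 < r" "r < R" "R < R'" using h \<sigma> by (auto simp: r_def R_def R'_def)
  have c: "1/2 < c" "c < 1" using h by (auto simp: c_def)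
  let ?z = "\<lambda>\<tau>::real. of_real \<sigma> + \<i> * of_real \<tau> :: complex"
  let ?g = "\<lambda>\<tau> x. (norm (xi (circlepath (?z \<tau>) R' x)))\<^sup>2"
  define Q where "Q = (\<lambda>\<tau>. integral {0..1} (?g \<tau>))"
  have circ: "circlepath (?z \<tau>) R' x = circlepath (of_real \<sigma>) R' x + \<i> * of_real \<tau>" for \<tau> x
    by (simp add: circlepath)
  have cnorm: "norm (circlepath z R' x - z) = R'" for z x
    using rR by (simp add: circlepath norm_mult norm_exp_eq_Re)
  have circRe: "Re (circlepath (of_real \<sigma>) R' x) \<ge> c" for x
  proof -
    have "\<bar>Re (circlepath (of_real \<sigma>) R' x - of_real \<sigma>)\<bar> \<le> R'"
      using abs_Re_le_cmod[of "circlepath (of_real \<sigma>) R' x - of_real \<sigma>"] cnorm by simp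
    thus ?thesis by (simp add: R'_def c_def)
  qed
  have circnorm: "norm (circlepath (of_real \<sigma>) R' x) \<le> \<sigma> + R'" for x
    using norm_triangle_ineq[of "of_real \<sigma>" "circlepath (of_real \<sigma>) R' x - of_real \<sigma>"] cnorm[of "of_real \<sigma>" x] \<sigma> by simp
  have contg: "continuous_on (A \<times> B) (\<lambda>(\<tau>, x). ?g \<tau> x)" for A B :: "real set"
    unfolding split_def
  proof (intro continuous_intros continuous_on_xi)
    show "continuous_on (A \<times> B) (\<lambda>p. circlepath (?z (fst p)) R' (snd p))"
      unfolding circlepath by (intro continuous_intros)
    show "Re (circlepath (?z (fst p)) R' (snd p)) > 1/2" for p
      using circRe[of "snd p"] c unfolding circ by simp
  qed
  have contQ: "continuous_on A Q" for A
    unfolding Q_def using integral_continuous_on_param[of A 0 1 ?g] contg[of A "cbox 0 1"] by simp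
  have contgx: "continuous_on {0..1} (?g \<tau>)" for \<tau>
  proof (intro continuous_intros continuous_on_xi)
    show "continuous_on {0..1} (circlepath (?z \<tau>) R')" unfolding circlepath by (intro continuous_intros)
    show "Re (circlepath (?z \<tau>) R' x) > 1/2" for x
      using circRe[of x] c unfolding circ by simp
  qed
  have Q0: "Q \<tau> \<ge> 0" for \<tau>
    unfolding Q_def by (intro integral_nonneg integrable_continuous_interval contgx) auto
  define Kq where "Kq = R' / (R' - R)"
  have Kq: "Kq > 0" using rR by (simp add: Kq_def)
  \<comment> \<open>Bernoulli's inequality (R/r)^n \<ge> n (R/r - 1) and sqrt y \<le> 1 + y make the
    bound for the number of zeros linear in the mean square Q.\<close>
  define C1 where "C1 = (1 + Kq) / (c0 * (R / r - 1))"
  have C1: "C1 > 0" unfolding C1_def using Kq \<sigma> rR by (intro divide_pos_pos mult_pos_pos) auto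
  have sub: "cball (?z \<tau>) R' \<subseteq> {s. Re s > 1/2}" for \<tau>
  proof
    fix s assume "s \<in> cball (?z \<tau>) R'"
    hence "\<bar>Re (s - ?z \<tau>)\<bar> \<le> R'"
      using abs_Re_le_cmod[of "s - ?z \<tau>"] by (simp add: dist_norm norm_minus_commute)
    thus "s \<in> {s. Re s > 1/2}" using h by (simp add: R'_def)
  qed
  have count: "real (\<Sum>a\<in>Z. nat (zorder xi a)) \<le> C1 * (1 + Q \<tau>)"
    if Z: "finite Z" "Z \<subseteq> cball (?z \<tau>) r" for Z \<tau>
  proof -
    define n where "n = (\<Sum>a\<in>Z. nat (zorder xi a))"
    have "(R / r) ^ n * norm (xi (?z \<tau>)) \<le> sqrt (Kq * Q \<tau>)"
      unfolding n_def
    proof (rule jensen_zero_count[OF xi_holomorphic xi_halfplane])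
      show "cball (?z \<tau>) R \<subseteq> {s. Re s > 1/2}"
        using sub[of \<tau>] rR by (meson less_imp_le order_trans subset_cball)
      show "xi (?z \<tau>) \<noteq> 0" using low[of "?z \<tau>"] \<sigma> by auto
      fix s assume s: "s \<in> sphere (?z \<tau>) R"
      have "norm ((xi s)\<^sup>2) \<le> R' / (R' - R) * integral {0..1} (\<lambda>x. norm ((xi (circlepath (?z \<tau>) R' x))\<^sup>2))"
        by (rule norm_le_circle_mean[OF holomorphic_on_power[OF xi_holomorphic] sub]) (use rR s in auto)
      hence "(norm (xi s))\<^sup>2 \<le> Kq * Q \<tau>" by (simp add: norm_power Kq_def Q_def)
      thus "norm (xi s) \<le> sqrt (Kq * Q \<tau>)" by (rule real_le_rsqrt)
    qed (use Z rR in auto)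
    also have "sqrt (Kq * Q \<tau>) \<le> 1 + Kq * Q \<tau>"
    proof (rule real_le_lsqrt)
      show "Kq * Q \<tau> \<le> (1 + Kq * Q \<tau>)\<^sup>2"
        using Kq Q0[of \<tau>] by (simp add: power2_eq_square algebra_simps)
    qed (use Kq Q0[of \<tau>] in auto)
    finally have 1: "(R / r) ^ n * norm (xi (?z \<tau>)) \<le> 1 + Kq * Q \<tau>" .
    have "real n * (R / r - 1) \<le> (R / r) ^ n"
    proof -
      have "R / r - 1 \<ge> -1" using rR by simp
      from Bernoulli_inequality[OF this, of n] show ?thesis by simp
    qed
    hence "real n * (R / r - 1) * c0 \<le> (R / r) ^ n * norm (xi (?z \<tau>))"
      using low[of "?z \<tau>"] \<sigma> rR by (intro mult_mono) auto
    also note 1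
    also have "1 + Kq * Q \<tau> \<le> (1 + Kq) * (1 + Q \<tau>)" using Kq Q0[of \<tau>] by (simp add: algebra_simps)
    finally have "real n * (c0 * (R / r - 1)) \<le> (1 + Kq) * (1 + Q \<tau>)" by (simp add: mult_ac)
    moreover have "c0 * (R / r - 1) > 0" using \<sigma> rR by (intro mult_pos_pos) auto
    ultimately show ?thesis unfolding n_def [symmetric] C1_def by (simp add: pos_le_divide_eq)
  qed
  obtain K where K: "K > 0" "\<forall>\<^sub>F T in at_top. \<forall>w. Re w \<ge> c \<longrightarrow> norm w \<le> \<sigma> + R' \<longrightarrow>
       integral {0..T} (\<lambda>t. (norm (xi (w + \<i> * of_real t)))\<^sup>2) \<le> K * T"
    using xi_mean_square[OF c, of "\<sigma> + R'"] \<sigma> rR by auto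
  then obtain T0 where T0: "\<And>T w. T \<ge> T0 \<Longrightarrow> Re w \<ge> c \<Longrightarrow> norm w \<le> \<sigma> + R' \<Longrightarrow>
       integral {0..T} (\<lambda>t. (norm (xi (w + \<i> * of_real t)))\<^sup>2) \<le> K * T"
    unfolding eventually_at_top_linorder by blast
  \<comment> \<open>Interchanging the integrals turns the mean over moving circles into mean squares
    on vertical lines, with a bound uniform in the point of the circle.\<close>
  have intQ: "integral {0..T} Q \<le> K * T" if T: "T \<ge> T0" for T
  proof -
    have "integral (cbox 0 T) (\<lambda>\<tau>. integral (cbox 0 1) (?g \<tau>)) = integral (cbox 0 1) (\<lambda>x. integral (cbox 0 T) (\<lambda>\<tau>. ?g \<tau> x))"
      by (rule integral_swap_continuous) (use contg in \<open>simp add: cbox_Pair_eq\<close>)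
    hence "integral {0..T} Q = integral {0..1} (\<lambda>x. integral {0..T} (\<lambda>\<tau>. ?g \<tau> x))"
      by (simp add: Q_def)
    also have "\<dots> \<le> integral {0..1::real} (\<lambda>x. K * T)"
    proof (rule integral_le)
      have "continuous_on ({0..1} \<times> cbox 0 T) (\<lambda>(x, \<tau>). ?g \<tau> x)"
        unfolding split_def
      proof (intro continuous_intros continuous_on_xi)
        show "continuous_on ({0..1} \<times> cbox 0 T) (\<lambda>p. circlepath (?z (snd p)) R' (fst p))"
          unfolding circlepath by (intro continuous_intros)
        show "Re (circlepath (?z (snd p)) R' (fst p)) > 1/2" for p
          using circRe[of "fst p"] c unfolding circ by simp
      qed
      hence "continuous_on {0..1} (\<lambda>x. integral (cbox 0 T) (\<lambda>\<tau>. ?g \<tau> x))"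
        by (rule integral_continuous_on_param)
      thus "(\<lambda>x. integral {0..T} (\<lambda>\<tau>. ?g \<tau> x)) integrable_on {0..1}"
        by (intro integrable_continuous_interval) simp
      show "integral {0..T} (\<lambda>\<tau>. ?g \<tau> x) \<le> K * T" for x
        unfolding circ by (intro T0 T circRe circnorm)
    qed auto
    also have "\<dots> = K * T" by simp
    finally show ?thesis .
  qed
  define C where "C = 2 * C1 * (1 + K) / h"
  have "real_of_int (\<Sum>z\<in>zeros \<alpha> \<beta> T. zorder xi z) \<le> C * T" if T: "T \<ge> max T0 1" for T
  proof -
    \<comment> \<open>The last window may reach past T by at most h; the factor 2 in C absorbs this,
      as T \<ge> 1 > h.\<close>
    define J where "J = nat \<lceil>T / h\<rceil>"
    define T' where "T' = real J * h"
    have "T / h \<le> real J" "real J \<le> T / h + 1"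
    proof -
      have "T / h \<ge> 0" using T h by simp
      thus "T / h \<le> real J" "real J \<le> T / h + 1" unfolding J_def by linarith+
    qed
    hence T': "T \<le> T'" "T' \<le> T + h" using h by (auto simp: T'_def field_simps)
    define Z where "Z = zeros \<alpha> \<beta> T"
    have finZ: "finite Z" unfolding Z_def by (rule finite_zeros) fact
    define g where "g = (\<lambda>z. nat \<lfloor>Im z / h\<rfloor>)"
    have gJ: "g ` Z \<subseteq> {..<J}"
    proof clarify
      fix z assume "z \<in> Z"
      hence "Im z > 0" "Im z < T" by (auto simp: Z_def zeros_def)
      hence "Im z / h < T / h" "Im z / h > 0" using h by (auto simp: divide_strict_right_mono)
      with \<open>T / h \<le> real J\<close> have "Im z / h < real J" "Im z / h > 0" by linarith+
      thus "g z < J" unfolding g_def by linarith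
    qed
    \<comment> \<open>The bound holds for every centre height \<tau> in the window that contains the
      zeros, so it may be averaged over the window.\<close>
    have part: "h * real (\<Sum>z\<in>{z\<in>Z. g z = j}. nat (zorder xi z)) \<le> integral {real j * h..real (Suc j) * h} (\<lambda>\<tau>. C1 * (1 + Q \<tau>))" for j
    proof -
      let ?n = "real (\<Sum>z\<in>{z\<in>Z. g z = j}. nat (zorder xi z))"
      have "h * ?n = integral {real j * h..real (Suc j) * h} (\<lambda>_. ?n)"
        using h by (simp add: distrib_right)
      also have "\<dots> \<le> integral {real j * h..real (Suc j) * h} (\<lambda>\<tau>. C1 * (1 + Q \<tau>))"
      proof (rule integral_le)
        show "(\<lambda>\<tau>. C1 * (1 + Q \<tau>)) integrable_on {real j * h..real (Suc j) * h}"
          by (intro integrable_continuous_interval continuous_intros contQ)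
        fix \<tau> assume \<tau>: "\<tau> \<in> {real j * h..real (Suc j) * h}"
        show "?n \<le> C1 * (1 + Q \<tau>)"
        proof (rule count)
          show "{z \<in> Z. g z = j} \<subseteq> cball (?z \<tau>) r"
          proof clarify
            fix z assume z: "z \<in> Z" and j: "j = g z"
            have zz: "\<alpha> < Re z" "Re z < \<beta>" "Im z > 0" using z by (auto simp: Z_def zeros_def)
            have "Im z / h \<ge> 0" using zz h by simp
            hence "real j \<le> Im z / h" "Im z / h \<le> real (Suc j)" unfolding j g_def by linarith+
            hence "real j * h \<le> Im z" "Im z \<le> real (Suc j) * h" using h by (auto simp: field_simps)
            hence "\<bar>Im z - \<tau>\<bar> \<le> h" using \<tau> by (auto simp: abs_le_iff algebra_simps)
            moreover have "\<bar>Re z - \<sigma>\<bar> \<le> \<sigma> - \<alpha>" using zz \<sigma> by (auto simp: abs_le_iff)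
            ultimately have "norm (z - ?z \<tau>) \<le> (\<sigma> - \<alpha>) + h"
              using cmod_le[of "z - ?z \<tau>"] by simp
            also have "\<dots> = r" by (simp add: r_def h_def field_simps)
            finally show "z \<in> cball (?z \<tau>) r" by (simp add: dist_norm norm_minus_commute)
          qed
        qed (use finZ in auto)
      qed auto
      finally show ?thesis .
    qed
    have "real_of_int (\<Sum>z\<in>Z. zorder xi z) = real (\<Sum>z\<in>Z. nat (zorder xi z))"
    proof -
      have "real_of_int (zorder xi z) = real (nat (zorder xi z))" if "z \<in> Z" for z
        using \<alpha> that by (auto simp: Z_def zeros_def zorder_xi_nonneg(1))
      thus ?thesis by (simp only: of_int_sum of_nat_sum) (rule sum.cong, auto)
    qed
    also have "(\<Sum>z\<in>Z. nat (zorder xi z)) = (\<Sum>j<J. \<Sum>z\<in>{z\<in>Z. g z = j}. nat (zorder xi z))"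
      using sum.group[OF finZ _ gJ, of "\<lambda>z. nat (zorder xi z)"] by simp
    finally have "h * real_of_int (\<Sum>z\<in>Z. zorder xi z) = (\<Sum>j<J. h * real (\<Sum>z\<in>{z\<in>Z. g z = j}. nat (zorder xi z)))"
      by (simp add: sum_distrib_left)
    also have "\<dots> \<le> (\<Sum>j<J. integral {real j * h..real (Suc j) * h} (\<lambda>\<tau>. C1 * (1 + Q \<tau>)))"
      by (intro sum_mono part)
    also have "\<dots> = integral {0..T'} (\<lambda>\<tau>. C1 * (1 + Q \<tau>))"
      unfolding T'_def using h
      by (intro sum_integrals_consecutive integrable_continuous_interval continuous_intros contQ) auto
    also have "\<dots> = C1 * (T' + integral {0..T'} Q)"
      using T T' by (simp add: integral_add integrable_continuous_interval contQ)
    also have "\<dots> \<le> C1 * (T' + K * T')"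
      using C1 T T' by (intro mult_left_mono add_left_mono intQ) auto
    also have "\<dots> = C1 * (1 + K) * T'" by (simp add: algebra_simps)
    also have "\<dots> \<le> C1 * (1 + K) * (2 * T)" using C1 K T T' h by (intro mult_left_mono) auto
    finally show ?thesis using h by (simp add: Z_def C_def field_simps)
  qed
  hence "\<forall>\<^sub>F T in at_top. real_of_int (\<Sum>z\<in>zeros \<alpha> \<beta> T. zorder xi z) \<le> C * T"
    unfolding eventually_at_top_linorder by blast
  moreover have "C > 0" using C1 K h by (simp add: C_def)
  ultimately show ?thesis using that by blast
qed

end

section \<open>Signs of the primes\<close>

definition nth_prime :: "nat \<Rightarrow> nat" where "nth_prime = enumerate {p. prime p}"

lemma prime_nth_prime: "prime (nth_prime i)"
  using enumerate_in_set[OF primes_infinite, of i] by (simp add: nth_prime_def)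

lemma nth_prime_ge: "nth_prime i \<ge> i" "nth_prime i \<ge> 2"
  using le_enumerate[OF primes_infinite, of i] prime_ge_2_nat[OF prime_nth_prime[of i]]
  by (simp_all add: nth_prime_def)

lemma strict_mono_nth_prime: "strict_mono nth_prime"
  unfolding nth_prime_def by (rule strict_mono_enumerate[OF primes_infinite])

lemma nth_prime_less_iff: "nth_prime i < nth_prime j \<longleftrightarrow> i < j"
  using strict_mono_less[OF strict_mono_nth_prime] .

lemma inj_nth_prime: "inj nth_prime"
  using strict_mono_imp_inj_on[OF strict_mono_nth_prime] .

lemma nth_prime_surj: "prime p \<Longrightarrow> \<exists>i. nth_prime i = p"
  using enumerate_Ex[of "{p. prime p}" p] primes_infinite by (auto simp: nth_prime_def)

text \<open>A finite Euler product. In the induction, the multiples of p in the set are p times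
  members of the same set, so the sum multiplied by 1 - 1/p is at most the sum for the smaller set
  of primes.\<close>

lemma sum_smooth_inverse_le:
  assumes "finite P" "\<And>p. p \<in> P \<Longrightarrow> prime p"
  shows "(\<Sum>m\<in>{m\<in>{1..N}. \<forall>q. prime q \<longrightarrow> q dvd m \<longrightarrow> q \<in> P}. 1 / real m) \<le> (\<Prod>p\<in>P. 1 / (1 - 1 / real p))"
  using assms
proof (induction P rule: finite_induct)
  case empty
  have "{m\<in>{1..N}. \<forall>q. prime q \<longrightarrow> q dvd m \<longrightarrow> q \<in> {}} \<subseteq> {1::nat}"
  proof
    fix m :: nat assume "m \<in> {m\<in>{1..N}. \<forall>q. prime q \<longrightarrow> q dvd m \<longrightarrow> q \<in> {}}"
    hence "\<not> (\<exists>q. prime q \<and> q dvd m)" by blast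
    thus "m \<in> {1}" using prime_factor_nat[of m] by blast
  qed
  hence "(\<Sum>m\<in>{m\<in>{1..N}. \<forall>q. prime q \<longrightarrow> q dvd m \<longrightarrow> q \<in> {}}. 1 / real m) \<le> (\<Sum>m\<in>{1::nat}. 1 / real m)"
    by (intro sum_mono2) auto
  thus ?case by simp
next
  case (insert p P)
  define A where "A = (\<lambda>P. {m\<in>{1..N}. \<forall>q. prime q \<longrightarrow> q dvd m \<longrightarrow> q \<in> P})"
  have p: "prime p" "p \<ge> 2" using insert.prems prime_ge_2_nat by auto
  let ?D = "{m\<in>A (insert p P). p dvd m}"
  have fin: "finite (A Q)" for Q by (simp add: A_def)
  have "A (insert p P) = A P \<union> ?D" unfolding A_def by auto
  hence "(\<Sum>m\<in>A (insert p P). 1 / real m) \<le> (\<Sum>m\<in>A P. 1 / real m) + (\<Sum>m\<in>?D. 1 / real m)"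
    using sum.union_inter[of "A P" ?D "\<lambda>m. 1 / real m"] sum_nonneg[of "A P \<inter> ?D" "\<lambda>m. 1 / real m"] fin by simp
  also have "(\<Sum>m\<in>?D. 1 / real m) = (\<Sum>m\<in>?D. 1 / real p * (1 / real (m div p)))"
    using p by (intro sum.cong refl) (auto elim!: dvdE)
  also have "\<dots> = (\<Sum>m\<in>(\<lambda>m. m div p) ` ?D. 1 / real p * (1 / real m))"
    by (subst sum.reindex) (auto simp: inj_on_def elim!: dvdE)
  also have "\<dots> \<le> (\<Sum>m\<in>A (insert p P). 1 / real p * (1 / real m))"
  proof (rule sum_mono2)
    show "(\<lambda>m. m div p) ` ?D \<subseteq> A (insert p P)"
    proof clarify
      fix m assume m: "m \<in> A (insert p P)" "p dvd m"
      then obtain k where k: "m = p * k" by auto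
      have pk: "1 \<le> p * k" "p * k \<le> N" using m unfolding A_def k by auto
      have "k \<le> p * k" using p by simp
      with pk have "k \<le> N" by linarith
      moreover have "k \<ge> 1" using pk by (cases k) auto
      ultimately show "m div p \<in> A (insert p P)" using m p unfolding A_def k by auto
    qed
  qed (use fin in auto)
  also have "\<dots> = 1 / real p * (\<Sum>m\<in>A (insert p P). 1 / real m)" by (rule sum_distrib_left [symmetric])
  finally have "(\<Sum>m\<in>A (insert p P). 1 / real m) * (1 - 1 / real p) \<le> (\<Sum>m\<in>A P. 1 / real m)"
    by (simp add: algebra_simps)
  also have "\<dots> \<le> (\<Prod>p\<in>P. 1 / (1 - 1 / real p))"
    unfolding A_def by (rule insert.IH) (use insert.prems in auto)
  finally have "(\<Sum>m\<in>A (insert p P). 1 / real m) \<le> (\<Prod>p\<in>P. 1 / (1 - 1 / real p)) / (1 - 1 / real p)"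
    using p by (subst pos_le_divide_eq) auto
  thus ?case unfolding A_def using insert by simp
qed

text \<open>Euler's argument: if the sum were S, then the finite Euler product and 1/(1 - x) \<le>
  exp (2x) for 0 < x \<le> 1/2 would bound all harmonic sums by exp (2S).\<close>

lemma not_summable_inverse_primes: "\<not> summable (\<lambda>i. 1 / real (nth_prime i))"
proof
  assume s: "summable (\<lambda>i. 1 / real (nth_prime i))"
  define S where "S = (\<Sum>i. 1 / real (nth_prime i))"
  have "harm N \<le> exp (2 * S)" for N :: nat
  proof -
    define P where "P = nth_prime ` {..N}"
    have P: "finite P" "\<And>p. p \<in> P \<Longrightarrow> prime p" by (auto simp: P_def prime_nth_prime)
    have "{m\<in>{1..N}. \<forall>q. prime q \<longrightarrow> q dvd m \<longrightarrow> q \<in> P} = {1..N}"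
    proof -
      have "q \<in> P" if "prime q" "q dvd m" "1 \<le> m" "m \<le> N" for q m
      proof -
        obtain i where i: "nth_prime i = q" using nth_prime_surj \<open>prime q\<close> by blast
        have "i \<le> N" using nth_prime_ge(1)[of i] i dvd_imp_le[OF that(2)] that by linarith
        thus ?thesis using i by (auto simp: P_def)
      qed
      thus ?thesis by auto
    qed
    hence "harm N \<le> (\<Prod>p\<in>P. 1 / (1 - 1 / real p))"
      using sum_smooth_inverse_le[OF P, of N] by (simp add: harm_def inverse_eq_divide)
    also have "\<dots> \<le> (\<Prod>p\<in>P. exp (2 * (1 / real p)))"
    proof (intro prod_mono conjI)
      fix p assume "p \<in> P"
      hence "p \<ge> 2" using P(2) prime_ge_2_nat by auto
      hence x: "1 / real p \<le> 1/2" "1 / real p > 0" by (auto simp: field_simps)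
      show "0 \<le> 1 / (1 - 1 / real p)" using x by simp
      have "1 / (1 - 1 / real p) \<le> 1 + 2 * (1 / real p)"
        using x by (subst pos_divide_le_eq) (auto simp: algebra_simps power2_eq_square[symmetric] power_divide field_simps)
      also have "\<dots> \<le> exp (2 * (1 / real p))" by (rule exp_ge_add_one_self)
      finally show "1 / (1 - 1 / real p) \<le> exp (2 * (1 / real p))" .
    qed
    also have "\<dots> = exp (2 * (\<Sum>p\<in>P. 1 / real p))" using P by (simp add: exp_sum sum_distrib_left)
    also have "(\<Sum>p\<in>P. 1 / real p) = (\<Sum>i\<le>N. 1 / real (nth_prime i))"
      unfolding P_def by (subst sum.reindex) (auto intro: inj_on_subset[OF inj_nth_prime])
    also have "exp (2 * (\<Sum>i\<le>N. 1 / real (nth_prime i))) \<le> exp (2 * S)"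
      unfolding S_def by (simp, intro sum_le_suminf s) auto
    finally show ?thesis .
  qed
  moreover have "filterlim (harm :: nat \<Rightarrow> real) at_top sequentially" by (rule harm_at_top)
  hence "\<exists>N. (harm N :: real) > exp (2 * S)"
    unfolding filterlim_at_top_dense eventually_sequentially by blast
  ultimately show False by (meson not_less)
qed

text \<open>Stated for sums from an arbitrary position, because each block of signs has to start
  after the preceding one.\<close>

lemma sum_primes_powr_unbounded:
  assumes "\<sigma> \<le> 1"
  obtains d where "c \<le> d" "(\<Sum>i=c..<d. real (nth_prime i) powr (-\<sigma>)) \<ge> L"
proof -
  have "\<exists>d\<ge>c. (\<Sum>i=c..<d. real (nth_prime i) powr (-\<sigma>)) \<ge> L"
  proof (rule ccontr)
    assume neg: "\<not> ?thesis"
    have "summable (\<lambda>i. real (nth_prime (i + c)) powr (-\<sigma>))"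
    proof (rule bounded_imp_summable)
      show "(\<Sum>i\<le>n. real (nth_prime (i + c)) powr (-\<sigma>)) \<le> L" for n
      proof -
        have "(\<Sum>i\<le>n. real (nth_prime (i + c)) powr (-\<sigma>)) = (\<Sum>i=c..<c + Suc n. real (nth_prime i) powr (-\<sigma>))"
          by (rule sum.reindex_bij_witness[of _ "\<lambda>i. i - c" "\<lambda>i. i + c"]) auto
        thus ?thesis using neg[simplified, rule_format, of "c + Suc n"] by simp
      qed
    qed auto
    hence "summable (\<lambda>i. 1 / real (nth_prime (i + c)))"
    proof (rule summable_comparison_test'[where N = 0])
      fix i
      have "real (nth_prime (i + c)) powr (-1) \<le> real (nth_prime (i + c)) powr (-\<sigma>)"
        using assms nth_prime_ge(2)[of "i + c"] by (intro powr_mono) auto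
      thus "norm (1 / real (nth_prime (i + c))) \<le> real (nth_prime (i + c)) powr (-\<sigma>)"
        by (simp add: powr_minus_divide)
    qed
    thus False using not_summable_inverse_primes summable_iff_shift[of "\<lambda>i. 1 / real (nth_prime i)" c] by simp
  qed
  thus ?thesis using that by blast
qed

text \<open>The signs are indexed by position: \<open>sg i\<close> is the value at \<open>nth_prime i\<close>.\<close>

definition sign_char :: "(nat \<Rightarrow> real) \<Rightarrow> nat \<Rightarrow> real" where
  "sign_char sg m = (\<Prod>q\<in>#prime_factorization m. sg (inv nth_prime q))"

lemma sign_char_1 [simp]: "sign_char sg (Suc 0) = 1" "sign_char sg 1 = 1"
  by (simp_all add: sign_char_def)

lemma sign_char_mult: "m \<noteq> 0 \<Longrightarrow> n \<noteq> 0 \<Longrightarrow> sign_char sg (m * n) = sign_char sg m * sign_char sg n"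
  by (simp add: sign_char_def prime_factorization_mult)

lemma sign_char_nth_prime: "sign_char sg (nth_prime i) = sg i"
  using inj_nth_prime by (simp add: sign_char_def prime_factorization_prime prime_nth_prime)

lemma abs_sign_char: "(\<And>i. \<bar>sg i\<bar> = 1) \<Longrightarrow> \<bar>sign_char sg m\<bar> = 1"
proof -
  assume sg: "\<And>i. \<bar>sg i\<bar> = 1"
  have "\<bar>\<Prod>q\<in>#A. sg (inv nth_prime q)\<bar> = 1" for A
    by (induction A) (auto simp: abs_mult sg)
  thus ?thesis unfolding sign_char_def .
qed

lemma sign_char_eq_1:
  assumes "\<And>i. i < a \<Longrightarrow> sg i = 1" "m < nth_prime a"
  shows "sign_char sg m = 1"
proof -
  have "sg (inv nth_prime q) = 1" if q: "q \<in># prime_factorization m" for q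
  proof -
    have "prime q" "q dvd m" "m \<noteq> 0" using q by (auto simp: in_prime_factors_iff)
    then obtain i where i: "nth_prime i = q" using nth_prime_surj by blast
    have "q \<le> m" using \<open>q dvd m\<close> \<open>m \<noteq> 0\<close> by (simp add: dvd_imp_le)
    hence "i < a" using assms(2) i nth_prime_less_iff[of i a] by simp
    moreover have "inv nth_prime q = i" using i inj_nth_prime by (auto simp: inv_f_eq)
    ultimately show ?thesis using assms by simp
  qed
  hence "image_mset (\<lambda>q. sg (inv nth_prime q)) (prime_factorization m) = image_mset (\<lambda>_. 1) (prime_factorization m)"
    by (intro image_mset_cong)
  thus ?thesis by (simp add: sign_char_def)
qed

section \<open>Products over the primes with prescribed signs\<close>

abbreviation prime_powr :: "nat \<Rightarrow> real \<Rightarrow> real" where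
  "prime_powr i \<sigma> \<equiv> real (nth_prime i) powr (-\<sigma>)"

lemma prime_powr_pos: "prime_powr i \<sigma> > 0"
  using nth_prime_ge(2)[of i] by simp

lemma prime_powr_less_1: "\<sigma> > 0 \<Longrightarrow> prime_powr i \<sigma> < 1"
  using nth_prime_ge(2)[of i] powr_less_mono[of "-\<sigma>" 0 "real (nth_prime i)"] by simp

lemma prime_powr_antimono: "\<sigma> \<ge> 0 \<Longrightarrow> i \<le> j \<Longrightarrow> prime_powr j \<sigma> \<le> prime_powr i \<sigma>"
  using nth_prime_ge(2)[of i] strict_mono_less_eq[OF strict_mono_nth_prime, of i j]
  by (intro powr_mono2') auto

lemma prod_even_odd_pairs:
  fixes f :: "nat \<Rightarrow> 'a :: comm_monoid_mult"
  assumes "u \<le> w"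
  shows "(\<Prod>i=2*u..<2*w. f i) = (\<Prod>j=u..<w. f (2 * j) * f (2 * j + 1))"
  using assms
proof (induction w rule: dec_induct)
  case (step w)
  have "(\<Prod>i=2*u..<2*Suc w. f i) = (\<Prod>i=2*u..<2*w. f i) * f (2*w) * f (2*w+1)"
    using step by (simp add: prod.atLeastLessThan_Suc)
  thus ?case using step by (simp add: mult.assoc)
qed auto

lemma one_minus_ge_exp:
  fixes x :: real assumes "0 \<le> x" "x \<le> 1/2"
  shows "1 - x \<ge> exp (- 2 * x)"
proof -
  have "(1 - x) * (1 + 2 * x) = 1 + x * (1 - 2 * x)" by (simp add: algebra_simps)
  also have "\<dots> \<ge> 1" using assms by simp
  finally have "1 \<le> (1 - x) * (1 + 2 * x)" .
  also have "\<dots> \<le> (1 - x) * exp (2 * x)"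
    using assms by (intro mult_left_mono exp_ge_add_one_self) auto
  finally show ?thesis by (simp add: exp_minus field_simps)
qed

text \<open>A lower bound for all alternating blocks that depends on c alone: the 1 stands for a
  telescoping sum of differences, the series for a sum of squares.\<close>

definition alt_const :: "real \<Rightarrow> real" where
  "alt_const c = exp (- 2 * (1 + (\<Sum>j. real j powr (-2 * c))))"

lemma prime_powr_even_sq_le:
  assumes "0 \<le> c" "c \<le> \<sigma>" "j \<ge> 1"
  shows "(prime_powr (2 * j) \<sigma>)\<^sup>2 \<le> real j powr (-2 * c)"
proof -
  have ge: "real (nth_prime (2 * j)) \<ge> real j" using nth_prime_ge(1)[of "2 * j"] by simp
  have "prime_powr (2 * j) \<sigma> \<le> real j powr (-\<sigma>)" using ge assms by (intro powr_mono2') auto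
  also have "\<dots> \<le> real j powr (-c)" using assms by (intro powr_mono) auto
  finally have "(prime_powr (2 * j) \<sigma>)\<^sup>2 \<le> (real j powr (-c))\<^sup>2" by (intro power_mono) auto
  also have "\<dots> = real j powr (-2 * c)"
    unfolding power2_eq_square by (subst powr_add [symmetric]) simp
  finally show ?thesis .
qed

text \<open>Pairing neighbours, (1 - x)(1 + y) = 1 - \<delta> with \<delta> = x - y + x y \<ge> 0.
  The differences telescope, and x y \<le> x^2 is summable because c > 1/2. Starting at u \<ge> 2
  gives x \<le> 4^(-1/2) = 1/2, hence \<delta> \<le> 1/2 and 1 - \<delta> \<ge> exp (-2
  \<delta>).\<close>

lemma alternating_block_bounds:
  assumes c: "1/2 < c" "c \<le> \<sigma>" and u: "2 \<le> u" "u \<le> w"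
  shows "alt_const c \<le> (\<Prod>i=2*u..<2*w. 1 - (-1) ^ i * prime_powr i \<sigma>)"
    and "(\<Prod>i=2*u..<2*w. 1 - (-1) ^ i * prime_powr i \<sigma>) \<le> 1"
proof -
  let ?x = "\<lambda>j. prime_powr (2 * j) \<sigma>" and ?y = "\<lambda>j. prime_powr (2 * j + 1) \<sigma>"
  have eq: "(\<Prod>i=2*u..<2*w. 1 - (-1) ^ i * prime_powr i \<sigma>) = (\<Prod>j=u..<w. (1 - ?x j) * (1 + ?y j))"
    by (subst prod_even_odd_pairs[OF u(2)]) simp
  have yx: "?y j \<le> ?x j" for j using c by (intro prime_powr_antimono) auto
  have x1: "?x j < 1" for j using c by (intro prime_powr_less_1) auto
  have pair_le: "(1 - ?x j) * (1 + ?y j) \<le> 1" for j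
  proof -
    have "(1 - ?x j) * (1 + ?y j) = 1 - (?x j - ?y j) - ?x j * ?y j" by (simp add: algebra_simps)
    thus ?thesis using yx[of j] by (smt (verit) mult_nonneg_nonneg powr_ge_zero)
  qed
  show "(\<Prod>i=2*u..<2*w. 1 - (-1) ^ i * prime_powr i \<sigma>) \<le> 1"
    unfolding eq using pair_le x1 by (intro prod_le_1) (auto simp: less_imp_le intro!: mult_nonneg_nonneg add_nonneg_nonneg)
  have pair_ge: "(1 - ?x j) * (1 + ?y j) \<ge> exp (- 2 * (?x j - prime_powr (2 * (j + 1)) \<sigma> + (?x j)\<^sup>2))" if j: "j \<ge> u" for j
  proof -
    have "real (nth_prime (2 * j)) \<ge> 4" using nth_prime_ge(1)[of "2 * j"] j u by simp
    hence "?x j \<le> 4 powr (-\<sigma>)" using c by (intro powr_mono2') auto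
    also have "\<dots> \<le> 4 powr (-(1/2))" using c by (intro powr_mono) auto
    also have "\<dots> = 1/2"
    proof -
      have "(4::real) powr (1/2) = 2" using powr_half_sqrt[of 4] by simp
      thus ?thesis by (simp only: powr_minus_divide)
    qed
    finally have xh: "?x j \<le> 1/2" .
    define \<delta> where "\<delta> = ?x j - ?y j + ?x j * ?y j"
    have "?x j * ?y j \<le> 1 * ?y j" using x1[of j] by (intro mult_right_mono) auto
    hence "\<delta> \<le> 1/2" using xh by (simp add: \<delta>_def)
    moreover have "\<delta> \<ge> 0" using yx[of j] by (simp add: \<delta>_def)
    ultimately have "exp (- 2 * \<delta>) \<le> 1 - \<delta>" by (intro one_minus_ge_exp)
    moreover have "?x j * ?y j \<le> (?x j)\<^sup>2" unfolding power2_eq_square using yx[of j] by (intro mult_left_mono) auto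
    moreover have "prime_powr (2 * (j + 1)) \<sigma> \<le> ?y j" using c by (intro prime_powr_antimono) auto
    ultimately have "exp (- 2 * (?x j - prime_powr (2 * (j + 1)) \<sigma> + (?x j)\<^sup>2)) \<le> 1 - \<delta>"
      by (smt (verit) exp_le_cancel_iff \<delta>_def)
    also have "1 - \<delta> = (1 - ?x j) * (1 + ?y j)" by (simp add: \<delta>_def algebra_simps)
    finally show ?thesis .
  qed
  have tele: "(\<Sum>j=u..<w. ?x j - prime_powr (2 * (j + 1)) \<sigma>) \<le> 1"
  proof -
    have "(\<Sum>j=u..<w. ?x j - ?x (Suc j)) = ?x u - ?x w"
      using u(2) by (induction w rule: dec_induct) auto
    moreover have "?x u - ?x w \<le> 1" using x1[of u] prime_powr_pos[of "2 * w" \<sigma>] by linarith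
    ultimately show ?thesis by simp
  qed
  have sq: "(\<Sum>j=u..<w. (?x j)\<^sup>2) \<le> (\<Sum>j. real j powr (-2 * c))"
  proof -
    have "(\<Sum>j=u..<w. (?x j)\<^sup>2) \<le> (\<Sum>j=u..<w. real j powr (-2 * c))"
      using c u by (intro sum_mono prime_powr_even_sq_le) auto
    also have "\<dots> \<le> (\<Sum>j. real j powr (-2 * c))"
      using c by (intro sum_le_suminf summable_powr_neg) auto
    finally show ?thesis .
  qed
  have "alt_const c \<le> exp (\<Sum>j=u..<w. - 2 * (?x j - prime_powr (2 * (j + 1)) \<sigma> + (?x j)\<^sup>2))"
    unfolding alt_const_def exp_le_cancel_iff sum_distrib_left [symmetric] sum.distrib
    using tele sq by simp
  also have "\<dots> = (\<Prod>j=u..<w. exp (- 2 * (?x j - prime_powr (2 * (j + 1)) \<sigma> + (?x j)\<^sup>2)))"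
    by (rule exp_sum) simp
  also have "\<dots> \<le> (\<Prod>j=u..<w. (1 - ?x j) * (1 + ?y j))"
    by (intro prod_mono conjI pair_ge) auto
  finally show "alt_const c \<le> (\<Prod>i=2*u..<2*w. 1 - (-1) ^ i * prime_powr i \<sigma>)" unfolding eq .
qed

text \<open>The cut at an even position keeps alternating signs in complete pairs.\<close>

definition sign_prod :: "(nat \<Rightarrow> real) \<Rightarrow> real \<Rightarrow> nat \<Rightarrow> real" where
  "sign_prod sg \<sigma> J = (\<Prod>i=0..<2*J. 1 - sg i * prime_powr i \<sigma>)"

text \<open>
  Large primes weigh relatively more at \<open>\<alpha>\<close> than at \<open>\<beta>\<close>. A block of signs \<open>-1\<close> makes the product
  large at \<open>\<beta>\<close>, and a much later block of signs \<open>+1\<close> makes it small at \<open>\<alpha>\<close> while hardly changing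
  it at \<open>\<beta>\<close>; alternating signs in between and afterwards are harmless.
\<close>

lemma exists_sign_blocks:
  assumes ab: "1/2 < \<alpha>" "\<alpha> < \<beta>" "\<beta> < 1" and B: "B > 0" and a: "2 \<le> a"
  obtains sg D where "\<And>i. \<bar>sg i\<bar> = 1" "\<And>i. i < 2 * a \<Longrightarrow> sg i = 1" "\<And>i. i \<ge> 2 * D \<Longrightarrow> sg i = (-1) ^ i"
    "\<And>J. J \<ge> D \<Longrightarrow> sign_prod sg \<beta> J \<ge> 3" "\<And>J. J \<ge> D \<Longrightarrow> B * sign_prod sg \<alpha> J \<le> 1/2"
proof -
  define k where "k = alt_const \<alpha>"
  have k: "k > 0" by (simp add: k_def alt_const_def)
  define A1 where "A1 = (\<Prod>i=0..<2*a. 1 - prime_powr i \<beta>)"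
  have A1: "A1 > 0" unfolding A1_def using ab by (intro prod_pos) (simp add: prime_powr_less_1)
  \<comment> \<open>At \<beta> the other four factors will be equal to A1 and at least k, 1/2 and k,
    so a block of signs -1 contributing 6 / (A1 k k) makes the whole product at least 3. The sum of
    the p^(-\<beta>) is a lower bound for the product of the 1 + p^(-\<beta>).\<close>
  obtain b where b: "2 * a \<le> b" "(\<Sum>i=2*a..<b. prime_powr i \<beta>) \<ge> 6 / (A1 * k * k)"
    using sum_primes_powr_unbounded[of \<beta> "2 * a" "6 / (A1 * k * k)"] ab by auto
  have b2: "(\<Sum>i=2*a..<2*b. prime_powr i \<beta>) \<ge> 6 / (A1 * k * k)"
    using b by (intro order.trans[OF b(2)] sum_mono2) auto
  define A2 where "A2 = (\<Prod>i=0..<2*a. 1 - prime_powr i \<alpha>) * (\<Prod>i=2*a..<2*b. 1 + prime_powr i \<alpha>)"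
  have A2: "A2 > 0" unfolding A2_def using ab
    by (intro mult_pos_pos prod_pos) (auto simp: prime_powr_less_1 intro!: add_pos_nonneg)
  \<comment> \<open>The block of signs +1 will contribute at most exp (-L) at \<alpha>, which brings
    B times the whole product to at most 1/2.\<close>
  define L where "L = max 0 (ln (2 * B * A2))"
  have L: "L \<ge> 0" "exp (-L) * (2 * B * A2) \<le> 1"
  proof -
    have "2 * B * A2 = exp (ln (2 * B * A2))" using B A2 by simp
    also have "\<dots> \<le> exp L" by (simp add: L_def)
    finally show "exp (-L) * (2 * B * A2) \<le> 1" by (simp add: exp_minus field_simps)
  qed (simp add: L_def)
  \<comment> \<open>From position 2c on, a term at \<beta> is at most c^(\<alpha> - \<beta>) times
    the term at \<alpha>. A block with sum at most L + 2 at \<alpha> then has sum at most 1/2 at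
    \<beta>.\<close>
  have "((\<lambda>n. real n powr (-(\<beta> - \<alpha>)) * (L + 2)) \<longlongrightarrow> 0) sequentially"
    using ab by real_asymp
  hence "\<forall>\<^sub>F n in sequentially. real n powr (-(\<beta> - \<alpha>)) * (L + 2) < 1/2 \<and> n \<ge> b \<and> n \<ge> 1"
    using eventually_ge_at_top[of b] eventually_ge_at_top[of 1]
    by (auto intro!: eventually_conj dest!: order_tendstoD(2)[of _ 0 _ "1/2"])
  then obtain c where c: "real c powr (-(\<beta> - \<alpha>)) * (L + 2) < 1/2" "c \<ge> b" "c \<ge> 1"
    using eventually_happens'[OF sequentially_bot] by blast
  have ex: "\<exists>d\<ge>c. (\<Sum>i=2*c..<2*d. prime_powr i \<alpha>) \<ge> L"
  proof -
    obtain d where d: "2 * c \<le> d" "(\<Sum>i=2*c..<d. prime_powr i \<alpha>) \<ge> L"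
      using sum_primes_powr_unbounded[of \<alpha> "2 * c" L] ab by auto
    have "(\<Sum>i=2*c..<2*d. prime_powr i \<alpha>) \<ge> L" using d by (intro order.trans[OF d(2)] sum_mono2) auto
    thus ?thesis using d by (intro exI[of _ d]) auto
  qed
  \<comment> \<open>Taking the least end point keeps the overshoot beyond L below two terms, each
    less than 1.\<close>
  define d where "d = (LEAST d. d \<ge> c \<and> (\<Sum>i=2*c..<2*d. prime_powr i \<alpha>) \<ge> L)"
  have d: "d \<ge> c" "(\<Sum>i=2*c..<2*d. prime_powr i \<alpha>) \<ge> L"
    using LeastI_ex[of "\<lambda>d. d \<ge> c \<and> (\<Sum>i=2*c..<2*d. prime_powr i \<alpha>) \<ge> L"] ex by (auto simp: d_def)
  have d_le: "(\<Sum>i=2*c..<2*d. prime_powr i \<alpha>) \<le> L + 2"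
  proof (cases "d = c")
    case False
    then obtain d' where d': "d = Suc d'" "d' \<ge> c" using d by (cases d) auto
    have "(\<Sum>i=2*c..<2*d'. prime_powr i \<alpha>) < L"
      using not_less_Least[of d' "\<lambda>d. d \<ge> c \<and> (\<Sum>i=2*c..<2*d. prime_powr i \<alpha>) \<ge> L"] d' by (auto simp: d_def)
    moreover have "(\<Sum>i=2*c..<2*d. prime_powr i \<alpha>) = (\<Sum>i=2*c..<2*d'. prime_powr i \<alpha>) + prime_powr (2*d') \<alpha> + prime_powr (Suc (2*d')) \<alpha>"
      using d' by (simp add: sum.atLeastLessThan_Suc)
    ultimately show ?thesis
      using prime_powr_less_1[of \<alpha> "2*d'"] prime_powr_less_1[of \<alpha> "Suc (2*d')"] ab by simp
  qed (use L in simp)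
  have d_le2: "(\<Sum>i=2*c..<2*d. prime_powr i \<beta>) \<le> 1/2"
  proof -
    have "(\<Sum>i=2*c..<2*d. prime_powr i \<beta>) \<le> (\<Sum>i=2*c..<2*d. real c powr (-(\<beta> - \<alpha>)) * prime_powr i \<alpha>)"
    proof (rule sum_mono)
      fix i assume "i \<in> {2*c..<2*d}"
      hence "real (nth_prime i) \<ge> real c" using nth_prime_ge(1)[of i] by simp
      hence "prime_powr i (\<beta> - \<alpha>) \<le> real c powr (-(\<beta> - \<alpha>))" using c ab by (intro powr_mono2') auto
      moreover have "prime_powr i \<beta> = prime_powr i (\<beta> - \<alpha>) * prime_powr i \<alpha>"
        by (subst powr_add [symmetric]) simp
      ultimately show "prime_powr i \<beta> \<le> real c powr (-(\<beta> - \<alpha>)) * prime_powr i \<alpha>"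
        by (simp add: mult_right_mono)
    qed
    also have "\<dots> = real c powr (-(\<beta> - \<alpha>)) * (\<Sum>i=2*c..<2*d. prime_powr i \<alpha>)" by (simp add: sum_distrib_left)
    also have "\<dots> \<le> real c powr (-(\<beta> - \<alpha>)) * (L + 2)" using d_le by (intro mult_left_mono) auto
    finally show ?thesis using c by simp
  qed
  define sg :: "nat \<Rightarrow> real" where "sg = (\<lambda>i. if i < 2*a then 1 else if i < 2*b then -1 else if i < 2*c then (-1)^i else if i < 2*d then 1 else (-1)^i)"
  have ord: "2 * a \<le> 2 * b" "2 * b \<le> 2 * c" "2 * c \<le> 2 * d" using b c d by auto
  have split: "sign_prod sg \<sigma> J = (\<Prod>i=0..<2*a. 1 - prime_powr i \<sigma>) * (\<Prod>i=2*a..<2*b. 1 + prime_powr i \<sigma>) *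
     (\<Prod>i=2*b..<2*c. 1 - (-1)^i * prime_powr i \<sigma>) * (\<Prod>i=2*c..<2*d. 1 - prime_powr i \<sigma>) *
     (\<Prod>i=2*d..<2*J. 1 - (-1)^i * prime_powr i \<sigma>)" if J: "J \<ge> d" for \<sigma> J
  proof -
    let ?f = "\<lambda>i. 1 - sg i * prime_powr i \<sigma>"
    have "sign_prod sg \<sigma> J = prod ?f {0..<2*a} * prod ?f {2*a..<2*b} * prod ?f {2*b..<2*c} * prod ?f {2*c..<2*d} * prod ?f {2*d..<2*J}"
      unfolding sign_prod_def using ord J by (simp add: prod.atLeastLessThan_concat)
    also have "prod ?f {0..<2*a} = (\<Prod>i=0..<2*a. 1 - prime_powr i \<sigma>)" by (rule prod.cong) (auto simp: sg_def)
    also have "prod ?f {2*a..<2*b} = (\<Prod>i=2*a..<2*b. 1 + prime_powr i \<sigma>)" by (rule prod.cong) (auto simp: sg_def)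
    also have "prod ?f {2*b..<2*c} = (\<Prod>i=2*b..<2*c. 1 - (-1)^i * prime_powr i \<sigma>)" by (rule prod.cong) (use ord in \<open>auto simp: sg_def\<close>)
    also have "prod ?f {2*c..<2*d} = (\<Prod>i=2*c..<2*d. 1 - prime_powr i \<sigma>)" by (rule prod.cong) (use ord in \<open>auto simp: sg_def\<close>)
    also have "prod ?f {2*d..<2*J} = (\<Prod>i=2*d..<2*J. 1 - (-1)^i * prime_powr i \<sigma>)" by (rule prod.cong) (use ord in \<open>auto simp: sg_def\<close>)
    finally show ?thesis .
  qed
  show ?thesis
  proof (rule that[of sg d])
    show "\<bar>sg i\<bar> = 1" for i by (simp add: sg_def)
    show "sg i = 1" if "i < 2 * a" for i using that by (simp add: sg_def)
    show "sg i = (-1) ^ i" if "i \<ge> 2 * d" for i using that ord by (simp add: sg_def)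
  next
    fix J assume J: "J \<ge> d"
    have alt1: "k \<le> (\<Prod>i=2*b..<2*c. 1 - (-1)^i * prime_powr i \<beta>)"
      unfolding k_def using ab a ord by (intro alternating_block_bounds) auto
    have alt2: "k \<le> (\<Prod>i=2*d..<2*J. 1 - (-1)^i * prime_powr i \<beta>)"
      unfolding k_def using ab a ord J by (intro alternating_block_bounds) auto
    have "6 / (A1 * k * k) \<le> (\<Prod>i=2*a..<2*b. 1 + prime_powr i \<beta>)"
      using b2 sum_le_prod[of "{2*a..<2*b}" "\<lambda>i. prime_powr i \<beta>"] by simp
    moreover have "1/2 \<le> (\<Prod>i=2*c..<2*d. 1 - prime_powr i \<beta>)"
    proof -
      have "1 - (\<Sum>i=2*c..<2*d. prime_powr i \<beta>) \<le> (\<Prod>i=2*c..<2*d. 1 - prime_powr i \<beta>)"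
        by (intro Weierstrass_prod_ineq) (use prime_powr_less_1[of \<beta>] ab in \<open>auto intro: less_imp_le\<close>)
      thus ?thesis using d_le2 by linarith
    qed
    moreover have "0 \<le> (\<Prod>i=2*a..<2*b. 1 + prime_powr i \<beta>)"
      by (intro prod_nonneg) (simp add: add_nonneg_nonneg)
    ultimately have "A1 * (6 / (A1 * k * k)) * k * (1/2) * k \<le> sign_prod sg \<beta> J"
      unfolding split[OF J] A1_def[symmetric] using A1 k alt1 alt2
      by (intro mult_mono mult_nonneg_nonneg) (auto intro: order.trans[OF less_imp_le[OF k]])
    thus "sign_prod sg \<beta> J \<ge> 3" using A1 k by (simp add: field_simps)
  next
    fix J assume J: "J \<ge> d"
    have pos: "1 - (-1)^i * prime_powr i \<alpha> \<ge> 0" for i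
      using prime_powr_less_1[of \<alpha> i] prime_powr_pos[of i \<alpha>] ab by (cases "even i") auto
    have alt1: "(\<Prod>i=2*b..<2*c. 1 - (-1)^i * prime_powr i \<alpha>) \<le> 1"
      using ab a ord by (intro alternating_block_bounds(2)[of \<alpha>]) auto
    have alt2: "(\<Prod>i=2*d..<2*J. 1 - (-1)^i * prime_powr i \<alpha>) \<le> 1"
      using ab a ord J by (intro alternating_block_bounds(2)[of \<alpha>]) auto
    have plus: "(\<Prod>i=2*c..<2*d. 1 - prime_powr i \<alpha>) \<le> exp (-L)"
    proof -
      have "(\<Prod>i=2*c..<2*d. 1 - prime_powr i \<alpha>) \<le> (\<Prod>i=2*c..<2*d. exp (- prime_powr i \<alpha>))"
      proof (intro prod_mono conjI)
        fix i show "0 \<le> 1 - prime_powr i \<alpha>" using prime_powr_less_1[of \<alpha> i] ab by simp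
        show "1 - prime_powr i \<alpha> \<le> exp (- prime_powr i \<alpha>)" using exp_ge_add_one_self[of "- prime_powr i \<alpha>"] by simp
      qed
      also have "\<dots> = exp (- (\<Sum>i=2*c..<2*d. prime_powr i \<alpha>))" by (simp add: exp_sum sum_negf [symmetric])
      also have "\<dots> \<le> exp (-L)" using d(2) by simp
      finally show ?thesis .
    qed
    have pos2: "0 \<le> (\<Prod>i=2*c..<2*d. 1 - prime_powr i \<alpha>)"
      using ab by (intro prod_nonneg) (simp add: less_imp_le prime_powr_less_1)
    have "sign_prod sg \<alpha> J \<le> A2 * 1 * exp (-L) * 1"
      unfolding split[OF J] A2_def[symmetric] using A2 alt1 alt2 plus pos2
      by (intro mult_mono mult_nonneg_nonneg prod_nonneg pos)
         (use ab in \<open>auto intro!: less_imp_le[OF prime_powr_less_1]\<close>)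
    hence "B * sign_prod sg \<alpha> J \<le> B * (A2 * exp (-L))" using B by (intro mult_left_mono) auto
    also have "\<dots> = (exp (-L) * (2 * B * A2)) / 2" by simp
    also have "\<dots> \<le> 1/2" using L(2) by simp
    finally show "B * sign_prod sg \<alpha> J \<le> 1/2" .
  qed
qed

definition sign_prodc :: "(nat \<Rightarrow> real) \<Rightarrow> nat \<Rightarrow> complex \<Rightarrow> complex" where
  "sign_prodc sg J w = (\<Prod>i=0..<2*J. 1 - of_real (sg i) * of_nat (nth_prime i) powr (-w))"

text \<open>The derivative of x^(-w) is dominated by that of -(B/c) x^(-c); in this form the bound
  telescopes along the primes.\<close>

lemma norm_powr_diff_le:
  assumes x: "1 \<le> x" "x < y" and w: "Re w \<ge> c" "norm w \<le> B" and c: "c > 0"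
  shows "norm (of_real y powr (-w) - of_real x powr (-w)) \<le> B / c * (x powr (-c) - y powr (-c))"
proof -
  have "norm (fdiff 0 w y - fdiff 0 w x) \<le> (- (B / c) * y powr (-c)) - (- (B / c) * x powr (-c))"
  proof (rule differentiable_bound_general[OF x(2)])
    show "continuous_on {x..y} (fdiff 0 w)"
    proof (rule continuous_on_vector_derivative)
      fix z assume "z \<in> {x..y}"
      thus "(fdiff 0 w has_vector_derivative (- w * fdiff 0 (w + 1) z)) (at z within {x..y})"
        using x by (intro has_vector_derivative_at_within[OF has_vector_derivative_fdiff]) auto
    qed
    show "continuous_on {x..y} (\<lambda>z. - (B / c) * z powr (-c))"
      using x by (intro continuous_intros) auto
    fix z assume z: "x < z" "z < y"
    show "(fdiff 0 w has_vector_derivative (- w * fdiff 0 (w + 1) z)) (at z)"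
      using x z by (intro has_vector_derivative_fdiff) auto
    have "((\<lambda>z. - (B / c) * z powr (-c)) has_real_derivative - (B / c) * (- c * z powr (-c - 1))) (at z)"
      using x z by (intro DERIV_cmult has_real_derivative_powr) auto
    hence "((\<lambda>z. - (B / c) * z powr (-c)) has_real_derivative B * z powr (-c - 1)) (at z)"
      using c by simp
    thus "((\<lambda>z. - (B / c) * z powr (-c)) has_vector_derivative B * z powr (-c - 1)) (at z)"
      by (simp add: has_real_derivative_iff_has_vector_derivative)
    have "norm (- w * fdiff 0 (w + 1) z) = norm w * z powr (- Re w - 1)"
      using x z by (simp add: norm_mult norm_powr_real_powr)
    also have "\<dots> \<le> B * z powr (-c - 1)"
      using x z w order.trans[OF norm_ge_zero w(2)] by (intro mult_mono powr_mono) auto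
    finally show "norm (- w * fdiff 0 (w + 1) z) \<le> B * z powr (-c - 1)" .
  qed
  thus ?thesis by (simp add: algebra_simps)
qed

text \<open>The product need not converge absolutely. Grouped in pairs, a late factor differs from 1
  by (y - x) - x y, where the first part is dominated by a telescoping series and the second by
  j^(-2c), so the product of the pairs converges absolutely and uniformly.\<close>

lemma uniformly_convergent_sign_prodc:
  assumes sg: "\<And>i. i \<ge> 2 * D \<Longrightarrow> sg i = (-1) ^ i" and A: "compact A" and c: "c > 1/2" "\<And>w. w \<in> A \<Longrightarrow> Re w \<ge> c"
  shows "uniformly_convergent_on A (sign_prodc sg)"
proof -
  define g where "g = (\<lambda>j w. (1 - of_real (sg (2*j)) * of_nat (nth_prime (2*j)) powr (-w)) *
      (1 - of_real (sg (2*j+1)) * of_nat (nth_prime (2*j+1)) powr (-w) :: complex))"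
  have eq: "sign_prodc sg J w = (\<Prod>j<J. g j w)" for J w
    unfolding sign_prodc_def g_def using prod_even_odd_pairs[of 0 J "\<lambda>i. 1 - of_real (sg i) * of_nat (nth_prime i) powr (-w)"]
    by (simp add: lessThan_atLeast0)
  obtain B where B: "\<And>w. w \<in> A \<Longrightarrow> norm w \<le> B" using compact_imp_bounded[OF A] unfolding bounded_iff by blast
  define M where "M = (\<lambda>j. B / c * (prime_powr (2*j) c - prime_powr (2 * Suc j) c) + real j powr (-2 * c))"
  have "(\<lambda>j. prime_powr (2*j) c) \<longlonglongrightarrow> 0"
  proof (rule tendsto_sandwich[OF _ _ tendsto_const])
    show "\<forall>\<^sub>F j in sequentially. prime_powr (2*j) c \<le> real j powr (-c)"
      using eventually_gt_at_top[of 0]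
    proof eventually_elim
      case (elim j)
      thus ?case using nth_prime_ge(1)[of "2*j"] c by (intro powr_mono2') auto
    qed
    show "(\<lambda>j. real j powr (-c)) \<longlonglongrightarrow> 0" using c by real_asymp
  qed auto
  hence "summable M" unfolding M_def
    using c by (intro summable_add summable_mult telescope_summable' summable_powr_neg) auto
  moreover have "\<forall>\<^sub>F j in sequentially. \<forall>w\<in>A. norm (norm (g j w - 1)) \<le> M j"
    using eventually_ge_at_top[of D] eventually_ge_at_top[of 1]
  proof eventually_elim
    case (elim j)
    show ?case
    proof
      fix w assume w: "w \<in> A"
      define x where "x = (of_nat (nth_prime (2*j)) :: complex) powr (-w)"
      define y where "y = (of_nat (nth_prime (2*j+1)) :: complex) powr (-w)"
      have B0: "B \<ge> 0" using B[OF w] norm_ge_zero[of w] by linarith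
      have "sg (2*j) = 1" "sg (2*j+1) = -1" using sg[of "2*j"] sg[of "2*j+1"] elim by auto
      hence "g j w - 1 = (y - x) - x * y" by (simp add: g_def x_def y_def algebra_simps)
      hence "norm (g j w - 1) \<le> norm (y - x) + norm x * norm y"
        using norm_triangle_ineq4[of "y - x" "x * y"] by (simp add: norm_mult)
      also have "norm (y - x) \<le> B / c * (prime_powr (2*j) c - prime_powr (2*j+1) c)"
      proof -
        have "1 \<le> real (nth_prime (2*j))" using nth_prime_ge(2)[of "2*j"] by simp
        moreover have "real (nth_prime (2*j)) < real (nth_prime (2*j+1))"
          using nth_prime_less_iff[of "2*j" "2*j+1"] by simp
        ultimately show ?thesis
          using norm_powr_diff_le[of "real (nth_prime (2*j))" "real (nth_prime (2*j+1))" c w B] c(1) c(2)[OF w] B[OF w]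
          by (simp add: x_def y_def)
      qed
      also have "B / c * (prime_powr (2*j) c - prime_powr (2*j+1) c) \<le> B / c * (prime_powr (2*j) c - prime_powr (2 * Suc j) c)"
        using B0 c prime_powr_antimono[of c "2*j+1" "2 * Suc j"] by (intro mult_left_mono) auto
      also have "norm x * norm y \<le> real j powr (-2 * c)"
      proof -
        have "norm x * norm y = prime_powr (2*j) (Re w) * prime_powr (2*j+1) (Re w)"
          by (simp add: x_def y_def norm_powr_real_powr)
        also have "\<dots> \<le> (prime_powr (2*j) (Re w))\<^sup>2"
          unfolding power2_eq_square using c(1) c(2)[OF w] by (intro mult_left_mono prime_powr_antimono) auto
        also have "\<dots> \<le> real j powr (-2 * c)" using elim c(1) c(2)[OF w] by (intro prime_powr_even_sq_le) auto
        finally show ?thesis .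
      qed
      finally show "norm (norm (g j w - 1)) \<le> M j" by (simp add: M_def)
    qed
  qed
  ultimately have "uniform_limit A (\<lambda>n w. \<Sum>j<n. norm (g j w - 1)) (\<lambda>w. \<Sum>j. norm (g j w - 1)) sequentially"
    by (intro Weierstrass_m_test_ev)
  hence "uniformly_convergent_on A (\<lambda>N w. \<Sum>j<N. norm (g j w - 1))" by (rule uniformly_convergentI)
  moreover have "continuous_on A (g j)" for j
    unfolding g_def by (intro continuous_intros)
  ultimately have "uniformly_convergent_on A (\<lambda>N w. \<Prod>j<N. g j w)"
    using A by (intro uniformly_convergent_on_prod')
  thus ?thesis unfolding eq[abs_def] .
qed

lemma sign_prodc_of_real: "sign_prodc sg J (of_real \<sigma>) = of_real (sign_prod sg \<sigma> J)"
proof -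
  have "(of_nat n :: complex) powr (- of_real \<sigma>) = of_real (real n powr (-\<sigma>))" for n
    using powr_of_real[of "real n" "-\<sigma>"] by simp
  thus ?thesis by (simp add: sign_prodc_def sign_prod_def)
qed

section \<open>A real zero of the twisted function\<close>

context zeta_minus_series
begin

definition V_twist :: "(nat \<Rightarrow> real) \<Rightarrow> complex \<Rightarrow> complex" where
  "V_twist sg = dirichlet_sum (\<lambda>m. of_real (v m * sign_char sg m))"

lemma norm_twist: "(\<And>i. \<bar>sg i\<bar> = 1) \<Longrightarrow> norm (of_real (v m * sign_char sg m) :: complex) \<le> v m"
  using abs_sign_char[of sg m] v_nonneg[of m] unfolding norm_of_real by (simp add: abs_mult)

lemma V_twist_holomorphic: "(\<And>i. \<bar>sg i\<bar> = 1) \<Longrightarrow> V_twist sg holomorphic_on {s. Re s > 1/2}"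
  unfolding V_twist_def by (rule dirichlet_sum_holomorphic[OF summ_v norm_twist])

lemma norm_V_twist_le: "(\<And>i. \<bar>sg i\<bar> = 1) \<Longrightarrow> Re s \<ge> 1/2 \<Longrightarrow> norm (V_twist sg s) \<le> Vmax"
  unfolding V_twist_def Vmax_def by (rule norm_dirichlet_sum_le[OF summ_v norm_twist])

lemma V_twist_of_real:
  assumes sg: "\<And>i. \<bar>sg i\<bar> = 1" and \<sigma>: "\<sigma> \<ge> 1/2"
  shows "summable (\<lambda>m. v m * sign_char sg m * real m powr (-\<sigma>))"
    and "V_twist sg (of_real \<sigma>) = of_real (\<Sum>m. v m * sign_char sg m * real m powr (-\<sigma>))"
proof -
  have eq: "of_real (v m * sign_char sg m) * (of_nat m :: complex) powr (- of_real \<sigma>) =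
      of_real (v m * sign_char sg m * real m powr (-\<sigma>))" for m
    using powr_of_real[of "real m" "-\<sigma>"] by simp
  have "summable (\<lambda>m. of_real (v m * sign_char sg m) * (of_nat m :: complex) powr (- of_real \<sigma>))"
    by (rule summable_dirichlet[OF summ_v norm_twist]) (use sg \<sigma> in auto)
  thus s: "summable (\<lambda>m. v m * sign_char sg m * real m powr (-\<sigma>))"
    unfolding eq by (rule summable_of_real_iff[THEN iffD1])
  show "V_twist sg (of_real \<sigma>) = of_real (\<Sum>m. v m * sign_char sg m * real m powr (-\<sigma>))"
    unfolding V_twist_def dirichlet_sum_def eq by (rule suminf_of_real[OF s, symmetric])
qed

lemma v_tail:
  assumes "e > 0"
  shows "\<forall>\<^sub>F n in sequentially. (\<Sum>m. v (m + n) * real (m + n) powr (-(1/2))) < e"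
proof -
  obtain N where "\<forall>n\<ge>N. norm (\<Sum>i. v (i + n) * real (i + n) powr (-(1/2))) < e"
    using suminf_exist_split[OF assms summ_v] by blast
  hence "\<And>n. n \<ge> N \<Longrightarrow> (\<Sum>m. v (m + n) * real (m + n) powr (-(1/2))) < e" by (force simp: abs_less_iff)
  thus ?thesis unfolding eventually_sequentially by blast
qed

text \<open>For 1 \<le> m < a all prime factors of m are among the first 2a primes, so its sign is
  +1: these terms are nonnegative, and m = 1 contributes at least 1. The remaining terms total less
  than 1/4 in absolute value.\<close>

lemma V_twist_lower:
  assumes sg: "\<And>i. \<bar>sg i\<bar> = 1" and one: "\<And>i. i < 2 * a \<Longrightarrow> sg i = 1" and a: "a \<ge> 2" and \<sigma>: "\<sigma> \<ge> 1/2"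
    and tail: "(\<Sum>m. v (m + a) * real (m + a) powr (-(1/2))) < 1/4"
  shows "(\<Sum>m. v m * sign_char sg m * real m powr (-\<sigma>)) \<ge> 3/4"
proof -
  let ?f = "\<lambda>m. v m * sign_char sg m * real m powr (-\<sigma>)"
  have sf: "summable ?f" by (rule V_twist_of_real(1)[where sg = sg, OF sg \<sigma>])
  have split: "suminf ?f = (\<Sum>m. ?f (m + a)) + (\<Sum>m<a. ?f m)"
    using suminf_split_initial_segment[OF sf, of a] by simp
  have "(\<Sum>m\<in>{1}. ?f m) \<le> (\<Sum>m<a. ?f m)"
  proof (rule sum_mono2)
    fix m assume "m \<in> {..<a} - {1}"
    hence "sign_char sg m = 1" using one nth_prime_ge(1)[of "2 * a"] by (intro sign_char_eq_1[of "2 * a"]) auto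
    thus "?f m \<ge> 0" using v_nonneg[of m] by simp
  qed (use a in auto)
  hence 1: "(\<Sum>m<a. ?f m) \<ge> 1" using v1 by simp
  have sv: "summable (\<lambda>m. v (m + a) * real (m + a) powr (-(1/2)))"
    using summ_v by (subst summable_iff_shift)
  have "norm (\<Sum>m. ?f (m + a)) \<le> (\<Sum>m. v (m + a) * real (m + a) powr (-(1/2)))"
  proof (rule norm_suminf_le[OF _ sv])
    fix m
    have "norm (?f (m + a)) = v (m + a) * real (m + a) powr (-\<sigma>)"
      using abs_sign_char[where sg = sg and m = "m + a", OF sg] v_nonneg[of "m + a"] by (simp add: abs_mult)
    also have "\<dots> \<le> v (m + a) * real (m + a) powr (-(1/2))"
      using a \<sigma> v_nonneg[of "m + a"] by (intro mult_left_mono powr_mono) auto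
    finally show "norm (?f (m + a)) \<le> v (m + a) * real (m + a) powr (-(1/2))" .
  qed
  hence "(\<Sum>m. ?f (m + a)) \<ge> -1/4" using tail by (simp add: abs_le_iff)
  thus ?thesis using split 1 by linarith
qed

text \<open>
  The sign change of the real function \<open>1 - V_twist sg \<sigma> * sign_prod sg \<sigma> J\<close> between \<open>\<alpha>\<close> and \<open>\<beta>\<close>
  survives in the limit and gives a zero of the holomorphic limit function.
\<close>

lemma exists_twisted_zero:
  assumes ab: "1/2 < \<alpha>" "\<alpha> < \<beta>" "\<beta> < 1"
  obtains sg x r \<mu> B where "\<And>i. \<bar>sg i\<bar> = 1" "r > 0" "r < 1/2" "\<alpha> < x - 2 * r" "x + 2 * r < \<beta>" "\<mu> > 0" "B \<ge> 0"
    "\<forall>\<^sub>F J in sequentially. (\<forall>w\<in>cball (of_real x) r. norm (sign_prodc sg J w) \<le> B) \<and>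
        norm (1 - V_twist sg (of_real x) * sign_prodc sg J (of_real x)) \<le> \<mu> / 8 \<and>
        (\<forall>w\<in>sphere (of_real x) r. norm (1 - V_twist sg w * sign_prodc sg J w) \<ge> 7 / 8 * \<mu>)"
proof -
  have "\<forall>\<^sub>F n in sequentially. (\<Sum>m. v (m + n) * real (m + n) powr (-(1/2))) < 1/4 \<and> n \<ge> 2"
    by (intro eventually_conj v_tail eventually_ge_at_top) auto
  then obtain a where a: "(\<Sum>m. v (m + a) * real (m + a) powr (-(1/2))) < 1/4" "a \<ge> 2"
    using eventually_happens'[OF sequentially_bot] by blast
  have Vp: "Vmax + 1 > 0" using Vmax_nonneg by linarith
  obtain sg D where sg: "\<And>i. \<bar>sg i\<bar> = 1" "\<And>i. i < 2 * a \<Longrightarrow> sg i = 1" "\<And>i. i \<ge> 2 * D \<Longrightarrow> sg i = (-1) ^ i"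
    and big: "\<And>J. J \<ge> D \<Longrightarrow> sign_prod sg \<beta> J \<ge> 3" and small: "\<And>J. J \<ge> D \<Longrightarrow> (Vmax + 1) * sign_prod sg \<alpha> J \<le> 1/2"
    using exists_sign_blocks[OF ab Vp a(2)] by metis
  define S where "S = {s::complex. Re s > 1/2}"
  have S: "open S" "connected S"
    unfolding S_def by (rule open_halfspace_Re_gt) (rule convex_connected[OF convex_halfspace_Re_gt])
  define Mi where "Mi = (\<lambda>w. lim (\<lambda>J. sign_prodc sg J w))"
  have ul: "uniform_limit A (sign_prodc sg) Mi sequentially" if A: "compact A" "A \<subseteq> S" for A
  proof (cases "A = {}")
    case False
    have "\<exists>c>1/2. \<forall>w\<in>A. Re w \<ge> c"
    proof -
      obtain w0 where "w0 \<in> A" "\<And>w. w \<in> A \<Longrightarrow> Re w0 \<le> Re w"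
        using continuous_attains_inf[OF A(1) False, of Re] continuous_on_Re[OF continuous_on_id] by auto
      thus ?thesis using A(2) by (intro exI[of _ "Re w0"]) (auto simp: S_def)
    qed
    then obtain c where c: "c > 1/2" "\<And>w. w \<in> A \<Longrightarrow> Re w \<ge> c" by blast
    have "uniformly_convergent_on A (sign_prodc sg)"
      by (rule uniformly_convergent_sign_prodc[OF sg(3) A(1) c])
    thus ?thesis unfolding Mi_def by (simp add: uniformly_convergent_uniform_limit_iff)
  qed (auto simp: uniform_limit_iff)
  have ptw: "(\<lambda>J. sign_prodc sg J w) \<longlonglongrightarrow> Mi w" if "w \<in> S" for w
    using tendsto_uniform_limitI[OF ul[of "{w}"]] that by auto
  have holp: "sign_prodc sg J holomorphic_on A" for J A
    unfolding sign_prodc_def by (intro holomorphic_intros)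
  have holM: "Mi holomorphic_on S"
  proof (rule holomorphic_uniform_sequence[OF S(1) holp])
    fix w assume "w \<in> S"
    then obtain d where d: "d > 0" "cball w d \<subseteq> S" using S(1) open_contains_cball by blast
    thus "\<exists>d>0. cball w d \<subseteq> S \<and> uniform_limit (cball w d) (sign_prodc sg) Mi sequentially"
      using ul[OF compact_cball d(2)] by blast
  qed
  define \<Phi> where "\<Phi> = (\<lambda>w. 1 - V_twist sg w * Mi w)"
  have hol\<Phi>: "\<Phi> holomorphic_on S"
    unfolding \<Phi>_def S_def using V_twist_holomorphic[where sg = sg, OF sg(1)] holM unfolding S_def by (intro holomorphic_intros)
  define s where "s = (\<lambda>\<sigma>. \<Sum>m. v m * sign_char sg m * real m powr (-\<sigma>))"
  define m where "m = (\<lambda>\<sigma>. Re (Mi (of_real \<sigma>)))"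
  have Mreal: "Mi (of_real \<sigma>) = of_real (m \<sigma>)" and mlim: "(\<lambda>J. sign_prod sg \<sigma> J) \<longlonglongrightarrow> m \<sigma>" if "\<sigma> > 1/2" for \<sigma>
  proof -
    have lim: "(\<lambda>J. of_real (sign_prod sg \<sigma> J)) \<longlonglongrightarrow> Mi (of_real \<sigma>)"
      using ptw[of "of_real \<sigma>"] that by (simp add: S_def sign_prodc_of_real)
    show l: "(\<lambda>J. sign_prod sg \<sigma> J) \<longlonglongrightarrow> m \<sigma>"
      using tendsto_Re[OF lim] by (simp add: m_def)
    have "(\<lambda>J. of_real (sign_prod sg \<sigma> J) :: complex) \<longlonglongrightarrow> of_real (m \<sigma>)" by (intro tendsto_of_real l)
    from LIMSEQ_unique[OF lim this] show "Mi (of_real \<sigma>) = of_real (m \<sigma>)" .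
  qed
  have \<Phi>real: "\<Phi> (of_real \<sigma>) = of_real (1 - s \<sigma> * m \<sigma>)" if "\<sigma> > 1/2" for \<sigma>
    using V_twist_of_real(2)[where sg = sg and \<sigma> = \<sigma>, OF sg(1)] that Mreal[OF that] by (simp add: \<Phi>_def s_def)
  \<comment> \<open>The series is at least 3/4 and the prime product at least 3, so their product
    exceeds 1.\<close>
  have at_\<beta>: "1 - s \<beta> * m \<beta> \<le> 0"
  proof -
    have "m \<beta> \<ge> 3" using ab big by (intro tendsto_lowerbound[OF mlim]) (auto simp: eventually_sequentially)
    moreover have "s \<beta> \<ge> 3/4" unfolding s_def using ab by (intro V_twist_lower[where sg = sg, OF sg(1,2) a(2) _ a(1)]) auto
    ultimately have "3/4 * 3 \<le> s \<beta> * m \<beta>" by (intro mult_mono) auto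
    thus ?thesis by simp
  qed
  \<comment> \<open>Whatever its sign, the series is at most Vmax in modulus, and the prime product
    was made at most 1/(2 (Vmax + 1)).\<close>
  have at_\<alpha>: "1 - s \<alpha> * m \<alpha> \<ge> 1/2"
  proof -
    have "sign_prod sg \<alpha> J \<ge> 0" for J
      unfolding sign_prod_def
    proof (intro prod_nonneg)
      fix i
      have "sg i * prime_powr i \<alpha> \<le> 1 * prime_powr i \<alpha>" using sg(1)[of i] by (intro mult_right_mono) auto
      thus "0 \<le> 1 - sg i * prime_powr i \<alpha>" using prime_powr_less_1[of \<alpha> i] ab by simp
    qed
    hence m0: "m \<alpha> \<ge> 0" using ab by (intro tendsto_lowerbound[OF mlim]) auto
    have "(\<lambda>J. (Vmax + 1) * sign_prod sg \<alpha> J) \<longlonglongrightarrow> (Vmax + 1) * m \<alpha>" using ab by (intro tendsto_intros mlim) auto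
    hence "(Vmax + 1) * m \<alpha> \<le> 1/2"
      by (rule tendsto_upperbound) (use small in \<open>auto simp: eventually_sequentially\<close>)
    moreover have "\<bar>s \<alpha>\<bar> \<le> Vmax"
      using norm_V_twist_le[where sg = sg and s = "of_real \<alpha>", OF sg(1)] V_twist_of_real(2)[where sg = sg and \<sigma> = \<alpha>, OF sg(1)] ab by (simp add: s_def)
    hence "s \<alpha> * m \<alpha> \<le> (Vmax + 1) * m \<alpha>" using m0 by (intro mult_right_mono) auto
    ultimately show ?thesis by linarith
  qed
  have cont: "continuous_on {\<alpha>..\<beta>} (\<lambda>\<sigma>. Re (\<Phi> (of_real \<sigma>)))"
    by (intro continuous_intros continuous_on_compose2[OF holomorphic_on_imp_continuous_on[OF hol\<Phi>]])
       (use ab in \<open>auto simp: S_def\<close>)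
  \<comment> \<open>The target value of the intermediate value theorem is 0.\<close>
  have "\<exists>x\<ge>\<alpha>. x \<le> \<beta> \<and> Re (\<Phi> (of_real x)) = -1/16 * 0"
    by (rule IVT2'[OF _ _ _ cont]) (use at_\<alpha> at_\<beta> ab \<Phi>real in auto)
  then obtain x where x: "x \<ge> \<alpha>" "x \<le> \<beta>" "Re (\<Phi> (of_real x)) = 0" by auto
  have \<Phi>x: "\<Phi> (of_real x) = 0" using x \<Phi>real[of x] ab by (simp add: complex_eq_iff)
  have xa: "x > \<alpha>" using x \<Phi>real[of \<alpha>] at_\<alpha> ab by (cases "x = \<alpha>") auto
  have xb: "x < \<beta>"
  proof -
    have "1 - s \<beta> * m \<beta> < 0"
    proof -
      have "m \<beta> \<ge> 3" using ab big by (intro tendsto_lowerbound[OF mlim]) (auto simp: eventually_sequentially)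
      moreover have "s \<beta> \<ge> 3/4" unfolding s_def using ab by (intro V_twist_lower[where sg = sg, OF sg(1,2) a(2) _ a(1)]) auto
      ultimately have "3/4 * 3 \<le> s \<beta> * m \<beta>" by (intro mult_mono) auto
      thus ?thesis by simp
    qed
    thus ?thesis using x \<Phi>real[of \<beta>] ab by (cases "x = \<beta>") auto
  qed
  have xS: "of_real x \<in> S" using xa ab by (simp add: S_def)
  have \<alpha>S: "of_real \<alpha> \<in> S" using ab by (simp add: S_def)
  have \<Phi>\<alpha>: "\<Phi> (of_real \<alpha>) \<noteq> 0"
  proof
    assume "\<Phi> (of_real \<alpha>) = 0"
    hence "1 - s \<alpha> * m \<alpha> = 0" using \<Phi>real[of \<alpha>] ab by (simp only: of_real_eq_0_iff)
    thus False using at_\<alpha> by simp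
  qed
  obtain r0 where r0: "r0 > 0" "ball (of_real x) r0 \<subseteq> S" "\<And>z. z \<in> ball (of_real x) r0 - {of_real x} \<Longrightarrow> \<Phi> z \<noteq> 0"
    using isolated_zeros[OF hol\<Phi> S xS \<Phi>x \<alpha>S \<Phi>\<alpha>] by metis
  \<comment> \<open>Half of r0 keeps other zeros off the circle; a third of the distances to
    \<alpha> and \<beta> leaves room in the strip for the concentric circle of radius 2r; 1/4
    ensures r < 1/2, so that a zero found later is less than 1/2 away in height from its
    shift.\<close>
  define r where "r = min (min (r0 / 2) ((x - \<alpha>) / 3)) (min ((\<beta> - x) / 3) (1/4))"
  have r: "r > 0" "r \<le> r0 / 2" "r \<le> (x - \<alpha>) / 3" "r \<le> (\<beta> - x) / 3" "r \<le> 1/4"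
  proof -
    have "r0 / 2 > 0" "(x - \<alpha>) / 3 > 0" "(\<beta> - x) / 3 > 0" using r0(1) xa xb by auto
    thus "r > 0" unfolding r_def by linarith
    show "r \<le> r0 / 2" "r \<le> (x - \<alpha>) / 3" unfolding r_def by (simp_all only: min.coboundedI1 min.cobounded1 min.cobounded2)
    show "r \<le> (\<beta> - x) / 3" "r \<le> 1/4" unfolding r_def by (simp_all only: min.coboundedI2 min.cobounded1 min.cobounded2)
  qed
  have "cball (of_real x :: complex) r \<subseteq> ball (of_real x) r0"
    using r r0(1) by (simp add: cball_subset_ball_iff)
  hence cb: "cball (of_real x) r \<subseteq> S" using r0(2) by blast
  have "continuous_on (sphere (of_real x) r) (\<lambda>w. norm (\<Phi> w))"
    by (intro continuous_intros holomorphic_on_imp_continuous_on holomorphic_on_subset[OF hol\<Phi>])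
       (use cb sphere_cball in blast)
  moreover have "sphere (of_real x :: complex) r \<noteq> {}" using r by simp
  ultimately obtain w1 where w1: "w1 \<in> sphere (of_real x) r" "\<And>w. w \<in> sphere (of_real x) r \<Longrightarrow> norm (\<Phi> w1) \<le> norm (\<Phi> w)"
    using continuous_attains_inf[OF compact_sphere, of "of_real x :: complex" r "\<lambda>w. norm (\<Phi> w)"] by blast
  define \<mu> where "\<mu> = norm (\<Phi> w1)"
  have "w1 \<in> ball (of_real x) r0 - {of_real x}" using w1 r r0 by (auto simp: dist_commute)
  hence \<mu>: "\<mu> > 0" using r0(3) by (simp add: \<mu>_def)
  have ulc: "uniform_limit (cball (of_real x) r) (sign_prodc sg) Mi sequentially" by (rule ul[OF compact_cball cb])
  have "continuous_on (cball (of_real x) r) Mi"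
    by (rule holomorphic_on_imp_continuous_on[OF holomorphic_on_subset[OF holM cb]])
  hence "bounded (Mi ` cball (of_real x) r)" by (intro compact_imp_bounded compact_continuous_image compact_cball)
  then obtain B0 where B0: "\<And>w. w \<in> cball (of_real x) r \<Longrightarrow> norm (Mi w) \<le> B0" unfolding bounded_iff by blast
  \<comment> \<open>Passing from the limit to a finite product then costs at most Vmax \<epsilon>
    \<le> \<mu>/8, whence the constants 1/8 at the centre and 7/8 on the circle.\<close>
  define \<epsilon> where "\<epsilon> = min 1 (\<mu> / (8 * (Vmax + 1)))"
  have \<epsilon>: "\<epsilon> > 0" "\<epsilon> \<le> 1" "Vmax * \<epsilon> \<le> \<mu> / 8"
  proof -
    show "\<epsilon> > 0" using \<mu> Vp by (simp add: \<epsilon>_def)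
    have "Vmax * \<epsilon> \<le> (Vmax + 1) * (\<mu> / (8 * (Vmax + 1)))"
      using Vmax_nonneg \<open>\<epsilon> > 0\<close> by (intro mult_mono) (auto simp: \<epsilon>_def)
    also have "\<dots> = \<mu> / 8" using Vp by (simp add: field_simps)
    finally show "Vmax * \<epsilon> \<le> \<mu> / 8" .
  qed (simp add: \<epsilon>_def)
  have "\<forall>\<^sub>F J in sequentially. \<forall>w\<in>cball (of_real x) r. dist (sign_prodc sg J w) (Mi w) < \<epsilon>"
    using ulc \<epsilon>(1) unfolding uniform_limit_iff by blast
  hence ev: "\<forall>\<^sub>F J in sequentially. (\<forall>w\<in>cball (of_real x) r. norm (sign_prodc sg J w) \<le> max 0 (B0 + 1)) \<and>
        norm (1 - V_twist sg (of_real x) * sign_prodc sg J (of_real x)) \<le> \<mu> / 8 \<and>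
        (\<forall>w\<in>sphere (of_real x) r. norm (1 - V_twist sg w * sign_prodc sg J w) \<ge> 7 / 8 * \<mu>)"
  proof eventually_elim
    case (elim J)
    have d: "norm (sign_prodc sg J w - Mi w) \<le> \<epsilon>" if "w \<in> cball (of_real x) r" for w
      using elim that by (auto simp: dist_norm less_imp_le)
    have diff: "norm ((1 - V_twist sg w * sign_prodc sg J w) - \<Phi> w) \<le> \<mu> / 8" if w: "w \<in> cball (of_real x) r" for w
    proof -
      have "(1 - V_twist sg w * sign_prodc sg J w) - \<Phi> w = - (V_twist sg w * (sign_prodc sg J w - Mi w))"
        by (simp add: \<Phi>_def algebra_simps)
      hence "norm ((1 - V_twist sg w * sign_prodc sg J w) - \<Phi> w) = norm (V_twist sg w) * norm (sign_prodc sg J w - Mi w)"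
        by (simp add: norm_mult)
      also have "\<dots> \<le> Vmax * \<epsilon>"
      proof (intro mult_mono norm_V_twist_le[where sg = sg, OF sg(1)])
        have "w \<in> S" using w cb by blast
        thus "Re w \<ge> 1/2" by (simp add: S_def)
      qed (use d[OF w] Vmax_nonneg in auto)
      finally show ?thesis using \<epsilon>(3) by linarith
    qed
    have "norm (sign_prodc sg J w) \<le> max 0 (B0 + 1)" if "w \<in> cball (of_real x) r" for w
      using norm_triangle_ineq[of "sign_prodc sg J w - Mi w" "Mi w"] d[OF that] B0[OF that] \<epsilon>(2) by simp
    moreover have "norm (1 - V_twist sg (of_real x) * sign_prodc sg J (of_real x)) \<le> \<mu> / 8"
      using diff[of "of_real x"] \<Phi>x r by simp
    moreover have "norm (1 - V_twist sg w * sign_prodc sg J w) \<ge> 7 / 8 * \<mu>" if w: "w \<in> sphere (of_real x) r" for w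
    proof -
      have "norm (\<Phi> w) \<ge> \<mu>" using w1(2)[OF w] by (simp add: \<mu>_def)
      moreover have "norm ((1 - V_twist sg w * sign_prodc sg J w) - \<Phi> w) \<le> \<mu> / 8"
        using w by (intro diff) auto
      ultimately show ?thesis
        using norm_triangle_ineq2[of "\<Phi> w" "1 - V_twist sg w * sign_prodc sg J w"] by (simp add: norm_minus_commute)
    qed
    ultimately show ?case by blast
  qed
  show ?thesis
    by (rule that[OF sg(1) r(1) _ _ _ \<mu> _ ev]) (use r xa xb in auto)
qed

end

section \<open>The lower bound\<close>

lemma imag_poly_mean_square:
  assumes S: "finite S" "\<And>d. d \<in> S \<Longrightarrow> d \<ge> 1" and x: "\<And>d. d \<in> S \<Longrightarrow> norm (x d) = 1"
  shows "\<exists>K. \<forall>T\<ge>0. \<bar>integral {0..T} (\<lambda>t. (norm (imag_poly S x t))\<^sup>2) - T * real (card S)\<bar> \<le> K"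
proof (intro exI allI impI)
  have card: "(\<Sum>i\<in>S. (norm (x i))\<^sup>2) = real (card S)" using x by simp
  show "\<bar>integral {0..T} (\<lambda>t. (norm (imag_poly S x t))\<^sup>2) - T * real (card S)\<bar>
      \<le> (\<Sum>i\<in>S. \<Sum>j\<in>S-{i}. 2 * (norm (x i) * norm (x j)) / \<bar>ln (real i) - ln (real j)\<bar>)" if "T \<ge> 0" for T
    using mean_square_dirichlet_poly[OF S(1) inj_on_id S(2) that, of x] unfolding card imag_poly_def id_def by simp
qed

text \<open>
  Multiplying by \<open>x p * p powr (-i t) - 1\<close> cancels all terms except those with \<open>d\<close> on the boundary of
  \<open>S\<close>, a proportion \<open>2 / (N + 1)\<close>.
\<close>

lemma resonator_concentration:
  fixes x :: "nat \<Rightarrow> complex" and N p Q :: nat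
  assumes p: "prime p" and Q: "Q > 0" "p dvd Q" "\<not> p dvd (Q div p)" and x: "\<And>m. norm (x m) = 1"
    and mult: "\<And>m. m \<ge> 1 \<Longrightarrow> x (p * m) = x p * x m"
  defines "S \<equiv> {d. d dvd Q ^ N}"
  obtains K where "\<And>T. T \<ge> 0 \<Longrightarrow>
     integral {0..T} (\<lambda>t. (norm (imag_poly S x t * (x p * of_nat p powr (-(\<i> * of_real t)) - 1)))\<^sup>2)
       \<le> T * (2 * real (card S) / (real N + 1)) + K"
proof -
  have p2: "p \<ge> 2" using p prime_ge_2_nat by auto
  have finS: "finite S" unfolding S_def using Q(1) by (intro finite_divisors_nat) auto
  have S1: "d \<ge> 1" if "d \<in> S" for d
  proof -
    have "Q ^ N > 0" "d dvd Q ^ N" using that Q(1) by (simp_all add: S_def)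
    hence "d > 0" by (rule dvd_pos_nat)
    thus ?thesis by simp
  qed
  define S' where "S' = (\<lambda>d. p * d) ` S"
  have inj: "inj_on (\<lambda>d. p * d) S" using p2 by (auto simp: inj_on_def)
  have cardS': "card S' = card S" unfolding S'_def by (rule card_image[OF inj])
  have finS': "finite S'" using finS by (simp add: S'_def)
  \<comment> \<open>By multiplicativity the product is the sum over p S minus the sum over S; the
    common terms cancel and the symmetric difference remains.\<close>
  define I where "I = (S' - S) \<union> (S - S')"
  define y where "y = (\<lambda>d. if d \<in> S then - x d else x d)"
  have "imag_poly S x t * (x p * of_nat p powr (-(\<i> * of_real t)) - 1) = imag_poly I y t" for t
  proof -
    let ?e = "\<lambda>d. x d * of_nat d powr (-(\<i> * of_real t))"
    have "imag_poly S x t * (x p * of_nat p powr (-(\<i> * of_real t))) = (\<Sum>d\<in>S. ?e (p * d))"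
      unfolding imag_poly_def sum_distrib_right
    proof (rule sum.cong[OF refl])
      fix d assume d: "d \<in> S"
      show "x d * of_nat d powr (-(\<i> * of_real t)) * (x p * of_nat p powr (-(\<i> * of_real t))) = ?e (p * d)"
        unfolding mult[OF S1[OF d]] of_nat_mult_powr by (simp only: mult_ac)
    qed
    also have "\<dots> = (\<Sum>d\<in>S'. ?e d)" unfolding S'_def by (simp add: sum.reindex[OF inj])
    finally have "imag_poly S x t * (x p * of_nat p powr (-(\<i> * of_real t)) - 1) = (\<Sum>d\<in>S'. ?e d) - (\<Sum>d\<in>S. ?e d)"
      by (simp add: right_diff_distrib imag_poly_def)
    also have "(\<Sum>d\<in>S'. ?e d) = (\<Sum>d\<in>S' - S. ?e d) + (\<Sum>d\<in>S' \<inter> S. ?e d)"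
      using sum.Int_Diff[OF finS', of ?e S] by (simp add: add.commute)
    also have "(\<Sum>d\<in>S. ?e d) = (\<Sum>d\<in>S - S'. ?e d) + (\<Sum>d\<in>S' \<inter> S. ?e d)"
      using sum.Int_Diff[OF finS, of ?e S'] by (simp add: add.commute Int_commute)
    also have "(\<Sum>d\<in>S' - S. ?e d) + (\<Sum>d\<in>S' \<inter> S. ?e d) - ((\<Sum>d\<in>S - S'. ?e d) + (\<Sum>d\<in>S' \<inter> S. ?e d)) =
       (\<Sum>d\<in>S' - S. ?e d) + (\<Sum>d\<in>S - S'. - ?e d)" by (simp add: sum_negf)
    also have "\<dots> = (\<Sum>d\<in>S' - S. y d * of_nat d powr (-(\<i> * of_real t))) + (\<Sum>d\<in>S - S'. y d * of_nat d powr (-(\<i> * of_real t)))"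
      by (intro arg_cong2[where f = "(+)"] sum.cong refl) (auto simp: y_def)
    also have "\<dots> = imag_poly I y t" unfolding imag_poly_def I_def
      using finS finS' by (subst sum.union_disjoint) auto
    finally show ?thesis .
  qed
  note prod = this
  have cardI: "real (card I) \<le> 2 * real (card S) / (real N + 1)"
  proof -
    define S0 where "S0 = {d\<in>S. \<not> p dvd d}"
    have "S - S' \<subseteq> S0"
    proof
      fix d assume d: "d \<in> S - S'"
      have "\<not> p dvd d"
      proof
        assume "p dvd d"
        then obtain k where k: "d = p * k" by auto
        have "k dvd d" using k by simp
        hence "k \<in> S" using d unfolding S_def by (auto intro: dvd_trans)
        thus False using d k by (auto simp: S'_def)
      qed
      thus "d \<in> S0" using d by (simp add: S0_def)
    qed
    hence c1: "card (S - S') \<le> card S0" using finS by (intro card_mono) (auto simp: S0_def)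
    have "card (S' - S) = card (S - S')"
      using card_Diff_subset_Int[of S' S] card_Diff_subset_Int[of S S'] finS finS' cardS' by (simp add: Int_commute)
    hence "card I \<le> 2 * card S0"
      unfolding I_def using c1 card_Un_le[of "S' - S" "S - S'"] by linarith
    hence "real (card I) \<le> 2 * real (card S0)" by linarith
    \<comment> \<open>A divisor of Q^N prime to p may be multiplied by p^k for 0 \<le> k \<le> N,
      and the results are distinct divisors, so those prime to p form at most 1/(N + 1) of
      all.\<close>
    moreover have "card S0 * (N + 1) \<le> card S"
    proof -
      have "card (S0 \<times> {..N}) \<le> card S"
      proof (rule card_inj_on_le)
        show "inj_on (\<lambda>(d, k). d * p ^ k) (S0 \<times> {..N})"
        proof (rule inj_onI, clarify)
          fix d k d' k' assume d: "d \<in> S0" "d' \<in> S0" and eq: "d * p ^ k = d' * p ^ k'"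
          have nz: "d \<noteq> 0" "d' \<noteq> 0" using d S1 by (force simp: S0_def)+
          have m0: "multiplicity p d = 0" "multiplicity p d' = 0" using d by (auto simp: S0_def not_dvd_imp_multiplicity_0)
          have "multiplicity p (d * p ^ k) = k" "multiplicity p (d' * p ^ k') = k'"
            using p p2 nz m0 by (simp_all add: prime_elem_multiplicity_mult_distrib prime_elem_multiplicity_power_distrib)
          hence "k = k'" using eq by metis
          thus "d = d' \<and> k = k'" using eq p2 by simp
        qed
        show "(\<lambda>(d, k). d * p ^ k) ` (S0 \<times> {..N}) \<subseteq> S"
        proof clarify
          fix d k assume d: "d \<in> S0" and k: "k \<le> N"
          define Q' where "Q' = Q div p"
          have QQ: "Q = p * Q'" using Q(2) by (simp add: Q'_def)
          have "d dvd p ^ N * Q' ^ N" using d by (simp add: S0_def S_def QQ power_mult_distrib)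
          moreover have "coprime p d" using d by (intro prime_imp_coprime[OF p]) (simp add: S0_def)
          hence "coprime d (p ^ N)" by (simp add: coprime_commute)
          ultimately have "d dvd Q' ^ N" by (simp add: coprime_dvd_mult_right_iff)
          hence "d * p ^ k dvd Q' ^ N * p ^ N" using k by (intro mult_dvd_mono le_imp_power_dvd)
          moreover have "Q ^ N = Q' ^ N * p ^ N" unfolding QQ by (simp only: power_mult_distrib mult.commute)
          ultimately show "d * p ^ k \<in> S" by (simp only: S_def mem_Collect_eq)
        qed
      qed (rule finS)
      thus ?thesis by (simp add: card_cartesian_product)
    qed
    hence "real (card S0 * (N + 1)) \<le> real (card S)" by (simp only: of_nat_le_iff)
    hence "real (card S0) * (real N + 1) \<le> real (card S)" by (simp add: distrib_left)
    ultimately have "real (card I) * (real N + 1) \<le> 2 * real (card S)"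
      using mult_right_mono[of "real (card I)" "2 * real (card S0)" "real N + 1"] by linarith
    thus ?thesis by (simp add: pos_le_divide_eq)
  qed
  have S1': "d \<ge> 1" if "d \<in> S'" for d
  proof -
    obtain e where "e \<in> S" "d = p * e" using \<open>d \<in> S'\<close> by (auto simp: S'_def)
    thus ?thesis using S1[of e] p2 by simp
  qed
  have I: "finite I" using finS finS' by (simp add: I_def)
  have I1: "d \<ge> 1" if "d \<in> I" for d using that S1 S1' by (auto simp: I_def)
  have ny: "norm (y d) = 1" for d using x by (simp add: y_def)
  obtain K where K: "\<And>T. T \<ge> 0 \<Longrightarrow> \<bar>integral {0..T} (\<lambda>t. (norm (imag_poly I y t))\<^sup>2) - T * real (card I)\<bar> \<le> K"
    using imag_poly_mean_square[where x = y, OF I I1 ny] by blast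
  show ?thesis
  proof (rule that[of K])
    fix T :: real assume T: "T \<ge> 0"
    have "T * real (card I) \<le> T * (2 * real (card S) / (real N + 1))" using cardI T by (intro mult_left_mono)
    thus "integral {0..T} (\<lambda>t. (norm (imag_poly S x t * (x p * of_nat p powr (-(\<i> * of_real t)) - 1)))\<^sup>2)
       \<le> T * (2 * real (card S) / (real N + 1)) + K"
      unfolding prod using K[OF T] by linarith
  qed
qed

text \<open>Induction through a prime divisor, m = p k: the errors of factors of modulus at most 1
  add up, and k + 1 \<le> m is a crude substitute for counting prime factors. All primes dividing m
  are among the first n because m < \<open>nth_prime n\<close>.\<close>

lemma sign_char_approx:
  assumes sg: "\<And>i. \<bar>sg i\<bar> = 1" and \<delta>: "\<delta> \<ge> 0"
    and near: "\<And>i. i < n \<Longrightarrow> norm (of_real (sg i) * of_nat (nth_prime i) powr (-(\<i> * of_real t)) - 1 :: complex) \<le> \<delta>"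
    and m: "1 \<le> m" "m < nth_prime n"
  shows "norm (of_real (sign_char sg m) * of_nat m powr (-(\<i> * of_real t)) - 1 :: complex) \<le> real m * \<delta>"
  using m
proof (induction m rule: less_induct)
  case (less m)
  show ?case
  proof (cases "m = 1")
    case False
    then obtain p where p: "prime p" "p dvd m" using prime_factor_nat by blast
    obtain k where k: "m = p * k" using p(2) by (elim dvdE)
    obtain i where i: "nth_prime i = p" using nth_prime_surj[OF p(1)] by blast
    have k1: "k \<ge> 1" using less.prems k by (cases k) auto
    have p2: "p \<ge> 2" using p prime_ge_2_nat by auto
    have "k < m" using k k1 p2 by simp
    have "p \<le> m" using k k1 by simp
    hence "i < n" using less.prems i nth_prime_less_iff[of i n] by simp
    let ?e = "\<lambda>m. of_real (sign_char sg m) * of_nat m powr (-(\<i> * of_real t)) :: complex"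
    have mult: "?e m = ?e p * ?e k"
      using k1 p2 unfolding k by (subst sign_char_mult) (simp_all add: of_nat_mult_powr[unfolded of_nat_mult] mult_ac)
    have p1: "norm (?e p - 1) \<le> \<delta>" using near[OF \<open>i < n\<close>] i sign_char_nth_prime[of sg i] by simp
    have k2: "norm (?e k - 1) \<le> real k * \<delta>" using less.IH[OF \<open>k < m\<close>] k1 \<open>k < m\<close> less.prems by simp
    have "norm (?e p) \<le> 1"
      using abs_sign_char[where sg = sg, OF sg] norm_of_nat_powr_imag[of p t] by (simp add: norm_mult)
    hence "norm (?e p) * norm (?e k - 1) \<le> 1 * norm (?e k - 1)" by (intro mult_right_mono) auto
    moreover have eq: "?e m - 1 = ?e p * (?e k - 1) + (?e p - 1)" unfolding mult by (simp add: algebra_simps)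
    have "norm (?e m - 1) \<le> norm (?e p) * norm (?e k - 1) + norm (?e p - 1)"
      by (subst eq, subst norm_mult [symmetric]) (rule norm_triangle_ineq)
    ultimately have "norm (?e m - 1) \<le> real (k + 1) * \<delta>" using p1 k2 by (simp add: algebra_simps)
    also have "k + 1 \<le> m" using \<open>k < m\<close> by simp
    hence "real (k + 1) * \<delta> \<le> real m * \<delta>" using \<delta> by (intro mult_right_mono) auto
    finally show ?thesis .
  qed (use \<delta> in simp)
qed

text \<open>The window comes from t in [j, j + 1] and |x - t| < 1/2: a zero at height x can be
  produced only by such intervals.\<close>

lemma card_nat_near:
  assumes "x > 0"
  shows "card {j::nat. x - 3/2 < real j \<and> real j < x + 1/2} \<le> 3" "finite {j::nat. x - 3/2 < real j \<and> real j < x + 1/2}"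
proof -
  define k where "k = nat \<lfloor>x\<rfloor>"
  have k: "real k \<le> x" "x < real k + 1" using assms unfolding k_def by linarith+
  have sub: "{j::nat. x - 3/2 < real j \<and> real j < x + 1/2} \<subseteq> {k - 1, k, k + 1}"
  proof
    fix j :: nat assume "j \<in> {j::nat. x - 3/2 < real j \<and> real j < x + 1/2}"
    hence "real j < real k + 2" "real k < real j + 2" using k by auto
    hence "j < k + 2" "k < j + 2" by linarith+
    thus "j \<in> {k - 1, k, k + 1}" by auto
  qed
  show "finite {j::nat. x - 3/2 < real j \<and> real j < x + 1/2}" by (rule finite_subset[OF sub]) auto
  have "card {k - 1, k, k + 1} \<le> 3" by (simp add: card_insert_if)
  thus "card {j::nat. x - 3/2 < real j \<and> real j < x + 1/2} \<le> 3" using card_mono[OF _ sub] by simp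
qed

context zeta_minus_series
begin

text \<open>
  With \<open>M\<close> the product of the \<open>1 - p powr (-w)\<close> over \<open>p \<in> P\<close>, one has
  \<open>M * xi = (1 - 2 powr (1 - w)) * (1 - V * M) + rough_eta P\<close>. At \<open>w + i \<tau>\<close> the factor \<open>1 - V * M\<close> is
  close to its twisted counterpart at \<open>w\<close>, which is smaller at the centre than on the circle.
\<close>

lemma xi_zero_of_good_shift:
  fixes x r \<mu> B \<delta> \<rho> \<beta> \<tau> :: real and J :: nat
  defines "P \<equiv> nth_prime ` {0..<2*J}" and "X \<equiv> of_real x :: complex"
  assumes sg: "\<And>i. \<bar>sg i\<bar> = 1" and r: "r > 0" "1/2 < x - r" "x + r < \<beta>" and \<beta>: "\<beta> < 1" and \<mu>: "\<mu> > 0"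
    and B: "\<And>w. w \<in> cball X r \<Longrightarrow> norm (sign_prodc sg J w) \<le> B" "B \<ge> 0"
    and centre: "norm (1 - V_twist sg X * sign_prodc sg J X) \<le> \<mu> / 8"
    and sph: "\<And>w. w \<in> sphere X r \<Longrightarrow> norm (1 - V_twist sg w * sign_prodc sg J w) \<ge> 7 / 8 * \<mu>"
    and tail: "2 * (\<Sum>m. v (m + 2*J) * real (m + 2*J) powr (-(1/2))) * B \<le> \<mu> / 32"
    and \<delta>: "\<delta> \<ge> 0" "Vmax * (real (2*J) * \<delta>) * B \<le> \<mu> / 32" "Vmax * (4 ^ J * (real (2*J) * \<delta>)) \<le> \<mu> / 16"
    and near: "\<And>i. i < 2*J \<Longrightarrow> norm (of_real (sg i) * of_nat (nth_prime i) powr (-(\<i> * of_real \<tau>)) - 1 :: complex) \<le> \<delta>"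
    and \<rho>: "\<rho> \<le> \<mu> / 16 * (2 powr (1 - \<beta>) - 1)"
    and rough: "\<And>w. w \<in> cball X r \<Longrightarrow> norm (rough_eta P (w + \<i> * of_real \<tau>)) \<le> \<rho>"
  obtains z where "z \<in> ball (X + \<i> * of_real \<tau>) r" "xi z = 0"
proof -
  let ?i = "\<i> * of_real \<tau>"
  define MP where "MP = (\<lambda>s. \<Prod>p\<in>P. 1 - of_nat p powr (-s) :: complex)"
  define u where "u = (\<lambda>s. 1 - 2 * 2 powr (-s) :: complex)"
  \<comment> \<open>This is MP * xi / u at the shifted point, written so that the error term
    \<open>rough_eta\<close> stands apart from 1 - V * MP.\<close>
  define g where "g = (\<lambda>w. 1 - V (w + ?i) * MP (w + ?i) + rough_eta P (w + ?i) / u (w + ?i))"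
  have primes: "prime p" if "p \<in> P" for p using that prime_nth_prime by (auto simp: P_def)
  have ReB: "1/2 < Re w" "Re w < \<beta>" if "w \<in> cball X r" for w
  proof -
    have "\<bar>Re (w - X)\<bar> \<le> r" using that abs_Re_le_cmod[of "w - X"] by (simp add: dist_norm norm_minus_commute)
    thus "1/2 < Re w" "Re w < \<beta>" using r by (auto simp: X_def abs_le_iff)
  qed
  have ulow: "norm (u s) \<ge> 2 powr (1 - \<beta>) - 1" if "Re s \<le> \<beta>" for s
  proof -
    have "norm (2 * (2::complex) powr (-s)) = 2 * 2 powr (- Re s)"
      using norm_powr_real_powr[of 2 "-s"] by (simp add: norm_mult)
    also have "\<dots> = 2 powr (1 - Re s)" using powr_add[of 2 1 "- Re s"] by simp
    also have "\<dots> \<ge> 2 powr (1 - \<beta>)" using that by (intro powr_mono) auto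
    finally show ?thesis using norm_triangle_ineq3[of 1 "2 * (2::complex) powr (-s)"] by (simp add: u_def)
  qed
  have upos: "2 powr (1 - \<beta>) - 1 > 0"
    using \<beta> powr_less_mono[of 0 "1 - \<beta>" 2] by simp
  have inB: "w + ?i \<in> {s. Re s > 1/2}" if "w \<in> cball X r" for w using ReB[OF that] by simp
  have holg: "g holomorphic_on cball X r"
  proof -
    have sh: "(\<lambda>w. w + ?i) holomorphic_on cball X r" by (intro holomorphic_intros)
    have img: "(\<lambda>w. w + ?i) ` cball X r \<subseteq> {s. Re s > 1/2}" using inB by blast
    have 1: "(\<lambda>w. V (w + ?i)) holomorphic_on cball X r"
      using holomorphic_on_compose_gen[OF sh V_holomorphic img] by (simp only: o_def)
    have 2: "(\<lambda>w. rough_eta P (w + ?i)) holomorphic_on cball X r"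
      using holomorphic_on_compose_gen[OF sh rough_eta_holomorphic[OF primes, where A = UNIV] subset_UNIV] by (simp only: o_def)
    have 3: "u (w + ?i) \<noteq> 0" if "w \<in> cball X r" for w
      using ulow[of "w + ?i"] ReB[OF that] upos by auto
    show ?thesis unfolding g_def MP_def
      using 3 by (intro holomorphic_intros 1 2) (auto simp: u_def intro!: holomorphic_intros)
  qed
  have close: "norm (g w - (1 - V_twist sg w * sign_prodc sg J w)) \<le> \<mu> / 4" if w: "w \<in> cball X r" for w
  proof -
    have Rw: "Re w > 1/2" "Re w < \<beta>" using ReB[OF w] by auto
    have e: "of_nat m powr (-(w + ?i)) = of_nat m powr (-w) * (of_nat m :: complex) powr (-?i)" for m
      by (simp flip: powr_add)
    have M1: "norm (MP (w + ?i) - sign_prodc sg J w) \<le> 4 ^ J * (real (2*J) * \<delta>)"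
    proof -
      have inj: "inj_on nth_prime {0..<2*J}" by (rule inj_on_subset[OF inj_nth_prime]) auto
      let ?a = "\<lambda>i. 1 - of_nat (nth_prime i) powr (-(w + ?i)) :: complex"
      let ?b = "\<lambda>i. 1 - of_real (sg i) * of_nat (nth_prime i) powr (-w) :: complex"
      have np: "norm ((of_nat (nth_prime i) :: complex) powr (-w)) \<le> 1" for i
      proof -
        have "norm ((of_nat (nth_prime i) :: complex) powr (-w)) = prime_powr i (Re w)" by (simp add: norm_powr_real_powr)
        also have "\<dots> \<le> 1" using prime_powr_less_1[of "Re w" i] Rw by simp
        finally show ?thesis .
      qed
      have na: "norm (?a i / 2) \<le> 1" for i
      proof -
        have "norm ((of_nat (nth_prime i) :: complex) powr (-(w + ?i))) \<le> 1 * 1"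
          unfolding e norm_mult by (intro mult_mono np norm_of_nat_powr_imag) auto
        thus ?thesis using norm_triangle_ineq4[of 1 "(of_nat (nth_prime i) :: complex) powr (-(w + ?i))"] by (simp add: norm_divide)
      qed
      have nb: "norm (?b i / 2) \<le> 1" for i
        using norm_triangle_ineq4[of 1 "of_real (sg i) * (of_nat (nth_prime i) :: complex) powr (-w)"] np[of i] sg[of i]
        by (simp add: norm_divide norm_mult)
      have diff: "norm (?a i / 2 - ?b i / 2) \<le> \<delta>" if i: "i < 2*J" for i
      proof -
        have ss: "of_real (sg i) * of_real (sg i) = (1::complex)"
          using sg[of i] by (simp add: abs_if split: if_splits flip: of_real_mult)
        have "?a i - ?b i = - (of_nat (nth_prime i) powr (-w) * (of_real (sg i) * (of_real (sg i) * of_nat (nth_prime i) powr (-?i) - 1)))"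
          unfolding e right_diff_distrib mult.assoc[symmetric] ss by (simp add: algebra_simps)
        hence "norm (?a i - ?b i) = norm ((of_nat (nth_prime i) :: complex) powr (-w)) * norm (of_real (sg i) * (of_nat (nth_prime i) :: complex) powr (-?i) - 1)"
          using sg[of i] by (simp add: norm_mult)
        also have "\<dots> \<le> 1 * \<delta>" by (intro mult_mono np near i) auto
        finally have "norm (?a i - ?b i) \<le> \<delta>" by simp
        moreover have "?a i / 2 - ?b i / 2 = (?a i - ?b i) / 2" by (simp add: diff_divide_distrib)
        ultimately show ?thesis using \<delta>(1) by (simp only: norm_divide) simp
      qed
      \<comment> \<open>Halving gives every factor modulus at most 1, as the comparison of products
        factor by factor requires; undoing it costs 2^(2J) = 4^J.\<close>
      have "MP (w + ?i) = (\<Prod>i=0..<2*J. ?a i)" unfolding MP_def P_def by (simp add: prod.reindex[OF inj])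
      also have "\<dots> = 2 ^ (2*J) * (\<Prod>i=0..<2*J. ?a i / 2)" by (simp add: prod_dividef)
      finally have m1: "MP (w + ?i) = 2 ^ (2*J) * (\<Prod>i=0..<2*J. ?a i / 2)" .
      have m2: "sign_prodc sg J w = 2 ^ (2*J) * (\<Prod>i=0..<2*J. ?b i / 2)" by (simp add: prod_dividef sign_prodc_def)
      have "norm ((\<Prod>i=0..<2*J. ?a i / 2) - (\<Prod>i=0..<2*J. ?b i / 2)) \<le> (\<Sum>i=0..<2*J. norm (?a i / 2 - ?b i / 2))"
        by (rule norm_prod_diff) (use na nb in auto)
      also have "\<dots> \<le> (\<Sum>i=0..<2*J. \<delta>)" by (intro sum_mono diff) auto
      finally have "norm ((\<Prod>i=0..<2*J. ?a i / 2) - (\<Prod>i=0..<2*J. ?b i / 2)) \<le> real (2*J) * \<delta>" by simp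
      hence "2 ^ (2*J) * norm ((\<Prod>i=0..<2*J. ?a i / 2) - (\<Prod>i=0..<2*J. ?b i / 2)) \<le> 2 ^ (2*J) * (real (2*J) * \<delta>)"
        by (intro mult_left_mono) auto
      moreover have "norm (MP (w + ?i) - sign_prodc sg J w) = 2 ^ (2*J) * norm ((\<Prod>i=0..<2*J. ?a i / 2) - (\<Prod>i=0..<2*J. ?b i / 2))"
        unfolding m1 m2 right_diff_distrib[symmetric] norm_mult by (simp add: norm_power)
      ultimately show ?thesis by (simp add: power_mult)
    qed
    \<comment> \<open>Below 2J the coefficients are compared by \<open>sign_char_approx\<close>;
      from 2J on, the trivial bound 2 and the tail of the series are used.\<close>
    have V1: "norm (V (w + ?i) - V_twist sg w) \<le> Vmax * (real (2*J) * \<delta>) + 2 * (\<Sum>m. v (m + 2*J) * real (m + 2*J) powr (-(1/2)))"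
    proof -
      let ?t = "\<lambda>m. v m * real m powr (-(1/2))"
      let ?f = "\<lambda>m. of_real (v m) * of_nat m powr (-(w + ?i)) - of_real (v m * sign_char sg m) * (of_nat m :: complex) powr (-w)"
      have s1: "summable (\<lambda>m. of_real (v m) * (of_nat m :: complex) powr (-(w + ?i)))"
        by (rule summable_dirichlet[OF summ_v norm_v]) (use Rw in auto)
      have s2: "summable (\<lambda>m. of_real (v m * sign_char sg m) * (of_nat m :: complex) powr (-w))"
        by (rule summable_dirichlet[OF summ_v norm_twist[where sg = sg, OF sg]]) (use Rw in auto)
      have eq: "V (w + ?i) - V_twist sg w = suminf ?f"
        unfolding V_def V_twist_def dirichlet_sum_def by (rule suminf_diff[OF s1 s2])
      have b1: "norm (of_real (v m) * (of_nat m :: complex) powr (-w)) \<le> ?t m" for m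
        by (rule norm_dirichlet_term_le[where b = "\<lambda>m. of_real (v m)"]) (use norm_v Rw in auto)
      have fm: "norm (?f m) \<le> ?t m * norm (of_real (sign_char sg m) * (of_nat m :: complex) powr (-?i) - 1)" for m
      proof -
        have ss: "of_real (sign_char sg m) * of_real (sign_char sg m) = (1::complex)"
          using abs_sign_char[where sg = sg and m = m, OF sg] by (simp add: abs_if split: if_splits flip: of_real_mult)
        have "?f m = of_real (v m) * of_nat m powr (-w) * (of_real (sign_char sg m) * (of_real (sign_char sg m) * of_nat m powr (-?i) - 1))"
          unfolding e right_diff_distrib mult.assoc[symmetric]
          using ss by (simp add: algebra_simps)
        hence "norm (?f m) = norm (of_real (v m) * (of_nat m :: complex) powr (-w)) * norm (of_real (sign_char sg m) * (of_nat m :: complex) powr (-?i) - 1)"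
          using abs_sign_char[where sg = sg and m = m, OF sg] by (simp add: norm_mult)
        thus ?thesis using b1[of m] by (simp add: mult_right_mono)
      qed
      have f1: "norm (?f m) \<le> ?t m * (real (2*J) * \<delta>)" if "m < 2*J" for m
      proof (cases "m = 0")
        case False
        have "norm (of_real (sign_char sg m) * (of_nat m :: complex) powr (-?i) - 1) \<le> real m * \<delta>"
          using False that nth_prime_ge(1)[of "2*J"] by (intro sign_char_approx[OF sg \<delta>(1) near]) auto
        also have "\<dots> \<le> real (2*J) * \<delta>" using that \<delta>(1) by (intro mult_right_mono) auto
        finally have "?t m * norm (of_real (sign_char sg m) * (of_nat m :: complex) powr (-?i) - 1) \<le> ?t m * (real (2*J) * \<delta>)"
          using v_nonneg[of m] by (intro mult_left_mono) auto
        thus ?thesis using fm[of m] by linarith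
      qed (use fm[of 0] in simp)
      have f2: "norm (?f m) \<le> 2 * ?t m" for m
      proof -
        have "norm (of_real (sign_char sg m) * (of_nat m :: complex) powr (-?i)) \<le> 1"
          using abs_sign_char[where sg = sg and m = m, OF sg] norm_of_nat_powr_imag[of m \<tau>] by (simp add: norm_mult)
        hence "norm (of_real (sign_char sg m) * (of_nat m :: complex) powr (-?i) - 1) \<le> 2"
          using norm_triangle_ineq4[of "of_real (sign_char sg m) * (of_nat m :: complex) powr (-?i)" 1] by simp
        hence "?t m * norm (of_real (sign_char sg m) * (of_nat m :: complex) powr (-?i) - 1) \<le> ?t m * 2"
          using v_nonneg[of m] by (intro mult_left_mono) auto
        thus ?thesis using fm[of m] by linarith
      qed
      have sf: "summable ?f" by (rule summable_diff[OF s1 s2])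
      have st: "summable (\<lambda>m. ?t (m + 2*J))" using summ_v by (subst summable_iff_shift)
      have split: "suminf ?f = (\<Sum>m. ?f (m + 2*J)) + (\<Sum>m<2*J. ?f m)"
        by (rule suminf_split_initial_segment[OF sf])
      have "norm (suminf ?f) \<le> norm (\<Sum>m. ?f (m + 2*J)) + norm (\<Sum>m<2*J. ?f m)"
        unfolding split by (rule norm_triangle_ineq)
      moreover have "norm (\<Sum>m. ?f (m + 2*J)) \<le> (\<Sum>m. 2 * ?t (m + 2*J))"
      proof (rule norm_suminf_le)
        show "norm (?f (m + 2*J)) \<le> 2 * ?t (m + 2*J)" for m by (rule f2)
        show "summable (\<lambda>m. 2 * ?t (m + 2*J))" by (rule summable_mult[OF st])
      qed
      moreover have "(\<Sum>m. 2 * ?t (m + 2*J)) = 2 * (\<Sum>m. ?t (m + 2*J))" by (rule suminf_mult[OF st])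
      moreover have "norm (\<Sum>m<2*J. ?f m) \<le> (\<Sum>m<2*J. ?t m * (real (2*J) * \<delta>))"
      proof (rule order.trans[OF norm_sum], rule sum_mono)
        fix m assume "m \<in> {..<2*J}"
        thus "norm (?f m) \<le> ?t m * (real (2*J) * \<delta>)" by (intro f1) simp
      qed
      moreover have "(\<Sum>m<2*J. ?t m * (real (2*J) * \<delta>)) = (\<Sum>m<2*J. ?t m) * (real (2*J) * \<delta>)"
        by (simp only: sum_distrib_right)
      moreover have "(\<Sum>m<2*J. ?t m) * (real (2*J) * \<delta>) \<le> Vmax * (real (2*J) * \<delta>)"
        unfolding Vmax_def using \<delta>(1) v_nonneg by (intro mult_right_mono sum_le_suminf summ_v) auto
      ultimately show ?thesis unfolding eq by linarith
    qed
    have "norm (V (w + ?i) * (MP (w + ?i) - sign_prodc sg J w)) \<le> Vmax * (4 ^ J * (real (2*J) * \<delta>))"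
      unfolding norm_mult using Rw Vmax_nonneg by (intro mult_mono norm_V_le M1) auto
    hence p1: "norm (V (w + ?i) * (MP (w + ?i) - sign_prodc sg J w)) \<le> \<mu> / 16" using \<delta>(3) by linarith
    have "norm ((V (w + ?i) - V_twist sg w) * sign_prodc sg J w) \<le>
       (Vmax * (real (2*J) * \<delta>) + 2 * (\<Sum>m. v (m + 2*J) * real (m + 2*J) powr (-(1/2)))) * B"
      unfolding norm_mult by (rule mult_mono[OF V1 B(1)[OF w] order.trans[OF norm_ge_zero V1] norm_ge_zero])
    also have "\<dots> \<le> \<mu> / 16" using tail \<delta>(2) by (simp add: distrib_right)
    finally have p2: "norm ((V (w + ?i) - V_twist sg w) * sign_prodc sg J w) \<le> \<mu> / 16" .
    have p3: "norm (rough_eta P (w + ?i) / u (w + ?i)) \<le> \<mu> / 16"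
    proof -
      have "norm (rough_eta P (w + ?i)) \<le> \<mu> / 16 * (2 powr (1 - \<beta>) - 1)" using rough[OF w] \<rho> by linarith
      also have "\<dots> \<le> \<mu> / 16 * norm (u (w + ?i))" using \<mu> Rw by (intro mult_left_mono ulow) auto
      finally have "norm (rough_eta P (w + ?i)) \<le> \<mu> / 16 * norm (u (w + ?i))" .
      moreover have "2 powr (1 - \<beta>) - 1 \<le> norm (u (w + ?i))" using Rw by (intro ulow) simp
      hence "norm (u (w + ?i)) > 0" using upos by linarith
      ultimately show ?thesis by (simp add: norm_divide pos_divide_le_eq)
    qed
    have "g w - (1 - V_twist sg w * sign_prodc sg J w) = rough_eta P (w + ?i) / u (w + ?i)
        - (V (w + ?i) * (MP (w + ?i) - sign_prodc sg J w) + (V (w + ?i) - V_twist sg w) * sign_prodc sg J w)"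
      by (simp add: g_def algebra_simps)
    also have "norm \<dots> \<le> norm (rough_eta P (w + ?i) / u (w + ?i)) +
       (norm (V (w + ?i) * (MP (w + ?i) - sign_prodc sg J w)) + norm ((V (w + ?i) - V_twist sg w) * sign_prodc sg J w))"
      by (intro order.trans[OF norm_triangle_ineq4] add_left_mono norm_triangle_ineq)
    finally show ?thesis using p1 p2 p3 \<mu> by linarith
  qed
  obtain z where z: "z \<in> ball X r" "g z = 0"
  proof (rule holomorphic_contract_to_zero)
    show "continuous_on (cball X r) g" by (rule holomorphic_on_imp_continuous_on[OF holg])
    show "g holomorphic_on ball X r" by (rule holomorphic_on_subset[OF holg]) auto
    \<comment> \<open>The perturbation \<mu>/4 leaves at most 3/8 \<mu> at the centre and at least
      5/8 \<mu> on the circle.\<close>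
    show "norm (g X) < norm (g w)" if "norm (X - w) = r" for w
    proof -
      have w: "w \<in> sphere X r" using that by (simp add: dist_norm)
      have "norm (g X) \<le> \<mu> / 8 + \<mu> / 4"
        using close[of X] centre r norm_triangle_ineq[of "g X - (1 - V_twist sg X * sign_prodc sg J X)" "1 - V_twist sg X * sign_prodc sg J X"] by simp
      moreover have "norm (g w) \<ge> 7 / 8 * \<mu> - \<mu> / 4"
        using close[of w] sph[OF w] w norm_triangle_ineq2[of "1 - V_twist sg w * sign_prodc sg J w" "1 - V_twist sg w * sign_prodc sg J w - g w"]
        by (simp add: norm_minus_commute)
      ultimately show ?thesis using \<mu> by linarith
    qed
  qed (use r that in auto)
  have zc: "z \<in> cball X r" using z by auto
  define s where "s = z + ?i"
  have u0: "u s \<noteq> 0" using ulow[of s] ReB[OF zc] upos by (auto simp: s_def)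
  \<comment> \<open>A zero of g is a zero of MP * xi, and MP has none because p^(-Re s) < 1.\<close>
  have M0: "MP s \<noteq> 0"
  proof -
    have "(of_nat p :: complex) powr (-s) \<noteq> 1" if pP: "p \<in> P" for p
    proof
      assume "(of_nat p :: complex) powr (-s) = 1"
      hence "norm ((of_nat p :: complex) powr (-s)) = 1" by simp
      hence "real p powr (- Re s) = 1" by (simp add: norm_powr_real_powr)
      moreover have "real p powr (- Re s) < 1"
      proof -
        obtain i where "p = nth_prime i" using pP by (auto simp: P_def)
        thus ?thesis using prime_powr_less_1[of "Re s" i] ReB(1)[OF zc] by (simp add: s_def)
      qed
      ultimately show False by simp
    qed
    thus ?thesis unfolding MP_def by (subst prod_zero_iff) (auto simp: P_def)
  qed
  have "u s * g z = MP s * xi s"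
  proof -
    have "u s * g z = u s * (1 - V s * MP s) + rough_eta P s"
      using u0 unfolding g_def s_def[symmetric] by (simp add: field_simps)
    also have "\<dots> = MP s * xi s"
      unfolding rough_eta_def u_def xi_def by (simp add: MP_def algebra_simps)
    finally show ?thesis .
  qed
  hence "xi s = 0" using z M0 by simp
  moreover have "s \<in> ball (X + ?i) r" using z by (simp add: s_def dist_norm)
  ultimately show ?thesis using that by blast
qed

end

text \<open>Since \<open>nth_prime i \<ge> i\<close>, every m with 1 < m < n has a prime factor in
  P, so no term below n survives.\<close>

lemma suminf_rough_le:
  fixes c :: real and n :: nat
  assumes c: "c > 1/2"
  defines "P \<equiv> nth_prime ` {0..<n}"
  shows "(\<Sum>m. (norm (rough_gt_1 P m))\<^sup>2 * real m powr (-2 * c)) \<le> (\<Sum>m. real (m + n) powr (-2 * c))"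
proof -
  let ?f = "\<lambda>m. (norm (rough_gt_1 P m))\<^sup>2 * real m powr (-2 * c)"
  have le: "?f m \<le> real m powr (-2 * c)" for m
    by (auto simp: rough_gt_1_def rough_def)
  have sf: "summable ?f"
    by (rule summable_comparison_test'[OF summable_powr_neg[OF c]]) (use le in auto)
  have zero: "?f m = 0" if "m < n" for m
  proof (cases "m \<le> 1")
    case False
    then obtain q where q: "prime q" "q dvd m" using prime_factor_nat[of m] by auto
    then obtain i where i: "nth_prime i = q" using nth_prime_surj by blast
    have "q \<le> m" using q False by (intro dvd_imp_le) auto
    hence "i < n" using nth_prime_ge(1)[of i] i that by simp
    hence "q \<in> P" using i by (auto simp: P_def)
    thus ?thesis using q by (auto simp: rough_gt_1_def rough_def)
  next
    case True
    hence "m = 0 \<or> m = 1" by linarith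
    thus ?thesis by (auto simp: rough_gt_1_def)
  qed
  have "suminf ?f = (\<Sum>m. ?f (m + n)) + (\<Sum>m<n. ?f m)"
    by (rule suminf_split_initial_segment[OF sf])
  also have "(\<Sum>m<n. ?f m) = 0" using zero by (intro sum.neutral) auto
  also have "(\<Sum>m. ?f (m + n)) \<le> (\<Sum>m. real (m + n) powr (-2 * c))"
  proof (rule suminf_le)
    show "summable (\<lambda>m. ?f (m + n))" using sf by (subst summable_iff_shift)
    show "summable (\<lambda>m. real (m + n) powr (-2 * c))"
      using summable_powr_neg[OF c] by (subst summable_iff_shift)
  qed (rule le)
  finally show ?thesis by simp
qed

text \<open>An interval without a point where F > 0 contributes at most 0 and any other at most M,
  so a large integral forces many intervals with such a point.\<close>

lemma card_positive_intervals_ge: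
  fixes F :: "real \<Rightarrow> real"
  assumes F: "F integrable_on {0..real n}" and M: "\<And>t. F t \<le> M" "M \<ge> 0"
  shows "integral {0..real n} F \<le> real (card {j\<in>{..<n}. \<exists>t\<in>{real j..real j + 1}. F t > 0}) * M"
proof -
  let ?G = "{j\<in>{..<n}. \<exists>t\<in>{real j..real j + 1}. F t > 0}"
  have "integral {0..real n} F = (\<Sum>j<n. integral {real j..real j + 1} F)"
    using sum_integrals_consecutive[of 1 F n] F by (simp add: add.commute)
  also have "\<dots> \<le> (\<Sum>j<n. if j \<in> ?G then M else 0)"
  proof (rule sum_mono)
    fix j assume j: "j \<in> {..<n}"
    have "F integrable_on {real j..real j + 1}"
      by (rule integrable_subinterval_real[OF F]) (use j in auto)
    hence "integral {real j..real j + 1} F \<le> integral {real j..real j + 1} (\<lambda>_. if j \<in> ?G then M else 0)"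
    proof (rule integral_le)
      fix t assume t: "t \<in> {real j..real j + 1}"
      show "F t \<le> (if j \<in> ?G then M else 0)"
      proof (cases "F t > 0")
        case True
        hence "j \<in> ?G" using t j by auto
        thus ?thesis using M(1) by simp
      next
        case False
        thus ?thesis using M(2) by auto
      qed
    qed (rule integrable_const_ivl)
    also have "\<dots> = (if j \<in> ?G then M else 0)" by simp
    finally show "integral {real j..real j + 1} F \<le> (if j \<in> ?G then M else 0)" .
  qed
  also have "\<dots> = (\<Sum>j\<in>?G. M)"
    by (rule sum.mono_neutral_cong_right) auto
  finally show ?thesis by simp
qed

context zeta_minus_series
begin

text \<open>
  Comparing the resonator-weighted means shows that a positive proportion of the unit intervals contain
  a good shift; a zero arises from at most three of these intervals.
\<close>

lemma zero_count_lower: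
  assumes ab: "1/2 < \<alpha>" "\<alpha> < \<beta>" "\<beta> < 1"
  obtains C where "C > 0" "\<forall>\<^sub>F T in at_top. C * T \<le> real_of_int (\<Sum>z\<in>zeros \<alpha> \<beta> T. zorder xi z)"
proof (rule exists_twisted_zero[OF ab])
  fix sg x r \<mu> B
  assume sg: "\<And>i. \<bar>sg i\<bar> = 1" and r: "r > 0" "r < 1/2" "\<alpha> < x - 2 * r" "x + 2 * r < \<beta>"
    and \<mu>: "\<mu> > 0" and B: "B \<ge> 0"
    and ev: "\<forall>\<^sub>F J in sequentially. (\<forall>w\<in>cball (of_real x) r. norm (sign_prodc sg J w) \<le> B) \<and>
        norm (1 - V_twist sg (of_real x) * sign_prodc sg J (of_real x)) \<le> \<mu> / 8 \<and>
        (\<forall>w\<in>sphere (of_real x) r. norm (1 - V_twist sg w * sign_prodc sg J w) \<ge> 7 / 8 * \<mu>)"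
  define X where "X = (of_real x :: complex)"
  define \<rho> where "\<rho> = \<mu> / 16 * (2 powr (1 - \<beta>) - 1)"
  have \<rho>: "\<rho> > 0" using \<mu> ab powr_less_mono[of 0 "1 - \<beta>" 2] by (simp add: \<rho>_def)
  obtain N1 where N1: "\<And>J. J \<ge> N1 \<Longrightarrow> (\<forall>w\<in>cball (of_real x) r. norm (sign_prodc sg J w) \<le> B) \<and>
        norm (1 - V_twist sg (of_real x) * sign_prodc sg J (of_real x)) \<le> \<mu> / 8 \<and>
        (\<forall>w\<in>sphere (of_real x) r. norm (1 - V_twist sg w * sign_prodc sg J w) \<ge> 7 / 8 * \<mu>)"
    using ev unfolding eventually_sequentially by blast
  have "\<mu> / (64 * (B + 1)) > 0" using \<mu> B by simp
  from v_tail[OF this] obtain N2 where N2: "\<And>n. n \<ge> N2 \<Longrightarrow> (\<Sum>m. v (m + n) * real (m + n) powr (-(1/2))) < \<mu> / (64 * (B + 1))"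
    unfolding eventually_sequentially by blast
  \<comment> \<open>With R \<le> \<rho>^2/640 and e = \<rho>^2 cS/16 the rough part of the weighted
    mean is at most T cS \<rho>^2 (1/32 + 1/16); multiplied by 2/\<rho>^2 this is 3/16 of T cS, less
    than a quarter.\<close>
  obtain N3 where N3: "\<And>n. n \<ge> N3 \<Longrightarrow> norm (\<Sum>i. real (i + n) powr (-2 * \<alpha>)) < \<rho>\<^sup>2 / 640"
    using suminf_exist_split[OF _ summable_powr_neg[OF ab(1)], of "\<rho>\<^sup>2 / 640"] \<rho> by auto
  define J where "J = max N1 (max N2 (max N3 1))"
  have J: "J \<ge> N1" "2 * J \<ge> N2" "2 * J \<ge> N3" "J \<ge> 1" by (auto simp: J_def)
  note tw = N1[OF J(1), folded X_def]
  have tail: "2 * (\<Sum>m. v (m + 2*J) * real (m + 2*J) powr (-(1/2))) * B \<le> \<mu> / 32"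
  proof -
    have "(\<Sum>m. v (m + 2*J) * real (m + 2*J) powr (-(1/2))) * B \<le> \<mu> / (64 * (B + 1)) * (B + 1)"
      using N2[OF J(2)] B \<mu> by (intro mult_mono) auto
    also have "\<dots> = \<mu> / 64" using B by (simp add: field_simps)
    finally show ?thesis by simp
  qed
  define P where "P = nth_prime ` {0..<2*J}"
  have P: "finite P" "\<And>p. p \<in> P \<Longrightarrow> prime p" by (auto simp: P_def prime_nth_prime)
  define R where "R = (\<Sum>m. (norm (rough_gt_1 P m))\<^sup>2 * real m powr (-2 * \<alpha>))"
  have R: "R \<le> \<rho>\<^sup>2 / 640"
    using suminf_rough_le[OF ab(1), of "2*J"] N3[OF J(3)] unfolding R_def P_def by (simp add: abs_less_iff)
  \<comment> \<open>A common majorant of the constants in both conditions on \<delta>, so that one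
    \<delta> serves for V and for the prime product.\<close>
  define W where "W = (Vmax + 1) * 4 ^ J * (real (2*J) + 1) * (B + 1)"
  have W: "W > 0" using Vmax_nonneg B unfolding W_def by (intro mult_pos_pos) auto
  define \<delta> where "\<delta> = \<mu> / 32 / W"
  have \<delta>: "\<delta> > 0" using \<mu> W by (simp add: \<delta>_def)
  have W\<delta>: "W * \<delta> = \<mu> / 32" using W by (simp add: \<delta>_def)
  have \<delta>1: "Vmax * (real (2*J) * \<delta>) * B \<le> \<mu> / 32"
  proof -
    have "Vmax * 1 * real (2*J) * B \<le> W"
      unfolding W_def using Vmax_nonneg B by (intro mult_mono) auto
    hence "Vmax * 1 * real (2*J) * B * \<delta> \<le> W * \<delta>" using \<delta> by (intro mult_right_mono) auto
    thus ?thesis using W\<delta> by (simp add: mult_ac)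
  qed
  have \<delta>2: "Vmax * (4 ^ J * (real (2*J) * \<delta>)) \<le> \<mu> / 16"
  proof -
    have "Vmax * 4 ^ J * real (2*J) * 1 \<le> W"
      unfolding W_def using Vmax_nonneg B by (intro mult_mono) auto
    hence "Vmax * 4 ^ J * real (2*J) * 1 * \<delta> \<le> W * \<delta>" using \<delta> by (intro mult_right_mono) auto
    thus ?thesis using W\<delta> \<mu> by (simp add: mult_ac)
  qed
  \<comment> \<open>This exponent makes the 2J boundary proportions 2/(N + 1), divided by
    \<delta>^2, add up to at most 1/4.\<close>
  define N where "N = nat \<lceil>16 * real J / \<delta>\<^sup>2\<rceil>"
  have N: "real (2*J) * (2 / (real N + 1)) / \<delta>\<^sup>2 \<le> 1/4"
  proof -
    have "16 * real J / \<delta>\<^sup>2 \<le> real N + 1" unfolding N_def by linarith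
    hence "16 * real J \<le> (real N + 1) * \<delta>\<^sup>2" using \<delta> by (simp add: pos_divide_le_eq)
    moreover have "(real N + 1) * \<delta>\<^sup>2 > 0" using \<delta> by (intro mult_pos_pos) auto
    ultimately show ?thesis using \<delta> by (simp add: field_simps)
  qed
  define Q where "Q = (\<Prod>i\<in>{0..<2*J}. nth_prime i)"
  define S where "S = {d. d dvd Q ^ N}"
  define ch where "ch = (\<lambda>d. of_real (sign_char sg d) :: complex)"
  have nch: "norm (ch d) = 1" for d using abs_sign_char[where sg = sg, OF sg] by (simp add: ch_def)
  have Q0: "Q > 0" unfolding Q_def using prime_nth_prime prime_gt_0_nat by (intro prod_pos) auto
  have finS: "finite S" unfolding S_def using Q0 by (intro finite_divisors_nat) auto
  have S1: "d \<ge> 1" if "d \<in> S" for d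
  proof -
    have "Q ^ N > 0" "d dvd Q ^ N" using that Q0 by (simp_all add: S_def)
    hence "d > 0" by (rule dvd_pos_nat)
    thus ?thesis by simp
  qed
  have Sprime: "q \<in> P" if d: "d \<in> S" and q: "prime q" "q dvd d" for d q
  proof -
    have "q dvd Q ^ N" using d q by (auto simp: S_def intro: dvd_trans)
    hence "q dvd Q" using prime_dvd_power[OF q(1)] by blast
    then obtain i where "i \<in> {0..<2*J}" "q dvd nth_prime i"
      using q(1) unfolding Q_def by (auto simp: prime_dvd_prod_iff)
    moreover have "q = nth_prime i" using primes_dvd_imp_eq[OF q(1) prime_nth_prime] calculation by blast
    ultimately show ?thesis by (auto simp: P_def)
  qed
  define cS where "cS = real (card S)"
  have "1 \<in> S" by (simp add: S_def)
  hence "card S > 0" using finS by (auto simp: card_gt_0_iff)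
  hence cS: "cS \<ge> 1" by (simp add: cS_def)
  define A where "A = imag_poly S ch"
  have nA: "norm (A t) \<le> cS" for t unfolding A_def cS_def by (rule norm_imag_poly_le) (simp add: nch)
  have contA: "continuous_on U A" for U unfolding A_def by (rule continuous_on_imag_poly)
  obtain K0 where K0: "\<And>T. T \<ge> 0 \<Longrightarrow> \<bar>integral {0..T} (\<lambda>t. (norm (A t))\<^sup>2) - T * cS\<bar> \<le> K0"
    unfolding A_def cS_def using imag_poly_mean_square[where x = ch, OF finS S1 nch] by blast
  define E where "E = (\<lambda>i t. of_real (sg i) * of_nat (nth_prime i) powr (-(\<i> * of_real t)) - 1 :: complex)"
  have contE: "continuous_on U (E i)" for U i unfolding E_def by (intro continuous_intros)
  have "\<exists>K. \<forall>T\<ge>0. integral {0..T} (\<lambda>t. (norm (A t * E i t))\<^sup>2) \<le> T * (2 * cS / (real N + 1)) + K" if i: "i < 2*J" for i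
  proof -
    let ?p = "nth_prime i"
    have Qi: "Q = ?p * (\<Prod>j\<in>{0..<2*J}-{i}. nth_prime j)"
      unfolding Q_def using i by (subst prod.remove[of _ i]) auto
    have "?p > 0" using prime_nth_prime[of i] prime_gt_0_nat by blast
    hence div: "Q div ?p = (\<Prod>j\<in>{0..<2*J}-{i}. nth_prime j)" unfolding Qi by simp
    have nd: "\<not> ?p dvd Q div ?p"
    proof
      assume "?p dvd Q div ?p"
      hence "\<exists>j\<in>{0..<2*J}-{i}. ?p dvd nth_prime j"
        unfolding div by (subst (asm) prime_dvd_prod_iff) (use prime_nth_prime[of i] in auto)
      then obtain j where j: "j \<in> {0..<2*J} - {i}" "?p dvd nth_prime j" by blast
      have "nth_prime i = nth_prime j" using primes_dvd_imp_eq[OF prime_nth_prime prime_nth_prime j(2)] .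
      thus False using j(1) inj_nth_prime by (auto simp: inj_def)
    qed
    have dv: "?p dvd Q" unfolding Qi by simp
    have mult: "ch (?p * m) = ch ?p * ch m" if "m \<ge> 1" for m
      using that prime_gt_0_nat[OF prime_nth_prime[of i]] unfolding ch_def by (subst sign_char_mult) auto
    show ?thesis
    proof (rule resonator_concentration[where x = ch and N = N, OF prime_nth_prime Q0 dv nd nch mult])
      fix K
      assume K: "\<And>T. 0 \<le> T \<Longrightarrow> integral {0..T} (\<lambda>t. (norm (imag_poly {d. d dvd Q ^ N} ch t * (ch ?p * of_nat ?p powr (-(\<i> * of_real t)) - 1)))\<^sup>2)
         \<le> T * (2 * real (card {d. d dvd Q ^ N}) / (real N + 1)) + K"
      have "ch ?p = of_real (sg i)" by (simp add: ch_def sign_char_nth_prime)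
      thus ?thesis using K unfolding A_def S_def cS_def E_def by auto
    qed
  qed
  then obtain Kf where Kf: "\<And>i T. i < 2*J \<Longrightarrow> T \<ge> 0 \<Longrightarrow> integral {0..T} (\<lambda>t. (norm (A t * E i t))\<^sup>2) \<le> T * (2 * cS / (real N + 1)) + Kf i"
    by metis
  define e where "e = \<rho>\<^sup>2 * cS / 16"
  have e: "e > 0" using \<rho> cS by (simp add: e_def)
  have R0: "\<bar>x\<bar> + 2 * r \<ge> 0" using r by simp
  have "\<forall>\<^sub>F T in at_top. \<forall>w. Re w \<ge> \<alpha> \<longrightarrow> norm w \<le> \<bar>x\<bar> + 2 * r \<longrightarrow>
       integral {0..T} (\<lambda>t. (norm (A t * rough_eta P (w + \<i> * of_real t)))\<^sup>2) \<le> T * (20 * real (card S) * R + e)"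
    unfolding A_def R_def by (rule rough_mean_square[OF P finS S1 Sprime _ ab(1) _ R0 e]) (use nch ab in auto)
  then obtain T1 where T1: "\<And>T w. T \<ge> T1 \<Longrightarrow> Re w \<ge> \<alpha> \<Longrightarrow> norm w \<le> \<bar>x\<bar> + 2 * r \<Longrightarrow>
       integral {0..T} (\<lambda>t. (norm (A t * rough_eta P (w + \<i> * of_real t)))\<^sup>2) \<le> T * (20 * cS * R + e)"
    unfolding eventually_at_top_linorder cS_def by blast
  let ?c = "circlepath X (2 * r)"
  have cnorm: "norm (?c u - X) = 2 * r" for u using r by (simp add: circlepath norm_mult norm_exp_eq_Re)
  have cRe: "Re (?c u) \<ge> \<alpha>" for u
  proof -
    have "\<bar>Re (?c u - X)\<bar> \<le> 2 * r" using abs_Re_le_cmod[of "?c u - X"] cnorm by simp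
    thus ?thesis using r by (simp add: X_def abs_le_iff)
  qed
  have cn: "norm (?c u) \<le> \<bar>x\<bar> + 2 * r" for u
    using norm_triangle_ineq[of X "?c u - X"] cnorm[of u] by (simp add: X_def)
  have contr: "continuous_on U (\<lambda>p. rough_eta P (f p))" if "continuous_on U f" for U :: "(real \<times> real) set" and f
    by (rule continuous_on_compose2[OF holomorphic_on_imp_continuous_on[OF rough_eta_holomorphic[OF P(2), where A = UNIV]] that]) auto
  \<comment> \<open>A mean over the circle of radius 2r controls \<open>rough_eta\<close> on the
    whole disc of radius r, with the constant 2r / (2r - r) = 2 from
    \<open>norm_le_circle_mean\<close>.\<close>
  define Gm where "Gm = (\<lambda>t. integral {0..1} (\<lambda>u. (norm (rough_eta P (?c u + \<i> * of_real t)))\<^sup>2))"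
  have contg: "continuous_on (U1 \<times> U2) (\<lambda>(t, u). (norm (rough_eta P (?c u + \<i> * of_real t)))\<^sup>2)" for U1 U2 :: "real set"
    unfolding split_def circlepath by (intro continuous_intros contr)
  have contG: "continuous_on U Gm" for U
    unfolding Gm_def
    using integral_continuous_on_param[of U 0 1 "\<lambda>t u. (norm (rough_eta P (?c u + \<i> * of_real t)))\<^sup>2"] contg[of U "cbox 0 1"] by simp
  have contAg: "continuous_on (U1 \<times> U2) (\<lambda>(t, u). (norm (A t * rough_eta P (?c u + \<i> * of_real t)))\<^sup>2)" for U1 U2 :: "real set"
    unfolding split_def circlepath by (intro continuous_intros contr continuous_on_compose2[OF contA[of UNIV]]) auto
  have Gm_nonneg: "Gm t \<ge> 0" for t
    unfolding Gm_def
  proof (rule integral_nonneg)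
    show "(\<lambda>u. (norm (rough_eta P (?c u + \<i> * of_real t)))\<^sup>2) integrable_on {0..1}"
    proof (rule integrable_continuous_interval)
      have "continuous_on {0..1} (\<lambda>u. ?c u + \<i> * of_real t)" unfolding circlepath by (intro continuous_intros)
      from continuous_on_compose2[OF holomorphic_on_imp_continuous_on[OF rough_eta_holomorphic[OF P(2), where A = UNIV]] this]
      show "continuous_on {0..1} (\<lambda>u. (norm (rough_eta P (?c u + \<i> * of_real t)))\<^sup>2)" by (intro continuous_intros) auto
    qed
  qed simp
  have Gm_bound: "(norm (rough_eta P (w + \<i> * of_real t)))\<^sup>2 \<le> 2 * Gm t" if w: "w \<in> cball X r" for w t
  proof -
    have hol: "(\<lambda>s. (rough_eta P (s + \<i> * of_real t))\<^sup>2) holomorphic_on UNIV"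
    proof (rule holomorphic_on_power)
      have "(\<lambda>s. s + \<i> * of_real t) holomorphic_on UNIV" by (intro holomorphic_intros)
      from holomorphic_on_compose_gen[OF this rough_eta_holomorphic[OF P(2), where A = UNIV] subset_UNIV]
      show "(\<lambda>s. rough_eta P (s + \<i> * of_real t)) holomorphic_on UNIV" by (simp only: o_def)
    qed
    have "norm ((rough_eta P (w + \<i> * of_real t))\<^sup>2) \<le> 2 * r / (2 * r - r) * integral {0..1} (\<lambda>u. norm ((rough_eta P (?c u + \<i> * of_real t))\<^sup>2))"
      by (rule norm_le_circle_mean[OF hol]) (use w r in auto)
    thus ?thesis using r by (simp add: norm_power Gm_def)
  qed
  \<comment> \<open>A Chebyshev device: all terms are nonnegative, so \<Omega> t < 1 yields
    closeness at every prime and smallness of \<open>rough_eta\<close> on the disc at once; F t > 0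
    implies \<Omega> t < 1.\<close>
  define \<Omega> where "\<Omega> = (\<lambda>t. (\<Sum>i<2*J. (norm (E i t))\<^sup>2) / \<delta>\<^sup>2 + 2 / \<rho>\<^sup>2 * Gm t)"
  define F where "F = (\<lambda>t. (norm (A t))\<^sup>2 * (1 - \<Omega> t))"
  have \<Omega>_nonneg: "\<Omega> t \<ge> 0" for t
    unfolding \<Omega>_def using Gm_nonneg by (intro add_nonneg_nonneg divide_nonneg_nonneg sum_nonneg mult_nonneg_nonneg) auto
  have F_le: "F t \<le> cS\<^sup>2" for t
  proof -
    have "F t \<le> (norm (A t))\<^sup>2 * 1" unfolding F_def using \<Omega>_nonneg[of t] by (intro mult_left_mono) auto
    also have "\<dots> \<le> cS\<^sup>2" using nA[of t] by (simp add: power_mono)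
    finally show ?thesis .
  qed
  have contF: "continuous_on U F" for U
    unfolding F_def \<Omega>_def by (intro continuous_intros contA contE contG) (use \<delta> \<rho> in auto)
  have good: "\<exists>z\<in>ball (X + \<i> * of_real t) r. xi z = 0" if "F t > 0" for t
  proof -
    have "\<Omega> t < 1"
    proof (rule ccontr)
      assume "\<not> \<Omega> t < 1"
      hence "F t \<le> 0" unfolding F_def by (intro mult_nonneg_nonpos) auto
      thus False using that by simp
    qed
    hence lt: "(\<Sum>i<2*J. (norm (E i t))\<^sup>2) / \<delta>\<^sup>2 + 2 / \<rho>\<^sup>2 * Gm t < 1" by (simp add: \<Omega>_def)
    have n1: "(\<Sum>i<2*J. (norm (E i t))\<^sup>2) / \<delta>\<^sup>2 \<ge> 0" by (intro divide_nonneg_nonneg sum_nonneg) auto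
    have n2: "2 / \<rho>\<^sup>2 * Gm t \<ge> 0" using Gm_nonneg by (intro mult_nonneg_nonneg) auto
    have near: "norm (E i t) \<le> \<delta>" if "i < 2*J" for i
    proof -
      have "(norm (E i t))\<^sup>2 \<le> (\<Sum>i<2*J. (norm (E i t))\<^sup>2)" using that by (intro member_le_sum) auto
      also have "\<dots> \<le> \<delta>\<^sup>2"
      proof -
        have "(\<Sum>i<2*J. (norm (E i t))\<^sup>2) / \<delta>\<^sup>2 \<le> 1" using lt n2 by linarith
        thus ?thesis using \<delta> by (simp add: pos_divide_le_eq)
      qed
      finally show ?thesis using \<delta> by (simp add: power2_le_iff_abs_le)
    qed
    have rough: "norm (rough_eta P (w + \<i> * of_real t)) \<le> \<rho>" if "w \<in> cball X r" for w
    proof -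
      have "2 / \<rho>\<^sup>2 * Gm t \<le> 1" using lt n1 by linarith
      hence "2 * Gm t \<le> \<rho>\<^sup>2" using \<rho> by (simp add: pos_divide_le_eq)
      hence "(norm (rough_eta P (w + \<i> * of_real t)))\<^sup>2 \<le> \<rho>\<^sup>2" using Gm_bound[OF that, of t] by linarith
      thus ?thesis using \<rho> by (simp add: power2_le_iff_abs_le)
    qed
    obtain z where "z \<in> ball (of_real x + \<i> * of_real t) r" "xi z = 0"
    proof (rule xi_zero_of_good_shift[where sg = sg and J = J and \<delta> = \<delta> and \<rho> = \<rho> and \<beta> = \<beta> and \<mu> = \<mu> and B = B and r = r and x = x and \<tau> = t])
      show "norm (of_real (sg i) * of_nat (nth_prime i) powr (-(\<i> * of_real t)) - 1 :: complex) \<le> \<delta>" if "i < 2*J" for i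
        using near[OF that] by (simp add: E_def)
      show "norm (rough_eta (nth_prime ` {0..<2*J}) (w + \<i> * of_real t)) \<le> \<rho>" if "w \<in> cball (of_real x) r" for w
        using rough[of w] that by (simp add: P_def X_def)
    qed (use sg r ab \<mu> B tw tail \<delta> \<delta>1 \<delta>2 \<rho>_def in \<open>auto simp: X_def\<close>)
    thus ?thesis by (auto simp: X_def)
  qed
  define KK where "KK = K0 + (\<Sum>i<2*J. Kf i) / \<delta>\<^sup>2"
  \<comment> \<open>Of the mean T cS of |A|^2 the prime conditions and the rough part each take at
    most a quarter, up to bounded terms, so half remains.\<close>
  have intF: "integral {0..T} F \<ge> T * cS / 2 - KK" if T: "T \<ge> max T1 0" for T
  proof -
    have T0: "T \<ge> 0" "T \<ge> T1" using T by auto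
    let ?a = "\<lambda>t. (norm (A t))\<^sup>2"
    let ?b = "\<lambda>t. (\<Sum>i<2*J. (norm (A t * E i t))\<^sup>2)"
    let ?d = "\<lambda>t. (norm (A t))\<^sup>2 * Gm t"
    have Feq: "F t = ?a t - (1 / \<delta>\<^sup>2 * ?b t + 2 / \<rho>\<^sup>2 * ?d t)" for t
      unfolding F_def \<Omega>_def norm_mult power_mult_distrib sum_distrib_left[symmetric] by (simp add: algebra_simps)
    have ia: "?a integrable_on {0..T}" by (intro integrable_continuous_interval continuous_intros contA)
    have ib0: "(\<lambda>t. (norm (A t * E i t))\<^sup>2) integrable_on {0..T}" for i
      by (intro integrable_continuous_interval continuous_intros contA contE)
    have ib: "?b integrable_on {0..T}" by (intro integrable_sum ib0) auto
    have id: "?d integrable_on {0..T}" by (intro integrable_continuous_interval continuous_intros contA contG)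
    have "integral {0..T} F = integral {0..T} ?a - (1 / \<delta>\<^sup>2 * integral {0..T} ?b + 2 / \<rho>\<^sup>2 * integral {0..T} ?d)"
    proof -
      have "(F has_integral (integral {0..T} ?a - (1 / \<delta>\<^sup>2 * integral {0..T} ?b + 2 / \<rho>\<^sup>2 * integral {0..T} ?d))) {0..T}"
        unfolding Feq[abs_def]
        by (intro has_integral_diff has_integral_add has_integral_mult_right integrable_integral ia ib id)
      thus ?thesis by (rule integral_unique)
    qed
    moreover have "integral {0..T} ?a \<ge> T * cS - K0" using K0[OF T0(1)] by linarith
    moreover have "1 / \<delta>\<^sup>2 * integral {0..T} ?b \<le> T * cS / 4 + (\<Sum>i<2*J. Kf i) / \<delta>\<^sup>2"
    proof -
      have "integral {0..T} ?b = (\<Sum>i<2*J. integral {0..T} (\<lambda>t. (norm (A t * E i t))\<^sup>2))"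
        by (intro integral_sum ib0) auto
      also have "\<dots> \<le> (\<Sum>i<2*J. T * (2 * cS / (real N + 1)) + Kf i)"
        using T0 by (intro sum_mono Kf) auto
      also have "\<dots> = real (2*J) * (T * (2 * cS / (real N + 1))) + (\<Sum>i<2*J. Kf i)"
        by (simp add: sum.distrib)
      finally have "1 / \<delta>\<^sup>2 * integral {0..T} ?b \<le> 1 / \<delta>\<^sup>2 * (real (2*J) * (T * (2 * cS / (real N + 1))) + (\<Sum>i<2*J. Kf i))"
        by (intro mult_left_mono) auto
      also have "\<dots> = (T * cS) * (real (2*J) * (2 / (real N + 1)) / \<delta>\<^sup>2) + (\<Sum>i<2*J. Kf i) / \<delta>\<^sup>2"
        by (simp add: add_divide_distrib mult_ac)
      also have "(T * cS) * (real (2*J) * (2 / (real N + 1)) / \<delta>\<^sup>2) \<le> (T * cS) * (1/4)"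
        using N T0 cS by (intro mult_left_mono) auto
      finally show ?thesis by simp
    qed
    moreover have "2 / \<rho>\<^sup>2 * integral {0..T} ?d \<le> T * cS / 4"
    proof -
      have "integral {0..T} ?d = integral {0..T} (\<lambda>t. integral {0..1} (\<lambda>u. (norm (A t * rough_eta P (?c u + \<i> * of_real t)))\<^sup>2))"
        unfolding Gm_def norm_mult power_mult_distrib by (simp only: integral_mult_right)
      also have "\<dots> = integral {0..1} (\<lambda>u. integral {0..T} (\<lambda>t. (norm (A t * rough_eta P (?c u + \<i> * of_real t)))\<^sup>2))"
      proof -
        have "integral (cbox 0 T) (\<lambda>t. integral (cbox 0 1) (\<lambda>u. (norm (A t * rough_eta P (?c u + \<i> * of_real t)))\<^sup>2)) =
          integral (cbox 0 1) (\<lambda>u. integral (cbox 0 T) (\<lambda>t. (norm (A t * rough_eta P (?c u + \<i> * of_real t)))\<^sup>2))"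
          by (rule integral_swap_continuous) (use contAg in \<open>simp add: cbox_Pair_eq\<close>)
        thus ?thesis by simp
      qed
      also have "\<dots> \<le> integral {0..1::real} (\<lambda>u. T * (20 * cS * R + e))"
      proof (rule integral_le)
        have "continuous_on ({0..1} \<times> cbox 0 T) (\<lambda>(u, t). (norm (A t * rough_eta P (?c u + \<i> * of_real t)))\<^sup>2)"
          unfolding split_def circlepath by (intro continuous_intros contr continuous_on_compose2[OF contA[of UNIV]]) auto
        hence "continuous_on {0..1} (\<lambda>u. integral (cbox 0 T) (\<lambda>t. (norm (A t * rough_eta P (?c u + \<i> * of_real t)))\<^sup>2))"
          by (rule integral_continuous_on_param)
        thus "(\<lambda>u. integral {0..T} (\<lambda>t. (norm (A t * rough_eta P (?c u + \<i> * of_real t)))\<^sup>2)) integrable_on {0..1}"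
          by (intro integrable_continuous_interval) simp
        show "integral {0..T} (\<lambda>t. (norm (A t * rough_eta P (?c u + \<i> * of_real t)))\<^sup>2) \<le> T * (20 * cS * R + e)" for u
          by (intro T1 T0 cRe cn)
      qed auto
      also have "\<dots> = T * (20 * cS * R + e)" by simp
      also have "\<dots> \<le> T * (20 * cS * (\<rho>\<^sup>2 / 640) + \<rho>\<^sup>2 * cS / 16)"
        unfolding e_def using T0 cS R by (intro mult_left_mono add_right_mono) auto
      also have "\<dots> = \<rho>\<^sup>2 / 2 * (T * cS * 3 / 16)" by (simp add: algebra_simps)
      finally have "2 / \<rho>\<^sup>2 * integral {0..T} ?d \<le> 2 / \<rho>\<^sup>2 * (\<rho>\<^sup>2 / 2 * (T * cS * 3 / 16))"
        by (intro mult_left_mono) auto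
      also have "\<dots> = T * cS * 3 / 16" using \<rho> by simp
      also have "\<dots> \<le> T * cS / 4" using T0 cS by simp
      finally show ?thesis .
    qed
    ultimately show ?thesis unfolding KK_def by linarith
  qed
  \<comment> \<open>From n/4 \<le> cS card G and card G \<le> 3 card Z + 1 it follows that 12 cS
    card Z is at least T - 2 - 4 cS, and this is at least T/2 for T \<ge> 8 cS + 4.\<close>
  define C where "C = 1 / (24 * cS)"
  have "C * T \<le> real_of_int (\<Sum>z\<in>zeros \<alpha> \<beta> T. zorder xi z)" if T: "T \<ge> Max {T1 + 2, 4 * KK / cS + 2, 8 * cS + 4}" for T
  proof -
    have T': "T \<ge> T1 + 2" "T \<ge> 4 * KK / cS + 2" "T \<ge> 8 * cS + 4" using T by auto
    define n where "n = nat \<lfloor>T - 1\<rfloor>"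
    have n: "real n \<le> T - 1" "real n \<ge> T - 2" unfolding n_def using T'(3) cS by linarith+
    define G where "G = {j\<in>{..<n}. \<exists>t\<in>{real j..real j + 1}. F t > 0}"
    have finG: "finite G" by (simp add: G_def)
    have "real n * cS / 2 - KK \<le> integral {0..real n} F"
      using n T' by (intro intF) auto
    also have "\<dots> \<le> real (card G) * cS\<^sup>2"
      unfolding G_def by (intro card_positive_intervals_ge integrable_continuous_interval contF F_le) auto
    finally have "real n * cS / 2 - KK \<le> real (card G) * cS\<^sup>2" .
    moreover have "KK \<le> real n * cS / 4"
    proof -
      have "4 * KK / cS \<le> real n" using n T' by linarith
      hence "4 * KK \<le> real n * cS" using cS by (simp add: pos_divide_le_eq)
      thus ?thesis by simp
    qed
    ultimately have "cS * (real n / 4) \<le> cS * (real (card G) * cS)" by (simp add: power2_eq_square algebra_simps)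
    hence cG: "real n / 4 \<le> real (card G) * cS" by (rule mult_left_le_imp_le) (use cS in simp)
    let ?Z = "zeros \<alpha> \<beta> T"
    have finZ: "finite ?Z" by (rule finite_zeros[OF ab(1)])
    let ?near = "\<lambda>z. {j::nat. Im z - 3/2 < real j \<and> real j < Im z + 1/2}"
    \<comment> \<open>For j = 0 the zero could lie at a height \<le> 0. For j \<ge> 1, and with n
      \<le> T - 1, it satisfies 0 < Im z < T because its height differs from t by less than
      1/2.\<close>
    have "G - {0} \<subseteq> (\<Union>z\<in>?Z. ?near z)"
    proof
      fix j assume j: "j \<in> G - {0}"
      then obtain t where t: "t \<in> {real j..real j + 1}" "F t > 0" by (auto simp: G_def)
      obtain z where z: "z \<in> ball (X + \<i> * of_real t) r" "xi z = 0" using good[OF t(2)] by blast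
      have nz: "norm (z - (X + \<i> * of_real t)) < r" using z by (simp add: dist_norm norm_minus_commute)
      have re: "\<bar>Re z - x\<bar> < r" using abs_Re_le_cmod[of "z - (X + \<i> * of_real t)"] nz by (simp add: X_def)
      have im: "\<bar>Im z - t\<bar> < r" using abs_Im_le_cmod[of "z - (X + \<i> * of_real t)"] nz by (simp add: X_def)
      have jn: "1 \<le> j" "j < n" using j by (auto simp: G_def)
      have "real j + 1 \<le> real n" using jn by simp
      hence "z \<in> ?Z" unfolding zeros_def using re im r t n jn z by auto
      moreover have "j \<in> ?near z" using im r t by auto
      ultimately show "j \<in> (\<Union>z\<in>?Z. ?near z)" by blast
    qed
    moreover have "finite (\<Union>z\<in>?Z. ?near z)"
      using finZ card_nat_near(2) by (auto simp: zeros_def)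
    ultimately have "card (G - {0}) \<le> card (\<Union>z\<in>?Z. ?near z)" by (rule card_mono[rotated])
    also have "\<dots> \<le> (\<Sum>z\<in>?Z. card (?near z))" by (rule card_UN_le[OF finZ])
    also have "\<dots> \<le> (\<Sum>z\<in>?Z. 3)" by (intro sum_mono card_nat_near(1)) (auto simp: zeros_def)
    also have "\<dots> = 3 * card ?Z" by simp
    finally have "card G \<le> 3 * card ?Z + 1" using card_Diff1_le[of G 0] by (cases "0 \<in> G") (auto simp: finG card_Diff_singleton)
    hence "real (card G) \<le> 3 * real (card ?Z) + 1" by linarith
    hence "real (card G) * cS \<le> (3 * real (card ?Z) + 1) * cS" using cS by (intro mult_right_mono) auto
    hence "T - 2 \<le> 4 * ((3 * real (card ?Z) + 1) * cS)" using cG n by linarith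
    hence "T \<le> 24 * cS * real (card ?Z)" using T'(3) cS by (simp add: algebra_simps)
    hence "C * T \<le> real (card ?Z)" using cS by (simp add: C_def pos_divide_le_eq mult.commute)
    also have "\<dots> = real_of_int (\<Sum>z\<in>?Z. 1)" by simp
    also have "\<dots> \<le> real_of_int (\<Sum>z\<in>?Z. zorder xi z)"
      unfolding of_int_le_iff using ab by (intro sum_mono zorder_xi_nonneg(2)) (auto simp: zeros_def)
    finally show ?thesis .
  qed
  hence "\<forall>\<^sub>F T in at_top. C * T \<le> real_of_int (\<Sum>z\<in>zeros \<alpha> \<beta> T. zorder xi z)"
    unfolding eventually_at_top_linorder by blast
  moreover have "C > 0" using cS by (simp add: C_def)
  ultimately show ?thesis using that by blast
qed

end

section \<open>The zeta function of the sphere\<close>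

lemma sums_coeff_shift:
  assumes d: "d \<ge> 1" and s: "summable (\<lambda>m. a m * of_nat m powr (-s))"
  shows "(\<lambda>m. coeff_shift d a m * of_nat m powr (-s)) sums (of_nat d powr (-s) * dirichlet_sum a s)"
proof -
  define g where "g = (\<lambda>m. coeff_shift d a m * of_nat m powr (-s))"
  define A where "A = (\<lambda>N. \<Sum>m=1..N. a m * of_nat m powr (-s))"
  have A: "A \<longlonglongrightarrow> dirichlet_sum a s"
    unfolding A_def dirichlet_sum_def by (rule sum_atLeast1_tendsto) (use s in \<open>auto simp: summable_sums\<close>)
  have "filterlim (\<lambda>N::nat. N div d) at_top sequentially"
    unfolding filterlim_at_top eventually_sequentially
  proof
    fix Z
    have "Z \<le> N div d" if "N \<ge> Z * d" for N
      using that d by (simp add: less_eq_div_iff_mult_less_eq)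
    thus "\<exists>M. \<forall>N\<ge>M. Z \<le> N div d" by blast
  qed
  from filterlim_compose[OF A this] have "(\<lambda>N. of_nat d powr (-s) * A (N div d)) \<longlonglongrightarrow> of_nat d powr (-s) * dirichlet_sum a s"
    by (intro tendsto_intros)
  moreover have "of_nat d powr (-s) * A (N div d) = (\<Sum>m<Suc N. g m)" for N
  proof -
    have "(\<Sum>m<Suc N. g m) = (\<Sum>m=1..N. g m)"
      by (rule sum.mono_neutral_right) (auto simp: Suc_le_eq g_def intro: gr0I)
    thus ?thesis unfolding A_def g_def using sum_coeff_shift[OF d, of a s N] by simp
  qed
  ultimately have "(\<lambda>N. \<Sum>m<Suc N. g m) \<longlonglongrightarrow> of_nat d powr (-s) * dirichlet_sum a s" by simp
  hence "(\<lambda>N. \<Sum>m<N. g m) \<longlonglongrightarrow> of_nat d powr (-s) * dirichlet_sum a s" by (rule LIMSEQ_imp_Suc)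
  thus ?thesis by (simp add: sums_def g_def)
qed

section \<open>The multiplicities as powers of y times a weight close to 1\<close>

lemma prod_reflect:
  fixes f :: "nat \<Rightarrow> real"
  assumes "n \<ge> 2"
  shows "(\<Prod>j=1..n-2. f (n - 1 - j)) = (\<Prod>j=1..n-2. f j)"
  by (rule prod.reindex_bij_witness[of _ "\<lambda>j. n - 1 - j" "\<lambda>j. n - 1 - j"]) auto

text \<open>In terms of y = 2k + n - 1 the factor k + j of the multiplicity is (y +
  \<open>shift_root n j\<close>)/2. The reflection j -> n - 1 - j changes the sign.\<close>

definition shift_root :: "nat \<Rightarrow> nat \<Rightarrow> real" where
  "shift_root n j = 2 * real j - (real n - 1)"

text \<open>
  With \<open>y = 2 k + n - 1\<close> the multiplicity is \<open>y ^ (n - 1) / (2 ^ (n - 2) * fact (n - 1))\<close> times the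
  following weight.
\<close>

definition sphere_weight :: "nat \<Rightarrow> nat \<Rightarrow> real" where
  "sphere_weight n y = (if y \<ge> n + 1 then (\<Prod>j=1..n-2. 1 + shift_root n j / real y) else 0)"

lemma shift_root_bound:
  assumes "n \<ge> 2" "j \<in> {1..n-2}" "y \<ge> n + 1"
  shows "\<bar>shift_root n j / real y\<bar> < 1"
proof -
  have "real j \<ge> 1" "real j \<le> real n - 2" "real y \<ge> real n + 1" using assms by (auto simp: of_nat_diff)
  hence "\<bar>shift_root n j\<bar> < real y" unfolding shift_root_def by (simp add: abs_less_iff)
  thus ?thesis using assms by (simp add: abs_divide)
qed

text \<open>The reflection pairs 1 + u with 1 - u, so the square of the weight W is the product of
  the 1 - u^2 and terms of order 1/y cancel. As W lies in [0, 1], 1 - W \<le> 1 - W^2, which is at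
  most the sum of the u^2. Hence the coefficients of V are nonnegative.\<close>

lemma
  assumes n: "n \<ge> 2"
  shows sphere_weight_nonneg: "sphere_weight n y \<ge> 0"
    and sphere_weight_le_1: "sphere_weight n y \<le> 1"
    and sphere_weight_ge: "y \<ge> n + 1 \<Longrightarrow> 1 - sphere_weight n y \<le> (\<Sum>j=1..n-2. (shift_root n j)\<^sup>2) / (real y)\<^sup>2"
proof -
  have *: "sphere_weight n y \<ge> 0 \<and> sphere_weight n y \<le> 1 \<and> 1 - sphere_weight n y \<le> (\<Sum>j=1..n-2. (shift_root n j)\<^sup>2) / (real y)\<^sup>2"
    if y: "y \<ge> n + 1"
  proof -
    let ?u = "\<lambda>j. shift_root n j / real y"
    have b: "\<bar>?u j\<bar> < 1" if "j \<in> {1..n-2}" for j using shift_root_bound[OF n that y] .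
    have W: "sphere_weight n y = (\<Prod>j=1..n-2. 1 + ?u j)" using y by (simp add: sphere_weight_def)
    have W0: "sphere_weight n y \<ge> 0" unfolding W
    proof (intro prod_nonneg)
      fix j assume "j \<in> {1..n-2}"
      thus "0 \<le> 1 + ?u j" using b[of j] by linarith
    qed
    have sq: "(sphere_weight n y)\<^sup>2 = (\<Prod>j=1..n-2. 1 - (?u j)\<^sup>2)"
    proof -
      have "(\<Prod>j=1..n-2. 1 + ?u j) = (\<Prod>j=1..n-2. 1 + ?u (n - 1 - j))"
        using prod_reflect[OF n, of "\<lambda>j. 1 + ?u j"] by simp
      also have "\<dots> = (\<Prod>j=1..n-2. 1 - ?u j)"
      proof (rule prod.cong[OF refl])
        fix j assume "j \<in> {1..n-2}"
        hence "real (n - 1 - j) = real n - 1 - real j" by (auto simp: of_nat_diff)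
        hence "shift_root n (n - 1 - j) = - shift_root n j" unfolding shift_root_def by linarith
        thus "1 + ?u (n - 1 - j) = 1 - ?u j" by simp
      qed
      finally have "(sphere_weight n y)\<^sup>2 = (\<Prod>j=1..n-2. 1 + ?u j) * (\<Prod>j=1..n-2. 1 - ?u j)"
        unfolding W power2_eq_square by simp
      also have "\<dots> = (\<Prod>j=1..n-2. 1 - (?u j)\<^sup>2)"
        unfolding prod.distrib[symmetric] by (intro prod.cong refl) (simp add: power2_eq_square algebra_simps)
      finally show ?thesis .
    qed
    have u2: "0 \<le> (?u j)\<^sup>2" "(?u j)\<^sup>2 \<le> 1" if "j \<in> {1..n-2}" for j
      using b[OF that] by (auto simp: abs_square_le_1)
    have "(sphere_weight n y)\<^sup>2 \<le> 1" unfolding sq by (intro prod_le_1) (use u2 in auto)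
    hence W1: "sphere_weight n y \<le> 1" using W0 by (simp add: abs_square_le_1)
    have "1 - (\<Sum>j=1..n-2. (?u j)\<^sup>2) \<le> (sphere_weight n y)\<^sup>2"
      unfolding sq by (rule Weierstrass_prod_ineq) (use u2 in auto)
    also have "\<dots> \<le> sphere_weight n y"
      using W0 W1 by (simp add: power2_eq_square mult_left_le_one_le)
    finally have "1 - sphere_weight n y \<le> (\<Sum>j=1..n-2. (?u j)\<^sup>2)" by linarith
    also have "\<dots> = (\<Sum>j=1..n-2. (shift_root n j)\<^sup>2) / (real y)\<^sup>2"
      by (simp add: power_divide sum_divide_distrib)
    finally show ?thesis using W0 W1 by simp
  qed
  show "sphere_weight n y \<ge> 0" "sphere_weight n y \<le> 1"
    using * by (cases "y \<ge> n + 1"; simp add: sphere_weight_def)+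
  show "y \<ge> n + 1 \<Longrightarrow> 1 - sphere_weight n y \<le> (\<Sum>j=1..n-2. (shift_root n j)\<^sup>2) / (real y)\<^sup>2"
    using * by simp
qed

definition weight_poly :: "nat \<Rightarrow> real poly" where
  "weight_poly n = (\<Prod>j=1..n-2. [:shift_root n j, 1:])"

lemma degree_weight_poly: "degree (weight_poly n) = n - 2" and lead_coeff_weight_poly: "coeff (weight_poly n) (n - 2) = 1"
proof -
  have d: "degree (weight_poly n) = (\<Sum>j=1..n-2. degree [:shift_root n j, 1:])"
    unfolding weight_poly_def by (rule degree_prod_eq_sum_degree) auto
  thus 1: "degree (weight_poly n) = n - 2" by simp
  have "lead_coeff (weight_poly n) = (\<Prod>j=1..n-2. lead_coeff [:shift_root n j, 1:])"
    unfolding weight_poly_def by (rule lead_coeff_prod)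
  thus "coeff (weight_poly n) (n - 2) = 1" unfolding 1 by simp
qed

text \<open>Each descending power of y shifts the argument of a zeta-function; only the top term i =
  n - 2, with coefficient 1, carries no shift.\<close>

lemma sphere_weight_eq_poly:
  assumes "y \<ge> n + 1"
  shows "sphere_weight n y = (\<Sum>i\<le>n-2. coeff (weight_poly n) i * real y powr (-(real (n - 2) - real i)))"
proof -
  have y: "real y > 0" using assms by simp
  have "sphere_weight n y = (\<Prod>j=1..n-2. poly [:shift_root n j, 1:] (real y) / real y)"
    using assms y by (auto simp: sphere_weight_def field_simps intro!: prod.cong)
  also have "\<dots> = poly (weight_poly n) (real y) / real y ^ (n - 2)"
    by (simp add: weight_poly_def poly_prod prod_dividef)
  also have "poly (weight_poly n) (real y) = (\<Sum>i\<le>n-2. coeff (weight_poly n) i * real y ^ i)"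
    unfolding poly_altdef degree_weight_poly ..
  also have "\<dots> / real y ^ (n - 2) = (\<Sum>i\<le>n-2. coeff (weight_poly n) i * real y powr (-(real (n - 2) - real i)))"
    unfolding sum_divide_distrib
  proof (rule sum.cong[OF refl])
    fix i assume "i \<in> {..n-2}"
    have "real y powr (-(real (n - 2) - real i)) = real y powr (real i - real (n - 2))" by simp
    also have "\<dots> = real y powr real i / real y powr real (n - 2)" by (rule powr_diff)
    also have "\<dots> = real y ^ i / real y ^ (n - 2)" using y by (simp add: powr_realpow)
    finally show "coeff (weight_poly n) i * real y ^ i / real y ^ (n - 2) = coeff (weight_poly n) i * real y powr (-(real (n - 2) - real i))"
      by simp
  qed
  finally show ?thesis .
qed

definition odd_part :: "nat \<Rightarrow> nat" where
  "odd_part m = m div 2 ^ multiplicity 2 m"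

lemma odd_part_double: "odd_part (2 * m) = odd_part m"
proof (cases "m = 0")
  case False
  hence "multiplicity 2 (2 * m) = Suc (multiplicity 2 m)"
    by (simp add: multiplicity_times_same)
  thus ?thesis by (simp add: odd_part_def)
qed simp

lemma odd_part_odd: "odd m \<Longrightarrow> odd_part m = m"
  by (simp add: odd_part_def not_dvd_imp_multiplicity_0)

text \<open>
  The numbers \<open>y = 2 k + n - 1\<close> have the parity opposite to \<open>n\<close>. For odd \<open>n\<close> they are the \<open>2 * m\<close>. For
  even \<open>n\<close> they are odd, and extending the weight through the odd part makes the restriction to odd \<open>y\<close>
  amount to the factor \<open>1 - 2 powr (-w)\<close>.
\<close>

definition defect :: "nat \<Rightarrow> nat \<Rightarrow> real" where
  "defect n m = 1 - sphere_weight n (if odd n then 2 * m else odd_part m)"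

lemma defect_bounds:
  assumes "n \<ge> 2"
  shows "0 \<le> defect n m" "defect n m \<le> 1"
  using sphere_weight_nonneg[OF assms] sphere_weight_le_1[OF assms] by (simp_all add: defect_def)

lemma summable_weight_defect:
  assumes n: "n \<ge> 2" and d: "d \<ge> 1"
  shows "summable (\<lambda>m. (1 - sphere_weight n (d * m)) * real m powr (-(1/2)))"
proof (rule summable_comparison_test'[where N = "n + 1"])
  define C where "C = (\<Sum>j=1..n-2. (shift_root n j)\<^sup>2)"
  have C: "C \<ge> 0" unfolding C_def by (intro sum_nonneg) auto
  show "summable (\<lambda>m. C * real m powr (-2))" by (intro summable_mult) (simp add: summable_real_powr_iff)
  fix m assume m: "m \<ge> n + 1"
  have dm: "d * m \<ge> m" using d by simp
  have "1 - sphere_weight n (d * m) \<le> C / (real (d * m))\<^sup>2"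
    unfolding C_def using m dm by (intro sphere_weight_ge n) linarith
  also have "\<dots> \<le> C / (real m)\<^sup>2"
    using m C by (intro divide_left_mono power_mono mult_pos_pos) (use d in \<open>auto simp: mult_le_cancel_right1\<close>)
  also have "\<dots> = C * real m powr (-2)" using m by (simp add: powr_minus divide_inverse powr_realpow[of _ 2, simplified])
  finally have 1: "1 - sphere_weight n (d * m) \<le> C * real m powr (-2)" .
  have "(1 - sphere_weight n (d * m)) * real m powr (-(1/2)) \<le> (C * real m powr (-2)) * 1"
    using 1 m sphere_weight_le_1[OF n, of "d * m"] powr_mono[of "-(1/2)" 0 "real m"] by (intro mult_mono) auto
  thus "norm ((1 - sphere_weight n (d * m)) * real m powr (-(1/2))) \<le> C * real m powr (-2)"
    using sphere_weight_le_1[OF n, of "d * m"] by (simp add: abs_mult)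
qed

text \<open>For even n the defect takes the same value at m and 2m, so the even m contribute at most
  q = 2^(-1/2) times the whole partial sum, and q < 1; the odd m are bounded by the convergent
  series with terms 1 - \<open>sphere_weight n m\<close>.\<close>

lemma summable_defect:
  assumes n: "n \<ge> 2"
  shows "summable (\<lambda>m. defect n m * real m powr (-(1/2)))"
proof (cases "odd n")
  case True
  thus ?thesis using summable_weight_defect[OF n, of 2] by (simp add: defect_def)
next
  case False
  let ?t = "\<lambda>m. defect n m * real m powr (-(1/2))"
  let ?w = "\<lambda>m. (1 - sphere_weight n m) * real m powr (-(1/2))"
  have sw: "summable ?w" using summable_weight_defect[OF n, of 1] by simp
  have t0: "?t m \<ge> 0" for m using defect_bounds(1)[OF n] by simp
  define q where "q = (2::real) powr (-(1/2))"
  have q: "0 < q" "q < 1" using powr_less_mono[of "-(1/2)" 0 2] by (auto simp: q_def)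
  have bound: "(\<Sum>m\<le>N. ?t m) \<le> (\<Sum>m. ?w m) / (1 - q)" for N
  proof -
    let ?D = "{m\<in>{1..N}. even m}"
    have "(\<Sum>m\<le>N. ?t m) = (\<Sum>m\<in>{1..N}. ?t m)"
      by (rule sum.mono_neutral_right) (auto simp: Suc_le_eq intro: gr0I)
    also have "{1..N} = {m\<in>{1..N}. odd m} \<union> ?D" by auto
    also have "(\<Sum>m\<in>\<dots>. ?t m) = (\<Sum>m\<in>{m\<in>{1..N}. odd m}. ?t m) + (\<Sum>m\<in>?D. ?t m)"
      by (rule sum.union_disjoint) auto
    also have "(\<Sum>m\<in>{m\<in>{1..N}. odd m}. ?t m) = (\<Sum>m\<in>{m\<in>{1..N}. odd m}. ?w m)"
      using False by (intro sum.cong refl) (auto simp: defect_def odd_part_odd)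
    also have "\<dots> \<le> (\<Sum>m. ?w m)"
      using sphere_weight_le_1[OF n] by (intro sum_le_suminf sw) auto
    also have "(\<Sum>m\<in>?D. ?t m) = (\<Sum>m\<in>(\<lambda>m. m div 2) ` ?D. q * ?t m)"
    proof (subst sum.reindex)
      show "inj_on (\<lambda>m. m div 2) ?D" by (auto simp: inj_on_def elim!: evenE)
      show "(\<Sum>m\<in>?D. ?t m) = (\<Sum>m\<in>?D. ((\<lambda>m. q * ?t m) \<circ> (\<lambda>m. m div 2)) m)"
      proof (rule sum.cong[OF refl])
        fix m assume "m \<in> ?D"
        then obtain k where k: "m = 2 * k" by (auto elim!: evenE)
        have "defect n m = defect n k" using False k by (simp add: defect_def odd_part_double)
        moreover have "real m powr (-(1/2)) = q * real k powr (-(1/2))" unfolding k q_def by (simp add: powr_mult)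
        ultimately show "?t m = ((\<lambda>m. q * ?t m) \<circ> (\<lambda>m. m div 2)) m" using k by simp
      qed
    qed
    also have "\<dots> \<le> (\<Sum>m\<in>{..N}. q * ?t m)"
      using t0 q by (intro sum_mono2) auto
    also have "\<dots> = q * (\<Sum>m\<le>N. ?t m)" by (simp add: sum_distrib_left)
    finally have "(\<Sum>m\<le>N. ?t m) * (1 - q) \<le> (\<Sum>m. ?w m)" by (simp add: algebra_simps)
    thus ?thesis using q by (simp add: pos_le_divide_eq)
  qed
  show ?thesis by (rule bounded_imp_summable[OF t0 bound])
qed

lemma zeta_minus_series_defect:
  assumes n: "n \<ge> 2"
  shows "zeta_minus_series (defect n)"
proof
  show "0 \<le> defect n m" for m by (rule defect_bounds[OF n])
  \<comment> \<open>The index is y = 2 for odd n and y = 1 for even n, in both cases below n + 1,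
    where the weight is 0.\<close>
  show "1 \<le> defect n 1"
    using n by (cases "odd n") (auto simp: defect_def sphere_weight_def odd_part_odd)
  show "summable (\<lambda>m. defect n m * real m powr (-(1/2)))" by (rule summable_defect[OF n])
qed

section \<open>The spectral sum as a combination of shifted zeta-functions\<close>

definition parity_coeff :: "nat \<Rightarrow> (nat \<Rightarrow> complex) \<Rightarrow> nat \<Rightarrow> complex" where
  "parity_coeff n a y = (if odd n then coeff_shift 2 a y else a y - coeff_shift 2 a y)"

definition parity_factor :: "nat \<Rightarrow> complex \<Rightarrow> complex" where
  "parity_factor n s = (if odd n then 2 powr (-s) else 1 - 2 powr (-s))"

lemma sums_parity_coeff:
  assumes "summable (\<lambda>m. a m * of_nat m powr (-s))"
  shows "(\<lambda>y. parity_coeff n a y * of_nat y powr (-s)) sums (parity_factor n s * dirichlet_sum a s)"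
proof -
  have 1: "(\<lambda>m. coeff_shift 2 a m * of_nat m powr (-s)) sums (of_nat 2 powr (-s) * dirichlet_sum a s)"
    by (rule sums_coeff_shift[OF _ assms]) simp
  have 2: "(\<lambda>m. a m * of_nat m powr (-s)) sums dirichlet_sum a s"
    unfolding dirichlet_sum_def using assms by (rule summable_sums)
  show ?thesis
    using 1 sums_diff[OF 2 1] by (simp add: parity_coeff_def parity_factor_def left_diff_distrib)
qed

lemma parity_coeff_defect:
  "parity_coeff n (\<lambda>m. of_real (defect n m)) y = (if odd (y + n) then of_real (1 - sphere_weight n y) else 0)"
  "parity_coeff n (\<lambda>m. of_real (1 - defect n m)) y = (if odd (y + n) then of_real (sphere_weight n y) else 0)"
proof -
  have "defect n y = 1 - sphere_weight n y" if "even n" "odd y"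
    using that by (simp add: defect_def odd_part_odd)
  moreover have "defect n y = defect n (y div 2)" if "even n" "even y"
    using that by (auto simp: defect_def odd_part_double elim!: evenE)
  moreover have "defect n (y div 2) = 1 - sphere_weight n y" if "odd n" "even y"
    using that by (simp add: defect_def)
  ultimately show "parity_coeff n (\<lambda>m. of_real (defect n m)) y = (if odd (y + n) then of_real (1 - sphere_weight n y) else 0)"
    and "parity_coeff n (\<lambda>m. of_real (1 - defect n m)) y = (if odd (y + n) then of_real (sphere_weight n y) else 0)"
    by (auto simp: parity_coeff_def coeff_shift_def)
qed

lemma parity_coeff_one: "parity_coeff n (\<lambda>_. 1) y = (if odd (y + n) then 1 else 0)"
  by (auto simp: parity_coeff_def coeff_shift_def)

definition eta_factor :: "complex \<Rightarrow> complex" where "eta_factor z = 1 - 2 * 2 powr (-z)"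

lemma eta_factor_nonzero:
  assumes "Re z \<noteq> 1" shows "eta_factor z \<noteq> 0"
proof
  assume "eta_factor z = 0"
  hence "norm (2 * (2::complex) powr (-z)) = 1" by (simp add: eta_factor_def)
  hence "2 * 2 powr (- Re z) = (1::real)"
    using norm_powr_real_powr[of 2 "-z"] by (simp add: norm_mult)
  hence "2 powr (1 - Re z) = (2::real) powr 0" using powr_add[of 2 1 "- Re z"] by simp
  thus False using assms by (subst (asm) powr_inj) auto
qed

definition low_sum :: "nat \<Rightarrow> complex \<Rightarrow> complex" where
  "low_sum n z = (\<Sum>y\<in>{y\<in>{1..n}. odd (y + n)}. of_nat y powr (-z))"

text \<open>Continuation of the sum of y^(-z) over y \<ge> n + 1 with y + n odd: the full parity
  class comes from zeta, written as \<eta> over its factor, and the finitely many small y are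
  removed.\<close>

definition parity_zeta :: "nat \<Rightarrow> complex \<Rightarrow> complex" where
  "parity_zeta n z = parity_factor n z * (eta z / eta_factor z) - low_sum n z"

lemma sums_low_sum:
  "(\<lambda>y. (if odd (y + n) \<and> y \<le> n then 1 else 0) * of_nat y powr (-z)) sums low_sum n z"
proof -
  have "(\<lambda>y. if y \<in> {y\<in>{1..n}. odd (y + n)} then of_nat y powr (-z) else 0) sums low_sum n z"
    unfolding low_sum_def by (rule sums_If_finite_set) auto
  moreover have "(if y \<in> {y\<in>{1..n}. odd (y + n)} then of_nat y powr (-z) else 0) =
      (if odd (y + n) \<and> y \<le> n then 1 else 0) * of_nat y powr (-z)" for y
    by (cases "y = 0") auto
  ultimately show ?thesis by simp
qed

lemma sums_parity_zeta:
  assumes "Re z > 1"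
  shows "(\<lambda>y. (if odd (y + n) \<and> y \<ge> n + 1 then 1 else 0) * of_nat y powr (-z)) sums parity_zeta n z"
proof -
  have "eta z / eta_factor z = zeta_series z"
    using eta_eq_zeta_series[OF assms] eta_factor_nonzero[of z] assms by (simp add: eta_factor_def)
  moreover have "(\<lambda>y. parity_coeff n (\<lambda>_. 1) y * of_nat y powr (-z)) sums (parity_factor n z * zeta_series z)"
    by (rule sums_parity_coeff[OF summable_zeta_series[OF assms]])
  ultimately have "(\<lambda>y. parity_coeff n (\<lambda>_. 1) y * of_nat y powr (-z) - (if odd (y + n) \<and> y \<le> n then 1 else 0) * of_nat y powr (-z))
     sums parity_zeta n z"
    unfolding parity_zeta_def by (simp only:) (intro sums_diff sums_low_sum)
  moreover have "parity_coeff n (\<lambda>_. 1) y * of_nat y powr (-z) - (if odd (y + n) \<and> y \<le> n then 1 else 0) * of_nat y powr (-z) =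
     (if odd (y + n) \<and> y \<ge> n + 1 then 1 else 0) * of_nat y powr (-z)" for y
    by (auto simp: parity_coeff_one)
  ultimately show ?thesis by simp
qed

text \<open>The sum of \<open>sphere_weight n y\<close> times y^(-w) over the admissible y, expanded
  in powers of y and continued term by term.\<close>

definition sphere_zeta_aux :: "nat \<Rightarrow> complex \<Rightarrow> complex" where
  "sphere_zeta_aux n w = (\<Sum>i\<le>n-2. of_real (coeff (weight_poly n) i) * parity_zeta n (w + of_real (real (n - 2) - real i)))"

text \<open>Only the top term i = n - 2 needs a continuation. The others have argument of real part
  above 3/2, converge absolutely, and have the coefficient W - 1 at y \<ge> n + 1 and 0 at y \<le>
  n. Since 1 - W is 1 for y \<le> n, they add up to the low sum minus the parity factor times V, and
  the low sums cancel.\<close>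

lemma sphere_zeta_aux_eq_xi:
  assumes n: "n \<ge> 2" and w: "Re w > 1/2" "eta_factor w \<noteq> 0"
  shows "sphere_zeta_aux n w = parity_factor n w * zeta_minus_series.xi (defect n) w / eta_factor w"
proof -
  interpret zeta_minus_series "defect n" by (rule zeta_minus_series_defect[OF n])
  let ?R = "\<lambda>i. of_real (coeff (weight_poly n) i) :: complex"
  let ?k = "\<lambda>i. real (n - 2) - real i"
  let ?r = "\<lambda>y. if odd (y + n) \<and> y \<ge> n + 1 then 1 else 0 :: complex"
  have "(\<lambda>y. \<Sum>i<n-2. ?R i * (?r y * of_nat y powr (-(w + of_real (?k i))))) sums
        (\<Sum>i<n-2. ?R i * parity_zeta n (w + of_real (?k i)))"
  proof (intro sums_sum sums_mult sums_parity_zeta)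
    fix i assume "i \<in> {..<n-2}"
    hence "i + 1 \<le> n - 2" by simp
    hence "real i + 1 \<le> real (n - 2)" by (simp only: of_nat_le_iff flip: of_nat_Suc Suc_eq_plus1)
    thus "1 < Re (w + of_real (?k i))" using w by simp
  qed
  moreover have "(\<Sum>i<n-2. ?R i * (?r y * of_nat y powr (-(w + of_real (?k i))))) =
      (if odd (y + n) \<and> y \<le> n then 1 else 0) * of_nat y powr (-w) -
      (if odd (y + n) then of_real (1 - sphere_weight n y) else 0) * of_nat y powr (-w)" for y
  proof (cases "odd (y + n) \<and> y \<ge> n + 1")
    case True
    have "(\<Sum>i<n-2. ?R i * (?r y * of_nat y powr (-(w + of_real (?k i))))) =
       (\<Sum>i<n-2. of_real (coeff (weight_poly n) i * real y powr (- ?k i)) * of_nat y powr (-w))"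
    proof (rule sum.cong[OF refl])
      fix i
      have "(of_nat y :: complex) powr (-(w + of_real (?k i))) = of_nat y powr (- of_real (?k i)) * of_nat y powr (-w)"
        by (subst powr_add [symmetric]) (simp add: algebra_simps)
      also have "(of_nat y :: complex) powr (- of_real (?k i)) = of_real (real y powr (- ?k i))"
        using powr_of_real[of "real y" "- ?k i"] by simp
      finally show "?R i * (?r y * of_nat y powr (-(w + of_real (?k i)))) =
          of_real (coeff (weight_poly n) i * real y powr (- ?k i)) * of_nat y powr (-w)"
        using True by simp
    qed
    also have "\<dots> = of_real (\<Sum>i<n-2. coeff (weight_poly n) i * real y powr (- ?k i)) * of_nat y powr (-w)"
      by (simp only: sum_distrib_right of_real_sum)
    also have "(\<Sum>i<n-2. coeff (weight_poly n) i * real y powr (- ?k i)) = sphere_weight n y - 1"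
    proof -
      have "{..n-2} = insert (n-2) {..<n-2}" by auto
      moreover have "real y > 0" using True by auto
      ultimately show ?thesis using sphere_weight_eq_poly[of n y] True lead_coeff_weight_poly[of n] by simp
    qed
    finally show ?thesis using True by (simp add: left_diff_distrib)
  next
    case False
    thus ?thesis by (auto simp: sphere_weight_def)
  qed
  ultimately have A: "(\<lambda>y. (if odd (y + n) \<and> y \<le> n then 1 else 0) * of_nat y powr (-w) -
      (if odd (y + n) then of_real (1 - sphere_weight n y) else 0) * of_nat y powr (-w)) sums
        (\<Sum>i<n-2. ?R i * parity_zeta n (w + of_real (?k i)))" by simp
  have sV: "summable (\<lambda>m. of_real (defect n m) * of_nat m powr (-w))"
    by (rule summable_dirichlet[OF summ_v norm_v]) (use w in auto)
  have "(\<lambda>y. (if odd (y + n) then of_real (1 - sphere_weight n y) else 0) * of_nat y powr (-w)) sums (parity_factor n w * V w)"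
    using sums_parity_coeff[OF sV, of n] unfolding parity_coeff_defect V_def .
  from sums_diff[OF sums_low_sum this] A
  have eq: "(\<Sum>i<n-2. ?R i * parity_zeta n (w + of_real (?k i))) = low_sum n w - parity_factor n w * V w"
    using sums_unique2 by blast
  have "{..n-2} = insert (n-2) {..<n-2}" by auto
  hence "sphere_zeta_aux n w = parity_zeta n w + (\<Sum>i<n-2. ?R i * parity_zeta n (w + of_real (?k i)))"
    unfolding sphere_zeta_aux_def using lead_coeff_weight_poly[of n] by simp
  also have "\<dots> = parity_factor n w * (eta w / eta_factor w - V w)"
    unfolding eq unfolding parity_zeta_def by (simp add: algebra_simps)
  also have "\<dots> = parity_factor n w * xi w / eta_factor w"
    using w(2) unfolding xi_def eta_factor_def[symmetric] by (simp add: field_simps)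
  finally show ?thesis .
qed

lemma sphere_mult_eq_weight:
  assumes n: "n \<ge> 2" and k: "k \<ge> 1"
  defines "y \<equiv> 2 * k + n - 1"
  shows "sphere_mult n k = 2 / fact (n - 1) * (real y / 2) ^ (n - 1) * sphere_weight n y"
proof -
  have y: "y \<ge> n + 1" "real y > 0" "real y = 2 * real k + real n - 1"
    using n k by (auto simp: y_def of_nat_diff)
  have fact: "fact (k + m) = (fact k :: real) * (\<Prod>j=1..m. real k + real j)" for m
    by (induction m) (auto simp: algebra_simps)
  have "sphere_weight n y = (\<Prod>j=1..n-2. 2 * (real k + real j) / real y)"
    unfolding sphere_weight_def using y by (auto simp: shift_root_def field_simps intro!: prod.cong)
  also have "\<dots> = 2 ^ (n - 2) * (\<Prod>j=1..n-2. real k + real j) / real y ^ (n - 2)"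
    by (simp only: prod_dividef prod.distrib) simp
  finally have W: "sphere_weight n y = 2 ^ (n - 2) * (\<Prod>j=1..n-2. real k + real j) / real y ^ (n - 2)" .
  have n1: "n - 1 = Suc (n - 2)" using n by simp
  have "sphere_mult n k = real y * (\<Prod>j=1..n-2. real k + real j) / fact (n - 1)"
    unfolding sphere_mult_def y_def[symmetric] using fact[of "n - 2"] n by simp
  also have "\<dots> = 2 / fact (n - 1) * (real y / 2) ^ (n - 1) * sphere_weight n y"
    unfolding W n1 power_Suc using y(2) by (simp add: power_divide field_simps del: fact_Suc)
  finally show ?thesis .
qed

text \<open>The eigenvalue is (y/2)^2, so its power -s is (y/2)^(-w - (n - 1)), and the factor
  (y/2)^(n - 1) of the multiplicity cancels. This is the origin of the substitution w.\<close>

lemma sphere_term_eq: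
  fixes s :: complex
  assumes n: "n \<ge> 2" and k: "k \<ge> 1"
  defines "y \<equiv> 2 * k + n - 1" and "w \<equiv> 2 * s - of_real (real n - 1)"
  shows "of_real (sphere_mult n k) * of_real (sphere_eigenvalue n k) powr (-s) =
     (2 / fact (n - 1) * 2 powr w) * (of_real (sphere_weight n y) * of_nat y powr (-w))"
proof -
  have y: "real y > 0" "real y = 2 * real k + real n - 1"
    using n k by (auto simp: y_def of_nat_diff)
  define a where "a = real y / 2"
  have a: "a > 0" using y by (simp add: a_def)
  have eig: "sphere_eigenvalue n k = a\<^sup>2"
    unfolding sphere_eigenvalue_def a_def y(2) by (simp add: power2_eq_square field_simps)
  have "(of_real (a\<^sup>2) :: complex) powr (-s) = exp (-s * of_real (2 * ln a))"
    using a by (simp add: powr_def Ln_of_real ln_realpow flip: of_real_power)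
  also have "-s * of_real (2 * ln a) = -w * of_real (ln a) - of_real (real (n - 1) * ln a)"
    using n by (simp add: w_def of_nat_diff algebra_simps)
  also have "exp \<dots> = exp (-w * of_real (ln a)) / of_real (exp (real (n - 1) * ln a))"
    by (simp only: exp_diff exp_of_real)
  also have "exp (real (n - 1) * ln a) = a ^ (n - 1)"
    using a by (simp add: exp_of_nat_mult)
  also have "exp (-w * of_real (ln a)) = 2 powr w * of_nat y powr (-w)"
  proof -
    have ln_y: "ln (real y) = ln a + ln 2" using y by (simp add: a_def ln_div)
    have two: "(2::complex) powr w = exp (w * of_real (ln 2))"
      using Ln_of_real[of 2] by (simp add: powr_def)
    have "(of_nat y :: complex) powr (-w) = exp (-w * of_real (ln (real y)))"
      using y by (simp add: powr_def Ln_of_nat)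
    thus ?thesis unfolding two ln_y by (simp add: algebra_simps flip: exp_add)
  qed
  finally have pw: "(of_real (a\<^sup>2) :: complex) powr (-s) = 2 powr w * of_nat y powr (-w) / of_real (a ^ (n - 1))" .
  have "sphere_mult n k = 2 / fact (n - 1) * a ^ (n - 1) * sphere_weight n y"
    using sphere_mult_eq_weight[OF n k] by (simp add: y_def a_def)
  hence mult: "(of_real (sphere_mult n k) :: complex) = 2 / fact (n - 1) * of_real (a ^ (n - 1)) * of_real (sphere_weight n y)"
    by (simp add: mult_ac)
  show ?thesis unfolding eig pw mult using a by simp
qed

lemma sphere_zeta_series_eq:
  assumes n: "n \<ge> 2" and s: "Re s > real n / 2"
  defines "w \<equiv> 2 * s - of_real (real n - 1)"
  shows "sphere_zeta_series n s = 2 / fact (n - 1) * 2 powr w * sphere_zeta_aux n w"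
proof -
  interpret zeta_minus_series "defect n" by (rule zeta_minus_series_defect[OF n])
  have w: "Re w > 1" using s by (simp add: w_def)
  define q where "q = (\<lambda>y. (if odd (y + n) then of_real (sphere_weight n y) else 0) * (of_nat y :: complex) powr (-w))"
  \<comment> \<open>The map k -> 2k + n - 1 is a bijection from k \<ge> 1 to the y \<ge> n + 1 with
    y + n odd; for smaller y the weight is 0, so the sum extends to all y.\<close>
  define h where "h = (\<lambda>k. 2 * k + n - 1)"
  let ?K = "2 / fact (n - 1) * 2 powr w :: complex"
  have nd: "norm (of_real (1 - defect n m) :: complex) \<le> 1" for m
    using defect_bounds[OF n, of m] unfolding norm_of_real by simp
  have "summable (\<lambda>m. of_real (1 - defect n m) * of_nat m powr (-w))"
    by (rule summable_dirichlet[where v = "\<lambda>_. 1" and c = "Re w"]) (use w nd in \<open>auto simp: summable_real_powr_iff\<close>)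
  from sums_parity_coeff[OF this, of n]
  have q_sums: "q sums (parity_factor n w * dirichlet_sum (\<lambda>m. of_real (1 - defect n m)) w)"
    unfolding parity_coeff_defect q_def .
  have q_norm: "summable (\<lambda>y. norm (q y))"
    unfolding q_def
    by (rule summable_norm_dirichlet[where v = "\<lambda>_. 1" and c = "Re w"])
       (use w sphere_weight_nonneg[OF n] sphere_weight_le_1[OF n] in \<open>auto simp: summable_real_powr_iff\<close>)
  have D: "eta_factor w \<noteq> 0" using w by (intro eta_factor_nonzero) simp
  have aux: "parity_factor n w * dirichlet_sum (\<lambda>m. of_real (1 - defect n m)) w = sphere_zeta_aux n w"
    using sphere_zeta_aux_eq_xi[OF n _ D] w xi_eq_dirichlet[OF w] D by (simp add: eta_factor_def)
  have inj: "inj_on h {1..}" by (auto simp: inj_on_def h_def)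
  have img: "h ` {1..} = {y. odd (y + n) \<and> y \<ge> n + 1}"
  proof safe
    fix y assume y: "odd (y + n)" "y \<ge> n + 1"
    define k where "k = (y - (n - 1)) div 2"
    have "even (y - (n - 1))" using y n by (cases n) auto
    hence "2 * k = y - (n - 1)" by (simp add: k_def)
    hence "y = h k" "k \<ge> 1" using y n by (auto simp: h_def)
    thus "y \<in> h ` {1..}" by auto
  qed (use n in \<open>auto simp: h_def\<close>)
  have "sphere_zeta_series n s = (\<Sum>\<^sub>\<infinity>k\<in>{1..}. ?K * (q \<circ> h) k)"
    unfolding sphere_zeta_series_def
  proof (rule infsum_cong)
    fix k :: nat assume k: "k \<in> {1..}"
    have "odd (h k + n)" using k n by (auto simp: h_def)
    thus "of_real (sphere_mult n k) * of_real (sphere_eigenvalue n k) powr (-s) = ?K * (q \<circ> h) k"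
      using sphere_term_eq[OF n, of k s] k by (simp add: q_def h_def w_def)
  qed
  also have "\<dots> = ?K * (\<Sum>\<^sub>\<infinity>k\<in>{1..}. (q \<circ> h) k)" by (rule infsum_cmult_right')
  also have "(\<Sum>\<^sub>\<infinity>k\<in>{1..}. (q \<circ> h) k) = (\<Sum>\<^sub>\<infinity>y\<in>h ` {1..}. q y)" by (rule infsum_reindex[OF inj, symmetric])
  also have "\<dots> = (\<Sum>\<^sub>\<infinity>y\<in>UNIV. q y)"
    unfolding img by (rule infsum_cong_neutral) (auto simp: q_def sphere_weight_def)
  also have "\<dots> = parity_factor n w * dirichlet_sum (\<lambda>m. of_real (1 - defect n m)) w"
    by (rule infsumI[OF norm_summable_imp_has_sum[OF q_norm q_sums]])
  finally show ?thesis unfolding aux .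
qed

section \<open>Meromorphic continuation and transfer of the zeros\<close>

lemma eta_analytic [analytic_intros]:
  assumes "f analytic_on A" shows "(\<lambda>s. eta (f s)) analytic_on A"
  using analytic_on_compose_gen[OF assms, of eta UNIV] eta_holomorphic[of UNIV]
  by (simp add: o_def analytic_on_open)

lemma two_powr_analytic [analytic_intros]:
  assumes "f analytic_on A" shows "(\<lambda>s. 2 powr f s :: complex) analytic_on A"
  unfolding powr_def using assms by (auto intro!: analytic_intros)

lemma of_nat_powr_analytic [analytic_intros]:
  assumes "f analytic_on A" shows "(\<lambda>s. of_nat m powr f s :: complex) analytic_on A"
proof (cases "m = 0")
  case False
  thus ?thesis unfolding powr_def using assms by (auto intro!: analytic_intros)
qed auto

lemma parity_factor_analytic [analytic_intros]:
  assumes "f analytic_on A" shows "(\<lambda>s. parity_factor n (f s)) analytic_on A"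
  unfolding parity_factor_def using assms by (cases "odd n") (auto intro!: analytic_intros)

lemma eta_factor_analytic [analytic_intros]:
  assumes "f analytic_on A" shows "(\<lambda>s. eta_factor (f s)) analytic_on A"
  unfolding eta_factor_def using assms by (auto intro!: analytic_intros)

lemma low_sum_analytic [analytic_intros]:
  assumes "f analytic_on A" shows "(\<lambda>s. low_sum n (f s)) analytic_on A"
  unfolding low_sum_def using assms by (auto intro!: analytic_intros)

definition sphere_zeta_cont :: "nat \<Rightarrow> complex \<Rightarrow> complex" where
  "sphere_zeta_cont n s = 2 / fact (n - 1) * 2 powr (2 * s - of_real (real n - 1)) * sphere_zeta_aux n (2 * s - of_real (real n - 1))"

lemma sphere_zeta_cont_meromorphic: "sphere_zeta_cont n meromorphic_on UNIV"
proof -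
  have "(\<lambda>s. eta (2 * s - c + d) / eta_factor (2 * s - c + d)) meromorphic_on UNIV" for c d
    by (intro meromorphic_on_divide analytic_on_imp_meromorphic_on analytic_intros)
  hence "(\<lambda>s. parity_zeta n (2 * s - c + d)) meromorphic_on UNIV" for c d
    unfolding parity_zeta_def
    by (intro meromorphic_on_diff meromorphic_on_mult analytic_on_imp_meromorphic_on[of "\<lambda>s. parity_factor n (2 * s - c + d)"]
          analytic_on_imp_meromorphic_on[of "\<lambda>s. low_sum n (2 * s - c + d)"] analytic_intros)
  thus ?thesis unfolding sphere_zeta_cont_def[abs_def] sphere_zeta_aux_def
    by (intro meromorphic_on_mult meromorphic_on_sum meromorphic_on_const analytic_on_imp_meromorphic_on[of "\<lambda>s. 2 powr (2 * s - of_real (real n - 1))"] analytic_intros)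
qed

text \<open>Only zeros of \<open>eta_factor\<close> could give poles, and they have real part 1. For
  i < n - 2 the shift moves the real part beyond 3/2, so the excluded line concerns the unshifted
  term.\<close>

lemma sphere_zeta_cont_analytic:
  assumes s: "Re (2 * s - of_real (real n - 1)) > 1/2" "Re (2 * s - of_real (real n - 1)) \<noteq> 1"
  shows "sphere_zeta_cont n analytic_on {s}"
proof -
  let ?w = "\<lambda>s. 2 * s - of_real (real n - 1) :: complex"
  have "(\<lambda>s. parity_zeta n (?w s + of_real (real (n - 2) - real i))) analytic_on {s}" if i: "i \<le> n - 2" for i
  proof -
    have "Re (?w s + of_real (real (n - 2) - real i)) \<noteq> 1"
    proof (cases "i = n - 2")
      case False
      hence "i + 1 \<le> n - 2" using i by simp
      hence "real i + 1 \<le> real (n - 2)" by (simp only: of_nat_le_iff flip: of_nat_Suc Suc_eq_plus1)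
      thus ?thesis using s(1) by simp
    qed (use s in simp)
    hence "eta_factor (?w s + of_real (real (n - 2) - real i)) \<noteq> 0" by (rule eta_factor_nonzero)
    thus ?thesis unfolding parity_zeta_def by (intro analytic_intros) auto
  qed
  thus ?thesis unfolding sphere_zeta_cont_def[abs_def] sphere_zeta_aux_def by (intro analytic_intros) auto
qed

text \<open>\<open>remove_sings\<close> fills removable singularities and puts 0 at poles, which is
  the normalisation of a nicely meromorphic function; where the explicit formula is analytic it
  changes nothing.\<close>

lemma sphere_zeta_eq:
  assumes n: "n \<ge> 2" and s: "Re (2 * s - of_real (real n - 1)) > 1/2" "Re (2 * s - of_real (real n - 1)) \<noteq> 1"
  shows "sphere_zeta n s = sphere_zeta_cont n s"
proof -
  have "is_sphere_zeta n (remove_sings (sphere_zeta_cont n))"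
    unfolding is_sphere_zeta_def
  proof (intro conjI allI impI)
    show "remove_sings (sphere_zeta_cont n) nicely_meromorphic_on UNIV"
      by (rule remove_sings_nicely_meromorphic[OF sphere_zeta_cont_meromorphic])
    fix s assume s: "Re s > real n / 2"
    have "remove_sings (sphere_zeta_cont n) s = sphere_zeta_cont n s"
      by (intro remove_sings_at_analytic sphere_zeta_cont_analytic) (use s in auto)
    also have "\<dots> = sphere_zeta_series n s"
      unfolding sphere_zeta_cont_def by (rule sphere_zeta_series_eq[OF n s, symmetric])
    finally show "remove_sings (sphere_zeta_cont n) s = sphere_zeta_series n s" .
  qed
  hence "sphere_zeta n = remove_sings (sphere_zeta_cont n)" by (rule sphere_zeta_eqI)
  thus ?thesis using remove_sings_at_analytic[OF sphere_zeta_cont_analytic[OF s]] by simp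
qed

text \<open>The factor k collects the constant, 2^w and the quotient of parity factor and eta
  factor. It has no zeros here because 1 - 2^(-w) does not vanish for Re w > 0.\<close>

lemma sphere_zeta_eq_xi:
  assumes n: "n \<ge> 2"
  defines "c \<equiv> of_real (real n - 1) :: complex"
  obtains k where
    "\<And>s. Re (2 * s - c) > 1/2 \<Longrightarrow> Re (2 * s - c) \<noteq> 1 \<Longrightarrow> k s \<noteq> 0 \<and> k analytic_on {s} \<and>
       sphere_zeta n s = k s * zeta_minus_series.xi (defect n) (2 * s - c)"
proof -
  define k where "k = (\<lambda>s. 2 / fact (n - 1) * 2 powr (2 * s - c) * (parity_factor n (2 * s - c) / eta_factor (2 * s - c)))"
  show ?thesis
  proof (rule that[of k])
    fix s assume s: "Re (2 * s - c) > 1/2" "Re (2 * s - c) \<noteq> 1"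
    have D: "eta_factor (2 * s - c) \<noteq> 0" by (rule eta_factor_nonzero[OF s(2)])
    have E: "parity_factor n (2 * s - c) \<noteq> 0"
    proof (cases "odd n")
      case False
      have "(2::complex) powr (-(2 * s - c)) \<noteq> 1"
      proof
        assume "(2::complex) powr (-(2 * s - c)) = 1"
        hence "norm ((2::complex) powr (-(2 * s - c))) = 1" by simp
        hence "2 powr (- Re (2 * s - c)) = (1::real)" using norm_powr_real_powr[of 2 "-(2 * s - c)"] by simp
        moreover have "2 powr (- Re (2 * s - c)) < (2::real) powr 0" using s by (intro powr_less_mono) auto
        ultimately show False by simp
      qed
      thus ?thesis using False by (simp add: parity_factor_def)
    qed (simp add: parity_factor_def)
    have "k s \<noteq> 0" using D E by (simp add: k_def)
    moreover have "k analytic_on {s}"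
      unfolding k_def using D by (intro analytic_intros) auto
    moreover have "sphere_zeta n s = k s * zeta_minus_series.xi (defect n) (2 * s - c)"
      using sphere_zeta_eq[OF n, of s] sphere_zeta_aux_eq_xi[OF n, of "2 * s - c"] s D
      by (simp add: sphere_zeta_cont_def k_def c_def mult_ac)
    ultimately show "k s \<noteq> 0 \<and> k analytic_on {s} \<and> sphere_zeta n s = k s * zeta_minus_series.xi (defect n) (2 * s - c)"
      by blast
  qed
qed

text \<open>A nonvanishing analytic factor and the affine substitution w = 2s - (n - 1) preserve the
  orders of zeros; the product rule for orders applies because \<open>xi\<close> is not identically
  zero.\<close>

lemma zorder_sphere_zeta:
  assumes n: "n \<ge> 2" and s: "Re (2 * s - of_real (real n - 1)) > 1/2" "Re (2 * s - of_real (real n - 1)) < 1"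
  defines "w \<equiv> 2 * s - of_real (real n - 1)"
  shows "sphere_zeta n analytic_on {s}"
    and "sphere_zeta n s = 0 \<longleftrightarrow> zeta_minus_series.xi (defect n) w = 0"
    and "zorder (sphere_zeta n) s = zorder (zeta_minus_series.xi (defect n)) w"
proof -
  interpret zeta_minus_series "defect n" by (rule zeta_minus_series_defect[OF n])
  define c where "c = (of_real (real n - 1) :: complex)"
  define S where "S = {s. Re s > (1/2 + Re c) / 2}"
  define U where "U = {s. Re (2 * s - c) > 1/2 \<and> Re (2 * s - c) < 1}"
  have S: "Re (2 * z - c) > 1/2 \<longleftrightarrow> z \<in> S" for z by (auto simp: S_def field_simps)
  obtain k where k: "\<And>s. Re (2 * s - c) > 1/2 \<Longrightarrow> Re (2 * s - c) \<noteq> 1 \<Longrightarrow> k s \<noteq> 0 \<and> k analytic_on {s} \<and>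
       sphere_zeta n s = k s * xi (2 * s - c)"
    unfolding c_def using sphere_zeta_eq_xi[OF n] by blast
  have kU: "k s \<noteq> 0" "k analytic_on {s}" "sphere_zeta n s = k s * xi (2 * s - c)" if "s \<in> U" for s
    using k[of s] that by (auto simp: U_def)
  have sU: "s \<in> U" using s by (auto simp: U_def c_def)
  have sS: "s \<in> S" using sU S by (auto simp: U_def)
  have "open U" unfolding U_def
    by (intro open_Collect_conj open_Collect_less continuous_intros)
  hence evn: "\<forall>\<^sub>F z in nhds s. z \<in> U" using sU by (rule eventually_nhds_in_open)
  have ev: "\<forall>\<^sub>F z in nhds s. sphere_zeta n z = k z * xi (2 * z - c)"
    using evn by eventually_elim (rule kU(3))
  have g_hol: "(\<lambda>z. xi (2 * z - c)) holomorphic_on S"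
  proof -
    have "(\<lambda>z. 2 * z - c) holomorphic_on S" by (intro holomorphic_intros)
    moreover have "(\<lambda>z. 2 * z - c) ` S \<subseteq> {s. Re s > 1/2}" using S by blast
    ultimately show ?thesis
      using holomorphic_on_compose_gen[OF _ xi_holomorphic, of "\<lambda>z. 2 * z - c" S] by (simp add: o_def)
  qed
  have opS: "open S" "connected S"
    unfolding S_def by (intro open_halfspace_Re_gt convex_connected convex_halfspace_Re_gt)+
  have g_an: "(\<lambda>z. xi (2 * z - c)) analytic_on {s}"
    using g_hol opS sS analytic_at by blast
  have w: "Re w > 1/2" using s by (simp add: w_def)
  have xi_an: "xi analytic_on {w}" using xi_holomorphic xi_halfplane w analytic_at by blast
  have "(\<lambda>z. k z * xi (2 * z - c)) analytic_on {s}" using kU(2)[OF sU] g_an by (rule analytic_on_mult)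
  thus "sphere_zeta n analytic_on {s}" using analytic_at_cong[OF ev refl] by simp
  show "sphere_zeta n s = 0 \<longleftrightarrow> xi w = 0" using kU[OF sU] by (simp add: w_def c_def)
  obtain w0 where w0: "Re w0 > 1/2" "xi w0 \<noteq> 0" using xi_nonzero by blast
  have w0': "2 * ((w0 + c) / 2) - c = w0" by (simp add: field_simps)
  have "\<forall>\<^sub>F z in at s. xi (2 * z - c) \<noteq> 0 \<and> z \<in> S"
    by (rule non_zero_neighbour_alt[OF g_hol opS sS, of "(w0 + c) / 2"]) (use w0 in \<open>simp_all only: w0' not_False_eq_True flip: S\<close>)
  moreover have "\<forall>\<^sub>F z in at s. z \<in> U" using \<open>open U\<close> sU by (rule eventually_at_in_open')
  ultimately have xi_ev: "\<forall>\<^sub>F z in at s. k z * xi (2 * z - c) \<noteq> 0"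
    by eventually_elim (simp add: kU)
  have "zorder (sphere_zeta n) s = zorder (\<lambda>z. k z * xi (2 * z - c)) s"
    using ev by (intro zorder_cong refl) (auto simp: eventually_at_filter elim: eventually_mono)
  also have "\<dots> = zorder k s + zorder (\<lambda>z. xi (2 * z - c)) s"
    by (rule zorder_times_analytic[OF kU(2)[OF sU] g_an xi_ev])
  also have "zorder k s = 0" using kU[OF sU] by (intro zorder_eq_0I) auto
  also have "zorder (\<lambda>z. xi (2 * z - c)) s = zorder (\<lambda>u. xi (u - c)) (2 * s)"
  proof (rule Meromorphic.zorder_scale)
    have "(\<lambda>u. u - c) analytic_on {2 * s}" by (intro analytic_intros)
    from analytic_on_compose_gen[OF this xi_an] have "(\<lambda>u. xi (u - c)) analytic_on {2 * s}"
      by (simp add: o_def w_def c_def)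
    thus "(\<lambda>u. xi (u - c)) meromorphic_on {2 * s}" by (rule analytic_on_imp_meromorphic_on)
  qed simp
  also have "\<dots> = zorder xi w"
    using zorder_shift[of "\<lambda>u. xi (u - c)" "2 * s"] zorder_shift[of xi w] by (simp add: w_def c_def algebra_simps)
  finally show "zorder (sphere_zeta n) s = zorder xi w" by simp
qed

text \<open>The substitution doubles heights, hence 2T. The strip contains no pole, so the exclusion
  of poles in \<open>zeros_in_rect\<close> removes nothing.\<close>

lemma zero_count_sphere_zeta:
  assumes n: "n \<ge> 2" and \<sigma>: "real n / 2 - 1 / 4 < \<sigma>1" "\<sigma>2 < real n / 2"
  shows "zero_count (sphere_zeta n) \<sigma>1 \<sigma>2 T =
    (\<Sum>z\<in>zeta_minus_series.zeros (defect n) (2 * \<sigma>1 - (real n - 1)) (2 * \<sigma>2 - (real n - 1)) (2 * T).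
       zorder (zeta_minus_series.xi (defect n)) z)"
proof -
  interpret zeta_minus_series "defect n" by (rule zeta_minus_series_defect[OF n])
  let ?w = "\<lambda>s. 2 * s - of_real (real n - 1) :: complex"
  let ?Z = "zeros (2 * \<sigma>1 - (real n - 1)) (2 * \<sigma>2 - (real n - 1)) (2 * T)"
  have strip: "Re (?w s) > 1/2" "Re (?w s) < 1" if "\<sigma>1 < Re s" "Re s < \<sigma>2" for s
    using that \<sigma> by (simp_all add: field_simps)
  have np: "\<not> is_pole (sphere_zeta n) s" if "\<sigma>1 < Re s" "Re s < \<sigma>2" for s
    by (intro analytic_at_imp_no_pole zorder_sphere_zeta(1)[OF n] strip that)
  have mem: "s \<in> zeros_in_rect (sphere_zeta n) \<sigma>1 \<sigma>2 T \<longleftrightarrow> ?w s \<in> ?Z" for s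
    using np[of s] zorder_sphere_zeta(2)[OF n strip, of s]
    by (auto simp: zeros_in_rect_def zeros_def)
  show ?thesis unfolding zero_count_def
  proof (rule sum.reindex_bij_witness[of _ "\<lambda>z. (z + of_real (real n - 1)) / 2" ?w])
    fix s assume s: "s \<in> zeros_in_rect (sphere_zeta n) \<sigma>1 \<sigma>2 T"
    thus "?w s \<in> ?Z" by (simp only: mem)
    from s have "\<sigma>1 < Re s" "Re s < \<sigma>2" by (auto simp: zeros_in_rect_def)
    thus "zorder xi (?w s) = zorder (sphere_zeta n) s"
      using zorder_sphere_zeta(3)[OF n strip] by simp
  next
    fix z assume "z \<in> ?Z"
    moreover have "?w ((z + of_real (real n - 1)) / 2) = z" by (simp add: field_simps)
    ultimately show "(z + of_real (real n - 1)) / 2 \<in> zeros_in_rect (sphere_zeta n) \<sigma>1 \<sigma>2 T"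
      by (simp only: mem)
  qed (simp_all add: field_simps)
qed

theorem theorem3p4:
  fixes n :: nat and \<sigma>1 \<sigma>2 :: real
  assumes "n \<ge> 2"
    and "real n / 2 - 1 / 4 < \<sigma>1" and "\<sigma>1 < \<sigma>2" and "\<sigma>2 < real n / 2"
  shows "\<exists>C1 C2 :: real. 0 < C1 \<and> C1 < C2 \<and>
    (\<forall>\<^sub>F T in at_top.
       C1 * T \<le> of_int (zero_count (sphere_zeta n) \<sigma>1 \<sigma>2 T) \<and>
       of_int (zero_count (sphere_zeta n) \<sigma>1 \<sigma>2 T) \<le> C2 * T)"
proof -
  interpret zeta_minus_series "defect n" by (rule zeta_minus_series_defect[OF assms(1)])
  define \<alpha> where "\<alpha> = 2 * \<sigma>1 - (real n - 1)"
  define \<beta> where "\<beta> = 2 * \<sigma>2 - (real n - 1)"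
  have ab: "1/2 < \<alpha>" "\<alpha> < \<beta>" "\<beta> < 1" using assms by (auto simp: \<alpha>_def \<beta>_def field_simps)
  define N where "N = (\<lambda>T. real_of_int (\<Sum>z\<in>zeros \<alpha> \<beta> T. zorder xi z))"
  obtain A where A: "A > 0" "\<forall>\<^sub>F T in at_top. A * T \<le> N T"
    unfolding N_def using zero_count_lower[OF ab] by blast
  obtain B where B: "B > 0" "\<forall>\<^sub>F T in at_top. N T \<le> B * T"
    unfolding N_def using zero_count_upper[OF ab(1) _ ab(2)] ab by force
  have "filterlim (\<lambda>T::real. 2 * T) at_top at_top" by real_asymp
  from eventually_compose_filterlim[OF eventually_conj[OF A(2) B(2)] this]
  have "\<forall>\<^sub>F T in at_top. A * (2 * T) \<le> N (2 * T) \<and> N (2 * T) \<le> B * (2 * T)" .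
  \<comment> \<open>The upper constant is enlarged by 2A so that the strict inequality between the
    two constants is immediate.\<close>
  hence "\<forall>\<^sub>F T in at_top. (2 * A) * T \<le> N (2 * T) \<and> N (2 * T) \<le> (2 * A + 2 * B) * T"
    using eventually_ge_at_top[of 0] by eventually_elim (use A(1) in \<open>auto simp: algebra_simps intro: add_increasing\<close>)
  hence "\<forall>\<^sub>F T in at_top. (2 * A) * T \<le> of_int (zero_count (sphere_zeta n) \<sigma>1 \<sigma>2 T) \<and>
     of_int (zero_count (sphere_zeta n) \<sigma>1 \<sigma>2 T) \<le> (2 * A + 2 * B) * T"
    using zero_count_sphere_zeta[OF assms(1,2,4)] by (simp add: N_def \<alpha>_def \<beta>_def)
  thus ?thesis using A(1) B(1) by (intro exI[of _ "2 * A"] exI[of _ "2 * A + 2 * B"]) auto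
qed

end
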